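(* Let $S$ be a discrete inverse semigroupoid, $\mathcal{G}$ an ample (possibly non-Hausdorff) groupoid, $R$ a discrete unital ring, $A$ a discrete $R$-algebra, and $\theta\colon S\curvearrowright\mathcal{G}$ a continuous, associative and open $\land$-preaction of $S$ on $\mathcal{G}$. Consider the semidirect product semigroupoid $S\ltimes\mathcal{G}$, and let $\mathscr{G}(S\ltimes\mathcal{G})$ be the quotient of $S\ltimes\mathcal{G}$ by the relation \[(s_1,g_1)\sim(s_2,g_2)\iff g_1=g_2\text{ and there exists }u\leq s_1,s_2\text{ such that }g_1\in\operatorname{dom}(\theta_u)\] (the groupoid of germs of $\theta$). Let $\Theta$ be the $\land$-preaction of $S$ on $A\mathcal{G}$ induced by $\theta$: given $s\in S$, \[\operatorname{dom}(\Theta_s)=\{f\in A\mathcal{G}:f=0\text{ outside }\operatorname{dom}(\theta_s)\},\] and $\Theta_s(f)=f\circ\theta_s^{-1}$ on $\operatorname{ran}(\theta_s)$ and $0$ everywhere else. Then $A(\mathscr{G}(S\ltimes\mathcal{G}))$ is isomorphic to the quotient of $S\bigstar(A\mathcal{G})$ by the ideal generated by the elements $\delta_sa-\delta_ta$, where $s\leq t$ in $S$ and $a\in\operatorname{dom}(\Theta_s)\cap\operatorname{dom}(\Theta_t)$.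
   Context: An algebra over a (possibly non-commutative) ring $R$ is a ring $A$ with an $R$-bimodule structure with $(ra)b=r(ab)$, $(ar)b=a(rb)$, $(ab)r=a(br)$. A semigroupoid $\Lambda$ is a directed graph with vertex set $\Lambda^{(0)}$, source and range maps $\mathfrak{s},\mathfrak{r}\colon\Lambda\to\Lambda^{(0)}$, and an associative product $\Lambda^{(2)}=\{(a,b):\mathfrak{s}(a)=\mathfrak{r}(b)\}\to\Lambda$ with $\mathfrak{s}(ab)=\mathfrak{s}(b)$, $\mathfrak{r}(ab)=\mathfrak{r}(a)$. A homomorphism $\phi$ satisfies: $(a,b)$ composable implies $(\phi(a),\phi(b))$ composable and $\phi(ab)=\phi(a)\phi(b)$; an isomorphism is a bijective homomorphism whose inverse is a homomorphism. An ideal of $\Lambda$ is a subset $I$ with $I\Lambda\cup\Lambda I\subseteq I$. Topological semigroupoid: $\mathfrak{s},\mathfrak{r}$ and product continuous. Étale: $\mathfrak{s},\mathfrak{r}$ are local homeomorphisms and $\Lambda^{(0)}$ is locally compact Hausdorff. A bisection is a set on which $\mathfrak{s}$ and $\mathfrak{r}$ are injective. An ample groupoid is a topological (étale) groupoid, with locally compact Hausdorff unit space, having a basis of compact-open bisections. An inverse semigroupoid is a semigroupoid $S$ in which every $s$ has a unique $s^*$ with $\mathfrak{s}(s)=\mathfrak{r}(s^* )$, $\mathfrak{r}(s)=\mathfrak{s}(s^* )$, $ss^*s=s$, $s^*ss^*=s^*$. Its canonical order: $s\le t$ iff $\mathfrak{s}(s)=\mathfrak{s}(t)$, $\mathfrak{r}(s)=\mathfrak{r}(t)$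 and $s=ts^*s$. For partial functions, $gf$ is defined on the largest domain where $g(f(x))$ makes sense. A $\land$-preaction $\theta$ of $S$ on a semigroupoid $\Lambda$ is a family of maps $\{\theta_s\}_{s\in S}$ such that: (i) for all $v\in S^{(0)}$, $I(\theta,v)=\bigcup_{\mathfrak{s}(s)=v}\operatorname{dom}(\theta_s)$ is an ideal of $\Lambda$; (ii) $\operatorname{dom}(\theta_s)$ is an ideal of $I(\theta,\mathfrak{s}(s))$, $\operatorname{ran}(\theta_s)$ is an ideal of $I(\theta,\mathfrak{r}(s))$, and $\theta_s\colon\operatorname{dom}(\theta_s)\to\operatorname{ran}(\theta_s)$ is a semigroupoid isomorphism; (iii) $\theta_{s^*}=\theta_s^{-1}$; (iv) for $(s,t)\in S^{(2)}$, $\theta_{st}$ extends $\theta_s\theta_t$. It is associative if for all $s,t,u$ with $stu$ defined and all $(a,b,c)\in\operatorname{dom}(\theta_s)\times\operatorname{dom}(\theta_t)\times\operatorname{ran}(\theta_u)$ (with the products defined), $\theta_{t^*}(a\theta_t(b))c=\theta_{t^*}(a\theta_t(bc))$. The semidirect product is $S\ltimes\Lambda=\{(s,a)\in S\times\Lambda:a\in\operatorname{dom}(\theta_s)\}$ (subspace topology), over vertex set $S^{(0)}\times\Lambda^{(0)}$, with $\mathfrak{s}(s,a)=(\mathfrak{s}(s),\mathfrak{s}(a))$, $\mathfrak{r}(s,a)=(\mathfrak{r}(s),\mathfrak{r}(\theta_s(a)))$ and $(s,a)(t,b)=(st,\theta_{t^*}(a\theta_t(b)))$. $\theta$ is continuous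 (open) if the action map $S\ltimes\Lambda\to\Lambda$, $(s,a)\mapsto\theta_s(a)$, is continuous (open). The quotient $\mathscr{G}(S\ltimes\mathcal{G})$ carries the quotient topology, the same vertex space, and the source, range and product induced from $S\ltimes\mathcal{G}$. For an étale semigroupoid $\Gamma$ with a basis of compact-open sets, $A\Gamma$ is the algebra generated by (additive span of) all functions $f\colon\Gamma\to A$ for which there is an open Hausdorff $V\subseteq\Gamma$ with $f=0$ outside $V$ and $f|_V$ continuous and compactly supported; bimodule structure pointwise, product $(f\ast g)(\gamma)=\sum_{ab=\gamma}f(a)g(b)$. For $S$ discrete and $\Theta$ on an algebra $B$, the naïve crossed product $S\bigstar B$ is the set of finitely supported functions $f\colon S\to B$ with $f(s)\in\operatorname{dom}(\Theta_s)$ for all $s$, with pointwise bimodule structure and $(f\ast g)(s)=\sum_{xy=s}\Theta_{y^*}\big(f(x)\Theta_y(g(y))\big)$. For $a\in\operatorname{dom}(\Theta_s)$, $\delta_sa\in S\bigstar B$ is the function taking $s$ to $a$ and every other element to $0$. *)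

theory Defs
  imports "HOL-Algebra.QuotRing" "HOL-Analysis.Analysis"
begin

subsection \<open>Algebras over a possibly non-commutative ring\<close>

text \<open>Algebras need not be unital: as for the library's record \<open>module\<close>, the field \<open>one\<close> inherited
  from \<open>ring\<close> carries no meaning and is left undefined below.\<close>

record ('r, 'a) bimod_algebra = "'a ring" +
  lsmult :: "'r \<Rightarrow> 'a \<Rightarrow> 'a" (infixr "\<triangleright>\<index>" 70)
  rsmult :: "'a \<Rightarrow> 'r \<Rightarrow> 'a" (infixl "\<triangleleft>\<index>" 70)

locale bimod_algebra = R: ring R + abelian_group A
  for R :: "('r, 'm) ring_scheme" and A :: "('r, 'a, 'k) bimod_algebra_scheme" (structure) +
  assumes m_closed: "\<lbrakk>a \<in> carrier A; b \<in> carrier A\<rbrakk> \<Longrightarrow> a \<otimes> b \<in> carrier A"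
    and m_assoc: "\<lbrakk>a \<in> carrier A; b \<in> carrier A; c \<in> carrier A\<rbrakk> \<Longrightarrow> (a \<otimes> b) \<otimes> c = a \<otimes> (b \<otimes> c)"
    and l_distr: "\<lbrakk>a \<in> carrier A; b \<in> carrier A; c \<in> carrier A\<rbrakk> \<Longrightarrow> (a \<oplus> b) \<otimes> c = a \<otimes> c \<oplus> b \<otimes> c"
    and r_distr: "\<lbrakk>a \<in> carrier A; b \<in> carrier A; c \<in> carrier A\<rbrakk> \<Longrightarrow> c \<otimes> (a \<oplus> b) = c \<otimes> a \<oplus> c \<otimes> b"
    and lsmult_closed: "\<lbrakk>r \<in> carrier R; a \<in> carrier A\<rbrakk> \<Longrightarrow> r \<triangleright> a \<in> carrier A"
    and lsmult_l_distr: "\<lbrakk>r \<in> carrier R; s \<in> carrier R; a \<in> carrier A\<rbrakk> \<Longrightarrow>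
          (r \<oplus>\<^bsub>R\<^esub> s) \<triangleright> a = r \<triangleright> a \<oplus> s \<triangleright> a"
    and lsmult_r_distr: "\<lbrakk>r \<in> carrier R; a \<in> carrier A; b \<in> carrier A\<rbrakk> \<Longrightarrow>
          r \<triangleright> (a \<oplus> b) = r \<triangleright> a \<oplus> r \<triangleright> b"
    and lsmult_assoc: "\<lbrakk>r \<in> carrier R; s \<in> carrier R; a \<in> carrier A\<rbrakk> \<Longrightarrow>
          (r \<otimes>\<^bsub>R\<^esub> s) \<triangleright> a = r \<triangleright> (s \<triangleright> a)"
    and lsmult_one: "a \<in> carrier A \<Longrightarrow> \<one>\<^bsub>R\<^esub> \<triangleright> a = a"
    and rsmult_closed: "\<lbrakk>r \<in> carrier R; a \<in> carrier A\<rbrakk> \<Longrightarrow> a \<triangleleft> r \<in> carrier A"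
    and rsmult_r_distr: "\<lbrakk>r \<in> carrier R; s \<in> carrier R; a \<in> carrier A\<rbrakk> \<Longrightarrow>
          a \<triangleleft> (r \<oplus>\<^bsub>R\<^esub> s) = a \<triangleleft> r \<oplus> a \<triangleleft> s"
    and rsmult_l_distr: "\<lbrakk>r \<in> carrier R; a \<in> carrier A; b \<in> carrier A\<rbrakk> \<Longrightarrow>
          (a \<oplus> b) \<triangleleft> r = a \<triangleleft> r \<oplus> b \<triangleleft> r"
    and rsmult_assoc: "\<lbrakk>r \<in> carrier R; s \<in> carrier R; a \<in> carrier A\<rbrakk> \<Longrightarrow>
          a \<triangleleft> (r \<otimes>\<^bsub>R\<^esub> s) = (a \<triangleleft> r) \<triangleleft> s"
    and rsmult_one: "a \<in> carrier A \<Longrightarrow> a \<triangleleft> \<one>\<^bsub>R\<^esub> = a"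
    and smult_comm: "\<lbrakk>r \<in> carrier R; s \<in> carrier R; a \<in> carrier A\<rbrakk> \<Longrightarrow>
          (r \<triangleright> a) \<triangleleft> s = r \<triangleright> (a \<triangleleft> s)"
    and lsmult_mult: "\<lbrakk>r \<in> carrier R; a \<in> carrier A; b \<in> carrier A\<rbrakk> \<Longrightarrow>
          (r \<triangleright> a) \<otimes> b = r \<triangleright> (a \<otimes> b)"
    and smult_balanced: "\<lbrakk>r \<in> carrier R; a \<in> carrier A; b \<in> carrier A\<rbrakk> \<Longrightarrow>
          (a \<triangleleft> r) \<otimes> b = a \<otimes> (r \<triangleright> b)"
    and rsmult_mult: "\<lbrakk>r \<in> carrier R; a \<in> carrier A; b \<in> carrier A\<rbrakk> \<Longrightarrow>
          (a \<otimes> b) \<triangleleft> r = a \<otimes> (b \<triangleleft> r)"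

definition bimod_algebra_ideal ::
    "('r, 'm) ring_scheme \<Rightarrow> 'b set \<Rightarrow> ('r, 'b, 'k) bimod_algebra_scheme \<Rightarrow> bool" where
  "bimod_algebra_ideal R I B \<longleftrightarrow> additive_subgroup I B \<and>
     (\<forall>x\<in>I. \<forall>b\<in>carrier B. x \<otimes>\<^bsub>B\<^esub> b \<in> I \<and> b \<otimes>\<^bsub>B\<^esub> x \<in> I) \<and>
     (\<forall>x\<in>I. \<forall>r\<in>carrier R. r \<triangleright>\<^bsub>B\<^esub> x \<in> I \<and> x \<triangleleft>\<^bsub>B\<^esub> r \<in> I)"

definition bimod_algebra_genideal ::
    "('r, 'm) ring_scheme \<Rightarrow> ('r, 'b, 'k) bimod_algebra_scheme \<Rightarrow> 'b set \<Rightarrow> 'b set" where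
  "bimod_algebra_genideal R B X = \<Inter>{I. bimod_algebra_ideal R I B \<and> X \<subseteq> I}"

definition bimod_algebra_quotient ::
    "('r, 'b, 'k) bimod_algebra_scheme \<Rightarrow> 'b set \<Rightarrow> ('r, 'b set) bimod_algebra" where
  "bimod_algebra_quotient B I =
    \<lparr> carrier = a_rcosets\<^bsub>B\<^esub> I,
      monoid.mult = rcoset_mult B I,
      one = undefined,
      zero = I,
      add = set_add B,
      lsmult = (\<lambda>r X. \<Union>x\<in>X. I +>\<^bsub>B\<^esub> (r \<triangleright>\<^bsub>B\<^esub> x)),
      rsmult = (\<lambda>X r. \<Union>x\<in>X. I +>\<^bsub>B\<^esub> (x \<triangleleft>\<^bsub>B\<^esub> r)) \<rparr>"

definition bimod_algebra_isomorphic ::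
    "('r, 'm) ring_scheme \<Rightarrow> ('r, 'b, 'k) bimod_algebra_scheme \<Rightarrow> ('r, 'c, 'l) bimod_algebra_scheme \<Rightarrow> bool" where
  "bimod_algebra_isomorphic R B C \<longleftrightarrow> (\<exists>\<phi>. bij_betw \<phi> (carrier B) (carrier C) \<and>
     (\<forall>x\<in>carrier B. \<forall>y\<in>carrier B. \<phi> (x \<oplus>\<^bsub>B\<^esub> y) = \<phi> x \<oplus>\<^bsub>C\<^esub> \<phi> y) \<and>
     (\<forall>x\<in>carrier B. \<forall>y\<in>carrier B. \<phi> (x \<otimes>\<^bsub>B\<^esub> y) = \<phi> x \<otimes>\<^bsub>C\<^esub> \<phi> y) \<and>
     (\<forall>r\<in>carrier R. \<forall>x\<in>carrier B. \<phi> (r \<triangleright>\<^bsub>B\<^esub> x) = r \<triangleright>\<^bsub>C\<^esub> \<phi> x) \<and>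
     (\<forall>r\<in>carrier R. \<forall>x\<in>carrier B. \<phi> (x \<triangleleft>\<^bsub>B\<^esub> r) = \<phi> x \<triangleleft>\<^bsub>C\<^esub> r))"


subsection \<open>Semigroupoids\<close>

record ('g, 'v) semigroupoid =
  arr :: "'g set"
  vtx :: "'v set"
  src :: "'g \<Rightarrow> 'v"
  rng :: "'g \<Rightarrow> 'v"
  prd :: "'g \<Rightarrow> 'g \<Rightarrow> 'g" (infixl "\<cdot>\<index>" 70)

definition composable :: "('g, 'v, 'k) semigroupoid_scheme \<Rightarrow> 'g \<Rightarrow> 'g \<Rightarrow> bool" where
  "composable \<Lambda> a b \<longleftrightarrow> a \<in> arr \<Lambda> \<and> b \<in> arr \<Lambda> \<and> src \<Lambda> a = rng \<Lambda> b"

locale semigroupoid =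
  fixes \<Lambda> :: "('g, 'v, 'k) semigroupoid_scheme" (structure)
  assumes src_closed: "a \<in> arr \<Lambda> \<Longrightarrow> src \<Lambda> a \<in> vtx \<Lambda>"
    and rng_closed: "a \<in> arr \<Lambda> \<Longrightarrow> rng \<Lambda> a \<in> vtx \<Lambda>"
    and prd_closed: "composable \<Lambda> a b \<Longrightarrow> a \<cdot> b \<in> arr \<Lambda>"
    and src_prd: "composable \<Lambda> a b \<Longrightarrow> src \<Lambda> (a \<cdot> b) = src \<Lambda> b"
    and rng_prd: "composable \<Lambda> a b \<Longrightarrow> rng \<Lambda> (a \<cdot> b) = rng \<Lambda> a"
    and prd_assoc: "\<lbrakk>composable \<Lambda> a b; composable \<Lambda> b c\<rbrakk> \<Longrightarrow> (a \<cdot> b) \<cdot> c = a \<cdot> (b \<cdot> c)"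

definition semigroupoid_hom ::
    "('g, 'v, 'k) semigroupoid_scheme \<Rightarrow> ('h, 'w, 'l) semigroupoid_scheme \<Rightarrow> ('g \<Rightarrow> 'h) \<Rightarrow> bool" where
  "semigroupoid_hom \<Lambda> \<Gamma> \<phi> \<longleftrightarrow> \<phi> \<in> arr \<Lambda> \<rightarrow> arr \<Gamma> \<and>
     (\<forall>a b. composable \<Lambda> a b \<longrightarrow>
        composable \<Gamma> (\<phi> a) (\<phi> b) \<and> \<phi> (a \<cdot>\<^bsub>\<Lambda>\<^esub> b) = \<phi> a \<cdot>\<^bsub>\<Gamma>\<^esub> \<phi> b)"

definition semigroupoid_iso ::
    "('g, 'v, 'k) semigroupoid_scheme \<Rightarrow> ('h, 'w, 'l) semigroupoid_scheme \<Rightarrow> ('g \<Rightarrow> 'h) \<Rightarrow> bool" where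
  "semigroupoid_iso \<Lambda> \<Gamma> \<phi> \<longleftrightarrow> bij_betw \<phi> (arr \<Lambda>) (arr \<Gamma>) \<and>
     semigroupoid_hom \<Lambda> \<Gamma> \<phi> \<and> semigroupoid_hom \<Gamma> \<Lambda> (inv_into (arr \<Lambda>) \<phi>)"

definition semigroupoid_ideal :: "('g, 'v, 'k) semigroupoid_scheme \<Rightarrow> 'g set \<Rightarrow> bool" where
  "semigroupoid_ideal \<Lambda> I \<longleftrightarrow> I \<subseteq> arr \<Lambda> \<and>
     (\<forall>a b. composable \<Lambda> a b \<and> (a \<in> I \<or> b \<in> I) \<longrightarrow> a \<cdot>\<^bsub>\<Lambda>\<^esub> b \<in> I)"

definition is_star :: "('g, 'v, 'k) semigroupoid_scheme \<Rightarrow> 'g \<Rightarrow> 'g \<Rightarrow> bool" where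
  "is_star S s t \<longleftrightarrow> s \<in> arr S \<and> t \<in> arr S \<and> src S s = rng S t \<and> rng S s = src S t \<and>
     s \<cdot>\<^bsub>S\<^esub> t \<cdot>\<^bsub>S\<^esub> s = s \<and> t \<cdot>\<^bsub>S\<^esub> s \<cdot>\<^bsub>S\<^esub> t = t"

locale inverse_semigroupoid = semigroupoid S
  for S :: "('s, 'w, 'k) semigroupoid_scheme" (structure) +
  assumes ex1_star: "s \<in> arr S \<Longrightarrow> \<exists>!t. is_star S s t"

definition star :: "('g, 'v, 'k) semigroupoid_scheme \<Rightarrow> 'g \<Rightarrow> 'g" where
  "star S s = (THE t. is_star S s t)"

definition canonical_le :: "('s, 'w, 'k) semigroupoid_scheme \<Rightarrow> 's \<Rightarrow> 's \<Rightarrow> bool" where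
  "canonical_le S s t \<longleftrightarrow> s \<in> arr S \<and> t \<in> arr S \<and> src S s = src S t \<and> rng S s = rng S t \<and>
     s = t \<cdot>\<^bsub>S\<^esub> star S s \<cdot>\<^bsub>S\<^esub> s"

definition is_identity :: "('g, 'v, 'k) semigroupoid_scheme \<Rightarrow> 'v \<Rightarrow> 'g \<Rightarrow> bool" where
  "is_identity \<G> v e \<longleftrightarrow> e \<in> arr \<G> \<and> src \<G> e = v \<and> rng \<G> e = v \<and>
     (\<forall>a\<in>arr \<G>. (src \<G> a = v \<longrightarrow> a \<cdot>\<^bsub>\<G>\<^esub> e = a) \<and> (rng \<G> a = v \<longrightarrow> e \<cdot>\<^bsub>\<G>\<^esub> a = a))"

definition is_groupoid_inverse :: "('g, 'v, 'k) semigroupoid_scheme \<Rightarrow> 'g \<Rightarrow> 'g \<Rightarrow> bool" where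
  "is_groupoid_inverse \<G> a b \<longleftrightarrow> composable \<G> a b \<and> composable \<G> b a \<and>
     is_identity \<G> (rng \<G> a) (a \<cdot>\<^bsub>\<G>\<^esub> b) \<and> is_identity \<G> (src \<G> a) (b \<cdot>\<^bsub>\<G>\<^esub> a)"

locale groupoid = semigroupoid \<G>
  for \<G> :: "('g, 'v, 'k) semigroupoid_scheme" (structure) +
  assumes ex_identity: "v \<in> vtx \<G> \<Longrightarrow> \<exists>e. is_identity \<G> v e"
    and ex_inverse: "a \<in> arr \<G> \<Longrightarrow> \<exists>b. is_groupoid_inverse \<G> a b"


subsection \<open>Topological semigroupoids and ample groupoids\<close>

record ('g, 'v) top_semigroupoid = "('g, 'v) semigroupoid" +
  atop :: "'g topology"
  vtop :: "'v topology"

locale top_semigroupoid = semigroupoid \<Lambda>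
  for \<Lambda> :: "('g, 'v, 'k) top_semigroupoid_scheme" (structure) +
  assumes topspace_atop: "topspace (atop \<Lambda>) = arr \<Lambda>"
    and topspace_vtop: "topspace (vtop \<Lambda>) = vtx \<Lambda>"
    and continuous_src: "continuous_map (atop \<Lambda>) (vtop \<Lambda>) (src \<Lambda>)"
    and continuous_rng: "continuous_map (atop \<Lambda>) (vtop \<Lambda>) (rng \<Lambda>)"
    and continuous_prd: "continuous_map
          (subtopology (prod_topology (atop \<Lambda>) (atop \<Lambda>)) {(a, b). composable \<Lambda> a b})
          (atop \<Lambda>) (\<lambda>(a, b). a \<cdot> b)"

definition discrete_semigroupoid :: "('g, 'v, 'k) top_semigroupoid_scheme \<Rightarrow> bool" where
  "discrete_semigroupoid S \<longleftrightarrow>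
     atop S = discrete_topology (arr S) \<and> vtop S = discrete_topology (vtx S)"

definition local_homeomorphism_map :: "'a topology \<Rightarrow> 'b topology \<Rightarrow> ('a \<Rightarrow> 'b) \<Rightarrow> bool" where
  "local_homeomorphism_map X Y f \<longleftrightarrow> (\<forall>x\<in>topspace X. \<exists>U. openin X U \<and> x \<in> U \<and> openin Y (f ` U) \<and>
     homeomorphic_map (subtopology X U) (subtopology Y (f ` U)) f)"

locale etale_semigroupoid = top_semigroupoid \<Lambda>
  for \<Lambda> :: "('g, 'v, 'k) top_semigroupoid_scheme" (structure) +
  assumes local_homeo_src: "local_homeomorphism_map (atop \<Lambda>) (vtop \<Lambda>) (src \<Lambda>)"
    and local_homeo_rng: "local_homeomorphism_map (atop \<Lambda>) (vtop \<Lambda>) (rng \<Lambda>)"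
    and locally_compact_vtop: "locally_compact_space (vtop \<Lambda>)"
    and Hausdorff_vtop: "Hausdorff_space (vtop \<Lambda>)"

definition bisection :: "('g, 'v, 'k) semigroupoid_scheme \<Rightarrow> 'g set \<Rightarrow> bool" where
  "bisection \<Lambda> U \<longleftrightarrow> U \<subseteq> arr \<Lambda> \<and> inj_on (src \<Lambda>) U \<and> inj_on (rng \<Lambda>) U"

text \<open>The unit space is the vertex space. The unit map \<open>v \<mapsto> id\<^sub>v\<close> is automatically continuous,
  since \<open>a \<mapsto> a\<^sup>-\<^sup>1a\<close> is continuous and the source map is an open continuous surjection.\<close>

locale ample_groupoid = groupoid \<G> + etale_semigroupoid \<G>
  for \<G> :: "('g, 'v, 'k) top_semigroupoid_scheme" (structure) +
  assumes continuous_inverse: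
      "continuous_map (atop \<G>) (atop \<G>) (\<lambda>a. THE b. is_groupoid_inverse \<G> a b)"
    and compact_open_bisection_basis: "\<lbrakk>openin (atop \<G>) W; a \<in> W\<rbrakk> \<Longrightarrow>
      \<exists>U. openin (atop \<G>) U \<and> compactin (atop \<G>) U \<and> bisection \<G> U \<and> a \<in> U \<and> U \<subseteq> W"


subsection \<open>Preactions, semidirect products and germs\<close>

text \<open>A family of partial maps \<open>\<theta>\<^sub>s\<close> is a function \<open>\<theta>\<close> with values in \<open>'g \<rightharpoonup> 'g\<close>. For a subset \<open>I\<close> of the
  arrows, \<open>\<Lambda>\<lparr>arr := I\<rparr>\<close> is \<open>I\<close> regarded as a semigroupoid with the product of \<open>\<Lambda>\<close>.\<close>

definition preaction_ideal ::
    "('s, 'w, 'k) semigroupoid_scheme \<Rightarrow> ('s \<Rightarrow> 'g \<rightharpoonup> 'g) \<Rightarrow> 'w \<Rightarrow> 'g set" where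
  "preaction_ideal S \<theta> v = (\<Union>s\<in>{s \<in> arr S. src S s = v}. dom (\<theta> s))"

locale wedge_preaction =
  fixes S :: "('s, 'w, 'k) semigroupoid_scheme"
    and \<Lambda> :: "('g, 'v, 'l) semigroupoid_scheme"
    and \<theta> :: "'s \<Rightarrow> 'g \<rightharpoonup> 'g"
  assumes preaction_ideal_ideal: "v \<in> vtx S \<Longrightarrow> semigroupoid_ideal \<Lambda> (preaction_ideal S \<theta> v)"
    and dom_ideal: "s \<in> arr S \<Longrightarrow>
      semigroupoid_ideal (\<Lambda>\<lparr>arr := preaction_ideal S \<theta> (src S s)\<rparr>) (dom (\<theta> s))"
    and ran_ideal: "s \<in> arr S \<Longrightarrow>
      semigroupoid_ideal (\<Lambda>\<lparr>arr := preaction_ideal S \<theta> (rng S s)\<rparr>) (ran (\<theta> s))"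
    and preaction_iso: "s \<in> arr S \<Longrightarrow>
      semigroupoid_iso (\<Lambda>\<lparr>arr := dom (\<theta> s)\<rparr>) (\<Lambda>\<lparr>arr := ran (\<theta> s)\<rparr>) (\<lambda>a. the (\<theta> s a))"
    and preaction_star: "s \<in> arr S \<Longrightarrow> \<theta> (star S s) b = Some a \<longleftrightarrow> \<theta> s a = Some b"
    and preaction_prd: "composable S s t \<Longrightarrow> (\<theta> s \<circ>\<^sub>m \<theta> t) \<subseteq>\<^sub>m \<theta> (s \<cdot>\<^bsub>S\<^esub> t)"

text \<open>All four products of \<open>\<Lambda>\<close> occurring in the identity are required to be defined.\<close>

definition associative_preaction ::
    "('s, 'w, 'k) semigroupoid_scheme \<Rightarrow> ('g, 'v, 'l) semigroupoid_scheme \<Rightarrow> ('s \<Rightarrow> 'g \<rightharpoonup> 'g) \<Rightarrow> bool" where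
  "associative_preaction S \<Lambda> \<theta> \<longleftrightarrow> (\<forall>s t u a b c.
     let \<theta>t = (\<lambda>x. the (\<theta> t x)); \<theta>t' = (\<lambda>x. the (\<theta> (star S t) x)) in
       composable S s t \<and> composable S t u \<and> a \<in> dom (\<theta> s) \<and> b \<in> dom (\<theta> t) \<and> c \<in> ran (\<theta> u) \<and>
       composable \<Lambda> a (\<theta>t b) \<and> composable \<Lambda> (\<theta>t' (a \<cdot>\<^bsub>\<Lambda>\<^esub> \<theta>t b)) c \<and>
       composable \<Lambda> b c \<and> composable \<Lambda> a (\<theta>t (b \<cdot>\<^bsub>\<Lambda>\<^esub> c)) \<longrightarrow>
       \<theta>t' (a \<cdot>\<^bsub>\<Lambda>\<^esub> \<theta>t b) \<cdot>\<^bsub>\<Lambda>\<^esub> c = \<theta>t' (a \<cdot>\<^bsub>\<Lambda>\<^esub> \<theta>t (b \<cdot>\<^bsub>\<Lambda>\<^esub> c)))"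

definition semidirect_product ::
    "('s, 'w, 'k) top_semigroupoid_scheme \<Rightarrow> ('g, 'v, 'l) top_semigroupoid_scheme \<Rightarrow>
     ('s \<Rightarrow> 'g \<rightharpoonup> 'g) \<Rightarrow> ('s \<times> 'g, 'w \<times> 'v) top_semigroupoid" where
  "semidirect_product S \<Lambda> \<theta> =
    (let X = {(s, a). s \<in> arr S \<and> a \<in> arr \<Lambda> \<and> a \<in> dom (\<theta> s)} in
    \<lparr> arr = X,
      vtx = vtx S \<times> vtx \<Lambda>,
      src = (\<lambda>(s, a). (src S s, src \<Lambda> a)),
      rng = (\<lambda>(s, a). (rng S s, rng \<Lambda> (the (\<theta> s a)))),
      prd = (\<lambda>(s, a) (t, b). (s \<cdot>\<^bsub>S\<^esub> t, the (\<theta> (star S t) (a \<cdot>\<^bsub>\<Lambda>\<^esub> the (\<theta> t b))))),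
      atop = subtopology (prod_topology (atop S) (atop \<Lambda>)) X,
      vtop = prod_topology (vtop S) (vtop \<Lambda>) \<rparr>)"

definition action_map :: "('s \<Rightarrow> 'g \<rightharpoonup> 'g) \<Rightarrow> 's \<times> 'g \<Rightarrow> 'g" where
  "action_map \<theta> = (\<lambda>(s, a). the (\<theta> s a))"

definition continuous_preaction ::
    "('s, 'w, 'k) top_semigroupoid_scheme \<Rightarrow> ('g, 'v, 'l) top_semigroupoid_scheme \<Rightarrow>
     ('s \<Rightarrow> 'g \<rightharpoonup> 'g) \<Rightarrow> bool" where
  "continuous_preaction S \<Lambda> \<theta> \<longleftrightarrow>
     continuous_map (atop (semidirect_product S \<Lambda> \<theta>)) (atop \<Lambda>) (action_map \<theta>)"

definition open_preaction ::
    "('s, 'w, 'k) top_semigroupoid_scheme \<Rightarrow> ('g, 'v, 'l) top_semigroupoid_scheme \<Rightarrow>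
     ('s \<Rightarrow> 'g \<rightharpoonup> 'g) \<Rightarrow> bool" where
  "open_preaction S \<Lambda> \<theta> \<longleftrightarrow>
     open_map (atop (semidirect_product S \<Lambda> \<theta>)) (atop \<Lambda>) (action_map \<theta>)"

definition quotient_topology :: "'a topology \<Rightarrow> ('a \<Rightarrow> 'b) \<Rightarrow> 'b topology" where
  "quotient_topology X q =
     topology (\<lambda>U. U \<subseteq> q ` topspace X \<and> openin X {x \<in> topspace X. q x \<in> U})"

lemma openin_quotient_topology:
  "openin (quotient_topology X q) U \<longleftrightarrow>
     U \<subseteq> q ` topspace X \<and> openin X {x \<in> topspace X. q x \<in> U}"
proof -
  have "istopology (\<lambda>U. U \<subseteq> q ` topspace X \<and> openin X {x \<in> topspace X. q x \<in> U})"
    unfolding istopology_def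
  proof (intro conjI allI impI)
    fix U V
    assume U: "U \<subseteq> q ` topspace X \<and> openin X {x \<in> topspace X. q x \<in> U}"
      and V: "V \<subseteq> q ` topspace X \<and> openin X {x \<in> topspace X. q x \<in> V}"
    show "U \<inter> V \<subseteq> q ` topspace X" using U by blast
    have "{x \<in> topspace X. q x \<in> U \<inter> V} =
        {x \<in> topspace X. q x \<in> U} \<inter> {x \<in> topspace X. q x \<in> V}" by blast
    then show "openin X {x \<in> topspace X. q x \<in> U \<inter> V}" using U V by (simp add: openin_Int)
  next
    fix \<U>
    assume \<U>: "\<forall>K\<in>\<U>. K \<subseteq> q ` topspace X \<and> openin X {x \<in> topspace X. q x \<in> K}"
    show "\<Union>\<U> \<subseteq> q ` topspace X" using \<U> by blast
    have "{x \<in> topspace X. q x \<in> \<Union>\<U>} = (\<Union>K\<in>\<U>. {x \<in> topspace X. q x \<in> K})" by blast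
    then show "openin X {x \<in> topspace X. q x \<in> \<Union>\<U>}" using \<U> by auto
  qed
  then show ?thesis by (simp add: quotient_topology_def topology_inverse')
qed

lemma quotient_map_quotient_topology: "quotient_map X (quotient_topology X q) q"
proof -
  have "openin (quotient_topology X q) (q ` topspace X)"
    unfolding openin_quotient_topology by (auto intro: openin_subopen[THEN iffD2])
  then have "topspace (quotient_topology X q) = q ` topspace X"
    by (meson openin_quotient_topology openin_subset openin_topspace subset_antisym)
  then show ?thesis
    unfolding quotient_map_def by (simp add: openin_quotient_topology)
qed

definition germ_rel ::
    "('s, 'w, 'k) top_semigroupoid_scheme \<Rightarrow> ('g, 'v, 'l) top_semigroupoid_scheme \<Rightarrow>
     ('s \<Rightarrow> 'g \<rightharpoonup> 'g) \<Rightarrow> (('s \<times> 'g) \<times> ('s \<times> 'g)) set" where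
  "germ_rel S \<Lambda> \<theta> = {((s\<^sub>1, g\<^sub>1), (s\<^sub>2, g\<^sub>2)).
     (s\<^sub>1, g\<^sub>1) \<in> arr (semidirect_product S \<Lambda> \<theta>) \<and> (s\<^sub>2, g\<^sub>2) \<in> arr (semidirect_product S \<Lambda> \<theta>) \<and>
     g\<^sub>1 = g\<^sub>2 \<and> (\<exists>u. canonical_le S u s\<^sub>1 \<and> canonical_le S u s\<^sub>2 \<and> g\<^sub>1 \<in> dom (\<theta> u))}"

text \<open>Source and range are constant on germ classes, so \<open>the_elem\<close> extracts that constant; in the
  product of two composable classes all the classes in the union coincide.\<close>

definition germ_groupoid ::
    "('s, 'w, 'k) top_semigroupoid_scheme \<Rightarrow> ('g, 'v, 'l) top_semigroupoid_scheme \<Rightarrow>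
     ('s \<Rightarrow> 'g \<rightharpoonup> 'g) \<Rightarrow> (('s \<times> 'g) set, 'w \<times> 'v) top_semigroupoid" where
  "germ_groupoid S \<Lambda> \<theta> =
    (let P = semidirect_product S \<Lambda> \<theta>; E = germ_rel S \<Lambda> \<theta> in
    \<lparr> arr = arr P // E,
      vtx = vtx P,
      src = (\<lambda>c. the_elem (src P ` c)),
      rng = (\<lambda>c. the_elem (rng P ` c)),
      prd = (\<lambda>c d. \<Union>x\<in>c. \<Union>y\<in>d. E `` {x \<cdot>\<^bsub>P\<^esub> y}),
      atop = quotient_topology (atop P) (\<lambda>x. E `` {x}),
      vtop = vtop P \<rparr>)"


subsection \<open>The algebra of an etale semigroupoid\<close>

text \<open>The coefficient algebra \<open>A\<close> is discrete. Functions on \<open>\<Gamma>\<close> are extended by zero outside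
  its arrows.\<close>

definition steinberg_generators ::
    "('r, 'a, 'k) bimod_algebra_scheme \<Rightarrow> ('g, 'v, 'l) top_semigroupoid_scheme \<Rightarrow> ('g \<Rightarrow> 'a) set" where
  "steinberg_generators A \<Gamma> = {f. \<exists>V. openin (atop \<Gamma>) V \<and> Hausdorff_space (subtopology (atop \<Gamma>) V) \<and>
     (\<forall>x. x \<notin> V \<longrightarrow> f x = \<zero>\<^bsub>A\<^esub>) \<and>
     continuous_map (subtopology (atop \<Gamma>) V) (discrete_topology (carrier A)) f \<and>
     compactin (subtopology (atop \<Gamma>) V)
       (subtopology (atop \<Gamma>) V closure_of {x \<in> V. f x \<noteq> \<zero>\<^bsub>A\<^esub>})}"

inductive_set steinberg_functions ::
    "('r, 'a, 'k) bimod_algebra_scheme \<Rightarrow> ('g, 'v, 'l) top_semigroupoid_scheme \<Rightarrow> ('g \<Rightarrow> 'a) set"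
  for A :: "('r, 'a, 'k) bimod_algebra_scheme" and \<Gamma> :: "('g, 'v, 'l) top_semigroupoid_scheme" where
  generator: "f \<in> steinberg_generators A \<Gamma> \<Longrightarrow> f \<in> steinberg_functions A \<Gamma>"
| zero: "(\<lambda>_. \<zero>\<^bsub>A\<^esub>) \<in> steinberg_functions A \<Gamma>"
| minus: "f \<in> steinberg_functions A \<Gamma> \<Longrightarrow> (\<lambda>x. \<ominus>\<^bsub>A\<^esub> f x) \<in> steinberg_functions A \<Gamma>"
| add: "\<lbrakk>f \<in> steinberg_functions A \<Gamma>; g \<in> steinberg_functions A \<Gamma>\<rbrakk> \<Longrightarrow>
    (\<lambda>x. f x \<oplus>\<^bsub>A\<^esub> g x) \<in> steinberg_functions A \<Gamma>"

text \<open>In \<open>convolution\<close> and in \<open>crossed_mult\<close> below, the index set is restricted to the pairs at which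
  neither factor vanishes. The omitted summands are zero, and \<open>finsum\<close> is the sum only over a finite
  index set.\<close>

definition convolution ::
    "('r, 'a, 'k) bimod_algebra_scheme \<Rightarrow> ('g, 'v, 'l) top_semigroupoid_scheme \<Rightarrow>
     ('g \<Rightarrow> 'a) \<Rightarrow> ('g \<Rightarrow> 'a) \<Rightarrow> 'g \<Rightarrow> 'a" where
  "convolution A \<Gamma> f g = (\<lambda>\<gamma>. finsum A (\<lambda>(a, b). f a \<otimes>\<^bsub>A\<^esub> g b)
     {(a, b). composable \<Gamma> a b \<and> a \<cdot>\<^bsub>\<Gamma>\<^esub> b = \<gamma> \<and> f a \<noteq> \<zero>\<^bsub>A\<^esub> \<and> g b \<noteq> \<zero>\<^bsub>A\<^esub>})"

definition steinberg_algebra ::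
    "('r, 'a, 'k) bimod_algebra_scheme \<Rightarrow> ('g, 'v, 'l) top_semigroupoid_scheme \<Rightarrow>
     ('r, 'g \<Rightarrow> 'a) bimod_algebra" where
  "steinberg_algebra A \<Gamma> =
    \<lparr> carrier = steinberg_functions A \<Gamma>,
      monoid.mult = convolution A \<Gamma>,
      one = undefined,
      zero = (\<lambda>_. \<zero>\<^bsub>A\<^esub>),
      add = (\<lambda>f g x. f x \<oplus>\<^bsub>A\<^esub> g x),
      lsmult = (\<lambda>r f x. r \<triangleright>\<^bsub>A\<^esub> f x),
      rsmult = (\<lambda>f r x. f x \<triangleleft>\<^bsub>A\<^esub> r) \<rparr>"

definition induced_preaction ::
    "('r, 'a, 'k) bimod_algebra_scheme \<Rightarrow> ('g, 'v, 'l) top_semigroupoid_scheme \<Rightarrow>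
     ('s \<Rightarrow> 'g \<rightharpoonup> 'g) \<Rightarrow> 's \<Rightarrow> ('g \<Rightarrow> 'a) \<rightharpoonup> ('g \<Rightarrow> 'a)" where
  "induced_preaction A \<G> \<theta> s f =
    (if f \<in> carrier (steinberg_algebra A \<G>) \<and> (\<forall>x. x \<notin> dom (\<theta> s) \<longrightarrow> f x = \<zero>\<^bsub>A\<^esub>)
     then Some (\<lambda>y. if y \<in> ran (\<theta> s) then f (THE x. \<theta> s x = Some y) else \<zero>\<^bsub>A\<^esub>)
     else None)"


subsection \<open>The naive crossed product\<close>

definition crossed_mult ::
    "('s, 'w, 'k) semigroupoid_scheme \<Rightarrow> ('r, 'b, 'l) bimod_algebra_scheme \<Rightarrow> ('s \<Rightarrow> 'b \<rightharpoonup> 'b) \<Rightarrow>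
     ('s \<Rightarrow> 'b) \<Rightarrow> ('s \<Rightarrow> 'b) \<Rightarrow> 's \<Rightarrow> 'b" where
  "crossed_mult S B \<Theta> f g = (\<lambda>s.
     finsum B (\<lambda>(x, y). the (\<Theta> (star S y) (f x \<otimes>\<^bsub>B\<^esub> the (\<Theta> y (g y)))))
       {(x, y). composable S x y \<and> x \<cdot>\<^bsub>S\<^esub> y = s \<and> f x \<noteq> \<zero>\<^bsub>B\<^esub> \<and> g y \<noteq> \<zero>\<^bsub>B\<^esub>})"

definition crossed_product ::
    "('s, 'w, 'k) semigroupoid_scheme \<Rightarrow> ('r, 'b, 'l) bimod_algebra_scheme \<Rightarrow> ('s \<Rightarrow> 'b \<rightharpoonup> 'b) \<Rightarrow>
     ('r, 's \<Rightarrow> 'b) bimod_algebra" where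
  "crossed_product S B \<Theta> =
    \<lparr> carrier = {f. (\<forall>s\<in>arr S. f s \<in> dom (\<Theta> s)) \<and> (\<forall>s. s \<notin> arr S \<longrightarrow> f s = \<zero>\<^bsub>B\<^esub>) \<and>
                    finite {s. f s \<noteq> \<zero>\<^bsub>B\<^esub>}},
      monoid.mult = crossed_mult S B \<Theta>,
      one = undefined,
      zero = (\<lambda>_. \<zero>\<^bsub>B\<^esub>),
      add = (\<lambda>f g s. f s \<oplus>\<^bsub>B\<^esub> g s),
      lsmult = (\<lambda>r f s. r \<triangleright>\<^bsub>B\<^esub> f s),
      rsmult = (\<lambda>f r s. f s \<triangleleft>\<^bsub>B\<^esub> r) \<rparr>"

definition delta :: "('r, 'b, 'l) bimod_algebra_scheme \<Rightarrow> 's \<Rightarrow> 'b \<Rightarrow> 's \<Rightarrow> 'b" where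
  "delta B s a = (\<lambda>t. if t = s then a else \<zero>\<^bsub>B\<^esub>)"

end

theory Submission
  imports Defs
begin

text \<open>Write \<open>D\<^sub>s\<close> for the domain of \<open>\<theta>\<^sub>s\<close>, an open subset of \<open>\<G>\<close>. As a space, the semidirect product \<open>P\<close> is the disjoint
union of the sets \<open>D\<^sub>s\<close>, and an element \<open>f\<close> of the crossed product \<open>B\<close> can be read as the function
\<open>(s, g) \<mapsto> f s g\<close> on \<open>P\<close>. In this reading the crossed multiplication is convolution over \<open>P\<close>
(\<open>crossed_mult_value\<close>). The passage to germs maps each \<open>D\<^sub>s\<close> onto an open subset of the germ groupoid
\<open>\<Gamma>\<close> by an open embedding, and it preserves and reflects composability. Summing over its fibres,
\<open>pushforward f c = (\<Sum>(s, g)\<in>c. f s g)\<close>, is therefore a homomorphism from \<open>B\<close> to the algebra of \<open>\<Gamma>\<close>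
(\<open>pushforward_mult\<close>). It is onto, because \<open>\<Gamma>\<close> has a basis of images of compact open bisections \<open>U \<subseteq> D\<^sub>s\<close>
and a locally constant function on such an image lifts to \<open>U\<close>. What remains is to identify the kernel.

The elements \<open>\<delta>\<^sub>sa - \<delta>\<^sub>ta\<close> with \<open>s \<le> t\<close> lie in the kernel, since \<open>(s, g)\<close> and \<open>(t, g)\<close> have the same germ
whenever both exist. The converse inclusion is the heart of the matter, because neither \<open>\<G>\<close> nor \<open>\<Gamma>\<close>
is Hausdorff and intersections of compact open sets need not be compact. Suppose that functions
\<open>f\<^sub>1, \<dots>, f\<^sub>n\<close>, each locally constant on a compact open Hausdorff set \<open>V\<^sub>j\<close>, have pointwise sum zero. Where
\<open>f\<^sub>1\<close> does not vanish, another \<open>f\<^sub>j\<close> does not vanish either; hence the support of \<open>f\<^sub>1\<close>, which is compact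
and lies in the Hausdorff set \<open>V\<^sub>1\<close>, splits into finitely many compact open pieces each of which lies
in some \<open>V\<^sub>j\<close> with \<open>j > 1\<close>. Moving each piece of \<open>f\<^sub>1\<close> over to such a \<open>V\<^sub>j\<close> leaves a sum with fewer terms.
If \<open>V\<^sub>1\<close> consists of germs of \<open>s\<close> and \<open>V\<^sub>j\<close> of germs of \<open>t\<close>, then near each common germ there is \<open>u \<le> s, t\<close>,
and for small pieces a move changes the element of \<open>B\<close> by \<open>\<delta>\<^sub>sa - \<delta>\<^sub>ta = (\<delta>\<^sub>ua - \<delta>\<^sub>ta) - (\<delta>\<^sub>ua - \<delta>\<^sub>sa)\<close>. So the
kernel is generated by the relations already as an additive group (\<open>pushforward_kernel\<close>).

The moving argument is isolated in \<open>glued_mem_subgroup\<close>, in a form where the sum is only required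
to vanish outside an open set \<open>D\<close>. This form gives a second fact that is not obvious without the
Hausdorff property: an element of the algebra of \<open>\<G>\<close> that vanishes outside an open set \<open>D\<close> is a
sum of locally constant functions on compact open bisections contained in \<open>D\<close>
(\<open>steinberg_induct_supported\<close>). It is used with \<open>D = D\<^sub>s\<close>, to see that \<open>f \<circ> \<theta>\<^sub>s\<^sup>-\<^sup>1\<close> is again in the algebra
of \<open>\<G>\<close> and that the elements of \<open>B\<close> are sums of elements \<open>\<delta>\<^sub>sk\<close> with \<open>k\<close> locally constant on a compact
open bisection in \<open>D\<^sub>s\<close>.\<close>

section \<open>Sums of finitely supported families\<close>

text \<open>\<^const>\<open>finsum\<close> is zero over an infinite index set. Germ classes and sets of composable pairs are usually
infinite, so sums over them are restricted to the support.\<close>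

definition fsum :: "('a, 'm) ring_scheme \<Rightarrow> ('x \<Rightarrow> 'a) \<Rightarrow> 'x set \<Rightarrow> 'a" where
  "fsum A F X = finsum A F {x \<in> X. F x \<noteq> \<zero>\<^bsub>A\<^esub>}"

context abelian_group
begin

lemma fsum_eq_finsum:
  assumes "finite Z" "Z \<subseteq> X" "\<And>x. x \<in> X - Z \<Longrightarrow> F x = \<zero>" "\<And>x. x \<in> X \<Longrightarrow> F x \<in> carrier G"
  shows "fsum G F X = finsum G F Z"
  unfolding fsum_def
  by (rule add.finprod_mono_neutral_cong_left) (use assms in auto)

lemma fsum_closed:
  assumes "\<And>x. x \<in> X \<Longrightarrow> F x \<in> carrier G"
  shows "fsum G F X \<in> carrier G"
  unfolding fsum_def by (rule finsum_closed) (use assms in auto)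

lemma fsum_cong:
  assumes "X = Y" "\<And>x. x \<in> Y \<Longrightarrow> F x = K x" "\<And>x. x \<in> Y \<Longrightarrow> K x \<in> carrier G"
  shows "fsum G F X = fsum G K Y"
  unfolding fsum_def by (rule finsum_cong') (use assms in auto)

lemma fsum_zero: "(\<And>x. x \<in> X \<Longrightarrow> F x = \<zero>) \<Longrightarrow> fsum G F X = \<zero>"
  unfolding fsum_def by (rule add.finprod_one_eqI) auto

lemma fsum_mono_neutral:
  assumes "X \<subseteq> Y" "\<And>y. y \<in> Y - X \<Longrightarrow> F y = \<zero>"
  shows "fsum G F X = fsum G F Y"
proof -
  have "{x \<in> X. F x \<noteq> \<zero>} = {x \<in> Y. F x \<noteq> \<zero>}" using assms by blast
  then show ?thesis unfolding fsum_def by simp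
qed

lemma fsum_singleton:
  assumes "i \<in> X" "\<And>x. x \<in> X \<Longrightarrow> x \<noteq> i \<Longrightarrow> F x = \<zero>" "F i \<in> carrier G"
  shows "fsum G F X = F i"
proof -
  have "fsum G F X = finsum G F {i}"
    by (rule fsum_eq_finsum) (use assms in \<open>auto, metis zero_closed\<close>)
  then show ?thesis using assms(3) by (simp add: finsum_insert)
qed

lemma fsum_add:
  assumes "finite {x \<in> X. F x \<noteq> \<zero>}" "finite {x \<in> X. K x \<noteq> \<zero>}"
    and F: "\<And>x. x \<in> X \<Longrightarrow> F x \<in> carrier G" and K: "\<And>x. x \<in> X \<Longrightarrow> K x \<in> carrier G"
  shows "fsum G (\<lambda>x. F x \<oplus> K x) X = fsum G F X \<oplus> fsum G K X"
proof -
  let ?Z = "{x \<in> X. F x \<noteq> \<zero>} \<union> {x \<in> X. K x \<noteq> \<zero>}"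
  have 1: "fsum G F X = finsum G F ?Z" "fsum G K X = finsum G K ?Z"
    "fsum G (\<lambda>x. F x \<oplus> K x) X = finsum G (\<lambda>x. F x \<oplus> K x) ?Z"
    by (rule fsum_eq_finsum; use assms in auto)+
  show ?thesis unfolding 1 by (rule finsum_addf) (use F K in auto)
qed

lemma finsum_additive:
  assumes "finite Z" "\<And>a. a \<in> carrier G \<Longrightarrow> h a \<in> carrier G"
    "\<And>a b. a \<in> carrier G \<Longrightarrow> b \<in> carrier G \<Longrightarrow> h (a \<oplus> b) = h a \<oplus> h b"
    "\<And>x. x \<in> Z \<Longrightarrow> F x \<in> carrier G"
  shows "h (finsum G F Z) = finsum G (\<lambda>x. h (F x)) Z"
proof -
  have h0: "h \<zero> = \<zero>"
    using assms(2)[of \<zero>] assms(3)[of \<zero> \<zero>] by (simp add: add.r_cancel_one')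
  show ?thesis using assms(1,4)
  proof (induction Z rule: finite_induct)
    case empty
    then show ?case using h0 by (simp add: finsum_empty)
  next
    case (insert x Z)
    have "finsum G F Z \<in> carrier G" by (rule finsum_closed) (use insert in auto)
    then show ?case using insert assms(2,3)
      by (simp add: finsum_insert Pi_iff)
  qed
qed

lemma fsum_additive:
  assumes "finite {x \<in> X. F x \<noteq> \<zero>}" "\<And>a. a \<in> carrier G \<Longrightarrow> h a \<in> carrier G"
    "\<And>a b. a \<in> carrier G \<Longrightarrow> b \<in> carrier G \<Longrightarrow> h (a \<oplus> b) = h a \<oplus> h b"
    "\<And>x. x \<in> X \<Longrightarrow> F x \<in> carrier G"
  shows "h (fsum G F X) = fsum G (\<lambda>x. h (F x)) X"
proof -
  have h0: "h \<zero> = \<zero>"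
    using assms(2)[of \<zero>] assms(3)[of \<zero> \<zero>] by (simp add: add.r_cancel_one')
  have "fsum G (\<lambda>x. h (F x)) X = finsum G (\<lambda>x. h (F x)) {x \<in> X. F x \<noteq> \<zero>}"
    by (rule fsum_eq_finsum) (use assms h0 in auto)
  then show ?thesis unfolding fsum_def[of G F]
    using finsum_additive[of "{x \<in> X. F x \<noteq> \<zero>}" h F] assms by auto
qed

text \<open>The direct image of functions preserves products because both sides are regroupings of one sum
over composable pairs; this is the regrouping.\<close>

lemma fsum_fibres:
  assumes "finite {x \<in> X. F x \<noteq> \<zero>}" "\<And>x. x \<in> X \<Longrightarrow> F x \<in> carrier G"
    "\<And>x. x \<in> X \<Longrightarrow> F x \<noteq> \<zero> \<Longrightarrow> \<pi> x \<in> Z"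
  shows "fsum G F X = fsum G (\<lambda>z. fsum G F {x \<in> X. \<pi> x = z}) Z"
proof -
  let ?S = "{x \<in> X. F x \<noteq> \<zero>}"
  have "fsum G (\<lambda>z. fsum G F {x \<in> X. \<pi> x = z}) Z
      = finsum G (\<lambda>z. fsum G F {x \<in> X. \<pi> x = z}) (\<pi> ` ?S)"
    by (rule fsum_eq_finsum) (use assms in \<open>auto intro!: fsum_closed fsum_zero\<close>)
  also have "\<dots> = finsum G (\<lambda>z. finsum G F {x \<in> ?S. \<pi> x = z}) (\<pi> ` ?S)"
    unfolding fsum_def
    by (rule finsum_cong') (use assms in \<open>auto intro!: finsum_closed arg_cong[of _ _ "finsum G F"]\<close>)
  also have "\<dots> = finsum G F (\<Union>z\<in>\<pi> ` ?S. {x \<in> ?S. \<pi> x = z})"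
    by (rule add.finprod_UN_disjoint[symmetric])
      (use assms in \<open>auto simp: pairwise_def disjnt_def intro: finite_subset[OF _ assms(1)]\<close>)
  also have "(\<Union>z\<in>\<pi> ` ?S. {x \<in> ?S. \<pi> x = z}) = ?S" by auto
  finally show ?thesis unfolding fsum_def[of G F X] by simp
qed

lemma fsum_reindex:
  assumes "bij_betw \<sigma> Y X" "\<And>x. x \<in> X \<Longrightarrow> F x \<in> carrier G"
  shows "fsum G F X = fsum G (\<lambda>y. F (\<sigma> y)) Y"
proof -
  have "{x \<in> X. F x \<noteq> \<zero>} = \<sigma> ` {y \<in> Y. F (\<sigma> y) \<noteq> \<zero>}"
    using assms(1) by (auto simp: bij_betw_def)
  then show ?thesis unfolding fsum_def
    using finsum_reindex[of F \<sigma> "{y \<in> Y. F (\<sigma> y) \<noteq> \<zero>}"] assms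
    by (auto simp: bij_betw_def intro: inj_on_subset)
qed

end

context bimod_algebra
begin

lemma l_null: "b \<in> carrier A \<Longrightarrow> \<zero>\<^bsub>A\<^esub> \<otimes>\<^bsub>A\<^esub> b = \<zero>\<^bsub>A\<^esub>"
  using l_distr[of "\<zero>\<^bsub>A\<^esub>" "\<zero>\<^bsub>A\<^esub>" b] m_closed[of "\<zero>\<^bsub>A\<^esub>" b] by (simp add: add.r_cancel_one')

lemma r_null: "b \<in> carrier A \<Longrightarrow> b \<otimes>\<^bsub>A\<^esub> \<zero>\<^bsub>A\<^esub> = \<zero>\<^bsub>A\<^esub>"
  using r_distr[of "\<zero>\<^bsub>A\<^esub>" "\<zero>\<^bsub>A\<^esub>" b] m_closed[of b "\<zero>\<^bsub>A\<^esub>"] by (simp add: add.r_cancel_one')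

lemma lsmult_null: "r \<in> carrier R \<Longrightarrow> r \<triangleright>\<^bsub>A\<^esub> \<zero>\<^bsub>A\<^esub> = \<zero>\<^bsub>A\<^esub>"
  using lsmult_r_distr[of r "\<zero>\<^bsub>A\<^esub>" "\<zero>\<^bsub>A\<^esub>"] lsmult_closed[of r "\<zero>\<^bsub>A\<^esub>"] by (simp add: add.r_cancel_one')

lemma rsmult_null: "r \<in> carrier R \<Longrightarrow> \<zero>\<^bsub>A\<^esub> \<triangleleft>\<^bsub>A\<^esub> r = \<zero>\<^bsub>A\<^esub>"
  using rsmult_l_distr[of r "\<zero>\<^bsub>A\<^esub>" "\<zero>\<^bsub>A\<^esub>"] rsmult_closed[of r "\<zero>\<^bsub>A\<^esub>"] by (simp add: add.r_cancel_one')

lemma fsum_mult: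
  assumes X: "finite {x \<in> X. F x \<noteq> \<zero>\<^bsub>A\<^esub>}" "\<And>x. x \<in> X \<Longrightarrow> F x \<in> carrier A"
    and Y: "finite {y \<in> Y. K y \<noteq> \<zero>\<^bsub>A\<^esub>}" "\<And>y. y \<in> Y \<Longrightarrow> K y \<in> carrier A"
  shows "fsum A F X \<otimes>\<^bsub>A\<^esub> fsum A K Y = fsum A (\<lambda>(x, y). F x \<otimes>\<^bsub>A\<^esub> K y) (X \<times> Y)"
proof -
  have K: "fsum A K Y \<in> carrier A" by (rule fsum_closed) (rule Y)
  have "fsum A (\<lambda>(x, y). F x \<otimes>\<^bsub>A\<^esub> K y) (X \<times> Y) =
      fsum A (\<lambda>z. fsum A (\<lambda>(x, y). F x \<otimes>\<^bsub>A\<^esub> K y) {p \<in> X \<times> Y. fst p = z}) X"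
  proof (rule fsum_fibres)
    have "{p \<in> X \<times> Y. (case p of (x, y) \<Rightarrow> F x \<otimes>\<^bsub>A\<^esub> K y) \<noteq> \<zero>\<^bsub>A\<^esub>}
        \<subseteq> {x \<in> X. F x \<noteq> \<zero>\<^bsub>A\<^esub>} \<times> {y \<in> Y. K y \<noteq> \<zero>\<^bsub>A\<^esub>}"
      using X(2) Y(2) l_null r_null by auto
    then show "finite {p \<in> X \<times> Y. (case p of (x, y) \<Rightarrow> F x \<otimes>\<^bsub>A\<^esub> K y) \<noteq> \<zero>\<^bsub>A\<^esub>}"
      by (rule finite_subset) (simp add: X(1) Y(1))
  qed (use X Y in \<open>auto intro: m_closed\<close>)
  also have "\<dots> = fsum A (\<lambda>x. F x \<otimes>\<^bsub>A\<^esub> fsum A K Y) X"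
  proof (rule fsum_cong)
    fix x assume x: "x \<in> X"
    have "fsum A (\<lambda>(x, y). F x \<otimes>\<^bsub>A\<^esub> K y) {p \<in> X \<times> Y. fst p = x} = fsum A (\<lambda>y. F x \<otimes>\<^bsub>A\<^esub> K y) Y"
      using fsum_reindex[of "Pair x" Y "{p \<in> X \<times> Y. fst p = x}" "\<lambda>(x, y). F x \<otimes>\<^bsub>A\<^esub> K y"] x X Y
      by (force simp: bij_betw_def inj_on_def intro: m_closed)
    also have "\<dots> = F x \<otimes>\<^bsub>A\<^esub> fsum A K Y"
      by (rule fsum_additive[symmetric]) (use x X Y in \<open>auto intro: m_closed r_distr\<close>)
    finally show "fsum A (\<lambda>(x, y). F x \<otimes>\<^bsub>A\<^esub> K y) {p \<in> X \<times> Y. fst p = x} = F x \<otimes>\<^bsub>A\<^esub> fsum A K Y" .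
  qed (use X K m_closed in auto)
  also have "\<dots> = fsum A F X \<otimes>\<^bsub>A\<^esub> fsum A K Y"
    by (rule fsum_additive[symmetric, of _ _ "\<lambda>a. a \<otimes>\<^bsub>A\<^esub> fsum A K Y"])
      (use X K in \<open>auto intro: m_closed l_distr\<close>)
  finally show ?thesis by simp
qed

end

section \<open>Groups of functions\<close>

text \<open>Steinberg algebras and crossed products both have pointwise addition, which is why one lemma
provides the additive group of each.\<close>

lemma abelian_group_pointwise:
  fixes A :: "('a, 'm) ring_scheme" and M :: "('x \<Rightarrow> 'a, 'n) ring_scheme"
  assumes "abelian_group A"
    and zero: "zero M = (\<lambda>_. \<zero>\<^bsub>A\<^esub>)" and add: "add M = (\<lambda>f g x. f x \<oplus>\<^bsub>A\<^esub> g x)"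
    and car: "\<And>f x. f \<in> carrier M \<Longrightarrow> f x \<in> carrier A"
    and z: "(\<lambda>_. \<zero>\<^bsub>A\<^esub>) \<in> carrier M"
    and a: "\<And>f g. f \<in> carrier M \<Longrightarrow> g \<in> carrier M \<Longrightarrow> (\<lambda>x. f x \<oplus>\<^bsub>A\<^esub> g x) \<in> carrier M"
    and m: "\<And>f. f \<in> carrier M \<Longrightarrow> (\<lambda>x. \<ominus>\<^bsub>A\<^esub> f x) \<in> carrier M"
  shows "abelian_group M"
    and "f \<in> carrier M \<Longrightarrow> \<ominus>\<^bsub>M\<^esub> f = (\<lambda>x. \<ominus>\<^bsub>A\<^esub> f x)"
proof -
  interpret A: abelian_group A by fact
  show M: "abelian_group M"
  proof (rule abelian_groupI)
    fix f assume f: "f \<in> carrier M"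
    show "\<exists>g\<in>carrier M. g \<oplus>\<^bsub>M\<^esub> f = \<zero>\<^bsub>M\<^esub>"
      by (rule bexI[OF _ m[OF f]]) (auto simp: zero add A.l_neg car[OF f])
  qed (auto simp: zero add z a car A.a_assoc A.a_comm A.a_lcomm)
  interpret M: abelian_group M by fact
  assume f: "f \<in> carrier M"
  have "(\<lambda>x. \<ominus>\<^bsub>A\<^esub> f x) \<oplus>\<^bsub>M\<^esub> f = \<zero>\<^bsub>M\<^esub>"
    by (auto simp: zero add A.l_neg car[OF f])
  then show "\<ominus>\<^bsub>M\<^esub> f = (\<lambda>x. \<ominus>\<^bsub>A\<^esub> f x)"
    using M.minus_equality[of "\<lambda>x. \<ominus>\<^bsub>A\<^esub> f x" f] f m by blast
qed

lemma finsum_pointwise: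
  fixes A :: "('a, 'm) ring_scheme" and M :: "('x \<Rightarrow> 'a, 'n) ring_scheme"
  assumes "abelian_group A" "abelian_group M"
    and zero: "zero M = (\<lambda>_. \<zero>\<^bsub>A\<^esub>)" and add: "add M = (\<lambda>f g x. f x \<oplus>\<^bsub>A\<^esub> g x)"
    and car: "\<And>f x. f \<in> carrier M \<Longrightarrow> f x \<in> carrier A"
    and "finite Z" "\<And>z. z \<in> Z \<Longrightarrow> F z \<in> carrier M"
  shows "finsum M F Z x = finsum A (\<lambda>z. F z x) Z"
proof -
  interpret A: abelian_group A by fact
  interpret M: abelian_group M by fact
  show ?thesis using assms(6,7)
  proof (induction Z rule: finite_induct)
    case empty
    then show ?case by (simp add: M.finsum_empty A.finsum_empty zero)
  next
    case (insert y Z)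
    then show ?case
      by (simp add: M.finsum_insert A.finsum_insert Pi_iff car add)
  qed
qed

section \<open>Compact open sets and locally constant functions\<close>

definition compact_open :: "'x topology \<Rightarrow> 'x set \<Rightarrow> bool" where
  "compact_open X K \<longleftrightarrow> openin X K \<and> compactin X K"

definition compact_open_Hausdorff :: "'x topology \<Rightarrow> 'x set \<Rightarrow> bool" where
  "compact_open_Hausdorff X V \<longleftrightarrow> compact_open X V \<and> Hausdorff_space (subtopology X V)"

lemma compactin_Diff_openin:
  assumes "compactin X K" "openin X W"
  shows "compactin X (K - W)"
proof -
  have "K - W = (topspace X - W) \<inter> K"
    using assms compactin_subset_topspace by fastforce
  then show ?thesis
    using assms by (metis closed_Int_compactin openin_closedin_eq)
qed

lemma openin_Diff_compactin:
  assumes V: "openin X V" "Hausdorff_space (subtopology X V)"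
    and K: "compactin X K" "K \<subseteq> V"
  shows "openin X (V - K)"
proof -
  have "closedin (subtopology X V) K"
    using V K by (simp add: compactin_imp_closedin compactin_subtopology)
  then have "openin (subtopology X V) (V - K)"
    by (metis K(2) closedin_def inf.absorb_iff2 openin_subset V(1) topspace_subtopology)
  then show ?thesis using V(1) openin_open_subtopology by blast
qed

lemma compact_open_Diff:
  assumes "openin X V" "Hausdorff_space (subtopology X V)"
    "compact_open X L" "L \<subseteq> V" "compact_open X K" "K \<subseteq> V"
  shows "compact_open X (L - K)"
proof -
  have "L - K = L \<inter> (V - K)" using assms by blast
  then show ?thesis
    using assms openin_Diff_compactin[of X V K]
    by (metis compact_open_def compactin_Diff_openin openin_Int)
qed

lemma compact_open_Int:
  assumes "openin X V" "Hausdorff_space (subtopology X V)"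
    "compact_open X L" "L \<subseteq> V" "compact_open X K" "K \<subseteq> V"
  shows "compact_open X (L \<inter> K)"
proof -
  have "L \<inter> K = L - (L - K)" by blast
  then show ?thesis
    using compact_open_Diff[OF assms(1-4) compact_open_Diff[OF assms]] assms by auto
qed

text \<open>A finite cover of \<open>K\<close> by compact open sets can be made disjoint one member at a time, because inside
an open Hausdorff set the compact open sets are closed under differences. The set \<open>V\<close> is there
since \<open>X\<close> itself is not assumed to be Hausdorff.\<close>

lemma compact_open_induct:
  assumes V: "openin X V" "Hausdorff_space (subtopology X V)" and K: "compact_open X K" "K \<subseteq> V"
    and empty: "P {}"
    and union: "\<And>L M. compact_open X L \<Longrightarrow> compact_open X M \<Longrightarrow> L \<subseteq> K \<Longrightarrow> M \<subseteq> K \<Longrightarrow>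
      L \<inter> M = {} \<Longrightarrow> P L \<Longrightarrow> P M \<Longrightarrow> P (L \<union> M)"
    and local: "\<And>x. x \<in> K \<Longrightarrow> \<exists>W. compact_open X W \<and> x \<in> W \<and> W \<subseteq> K \<and>
      (\<forall>L. compact_open X L \<and> L \<subseteq> W \<longrightarrow> P L)"
  shows "P K"
proof -
  define \<W> where "\<W> = {W. compact_open X W \<and> W \<subseteq> K \<and> (\<forall>L. compact_open X L \<and> L \<subseteq> W \<longrightarrow> P L)}"
  have "\<exists>\<F>. finite \<F> \<and> \<F> \<subseteq> \<W> \<and> K \<subseteq> \<Union>\<F>"
  proof (rule compactinD)
    show "compactin X K" using K by (simp add: compact_open_def)
    show "openin X W" if "W \<in> \<W>" for W using that by (simp add: \<W>_def compact_open_def)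
    show "K \<subseteq> \<Union>\<W>" using local unfolding \<W>_def by blast
  qed
  then obtain \<F> where \<F>: "finite \<F>" "\<F> \<subseteq> \<W>" "K \<subseteq> \<Union>\<F>" by blast
  have "P L" if "compact_open X L" "L \<subseteq> K" "L \<subseteq> \<Union>\<F>" for L
    using \<F>(1,2) that
  proof (induction \<F> arbitrary: L rule: finite_induct)
    case empty
    then show ?case using assms(5) by simp
  next
    case (insert W \<F>)
    have W: "compact_open X W" "W \<subseteq> K" "\<And>L. compact_open X L \<and> L \<subseteq> W \<Longrightarrow> P L"
      using insert.prems(1) by (auto simp: \<W>_def)
    have LV: "L \<subseteq> V" "W \<subseteq> V" using insert.prems W K by auto
    have Int: "compact_open X (L \<inter> W)" and Diff: "compact_open X (L - W)"
      using compact_open_Int[OF V insert.prems(2) LV(1) W(1) LV(2)]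
        compact_open_Diff[OF V insert.prems(2) LV(1) W(1) LV(2)] by auto
    have "P (L - W)" using insert Diff by auto
    moreover have "P (L \<inter> W)" using W(3) Int by blast
    ultimately have "P ((L \<inter> W) \<union> (L - W))"
      by (intro union Int Diff) (use insert.prems in auto)
    then show ?case by (simp add: Int_Diff_Un)
  qed
  then show ?thesis using K \<F> by blast
qed

text \<open>For compact open Hausdorff \<open>V\<close> these are the generators of a Steinberg algebra that are supported in \<open>V\<close>;
compactness of the support is then automatic.\<close>

definition locally_constant ::
    "('a, 'm) ring_scheme \<Rightarrow> 'x topology \<Rightarrow> 'x set \<Rightarrow> ('x \<Rightarrow> 'a) set" where
  "locally_constant A X V = {f. (\<forall>x. x \<notin> V \<longrightarrow> f x = \<zero>\<^bsub>A\<^esub>) \<and> (\<forall>x. f x \<in> carrier A) \<and>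
     (\<forall>a. openin X {x \<in> V. f x = a})}"

definition cut_off :: "('a, 'm) ring_scheme \<Rightarrow> ('x \<Rightarrow> 'a) \<Rightarrow> 'x set \<Rightarrow> 'x \<Rightarrow> 'a" where
  "cut_off A f K = (\<lambda>x. if x \<in> K then f x else \<zero>\<^bsub>A\<^esub>)"

lemma locally_constantD:
  assumes "f \<in> locally_constant A X V"
  shows "x \<notin> V \<Longrightarrow> f x = \<zero>\<^bsub>A\<^esub>" "f x \<in> carrier A" "openin X {x \<in> V. f x = a}"
  using assms by (auto simp: locally_constant_def)

lemma locally_constant_openin_values:
  assumes "f \<in> locally_constant A X V"
  shows "openin X {x \<in> V. Q (f x)}"
proof -
  have "{x \<in> V. Q (f x)} = (\<Union>a\<in>{a. Q a}. {x \<in> V. f x = a})" by auto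
  then show ?thesis using locally_constantD(3)[OF assms(1)] by auto
qed

lemma locally_constant_support:
  assumes "f \<in> locally_constant A X V" "compact_open X V"
  shows "compact_open X {x \<in> V. f x \<noteq> \<zero>\<^bsub>A\<^esub>}"
proof -
  have "{x \<in> V. f x \<noteq> \<zero>\<^bsub>A\<^esub>} = V - {x \<in> V. f x = \<zero>\<^bsub>A\<^esub>}" by auto
  then have "compactin X {x \<in> V. f x \<noteq> \<zero>\<^bsub>A\<^esub>}"
    using compactin_Diff_openin[of X V "{x \<in> V. f x = \<zero>\<^bsub>A\<^esub>}"] locally_constantD(3)[OF assms(1)] assms(2)
    by (simp add: compact_open_def)
  then show ?thesis
    using locally_constant_openin_values[OF assms(1), of "\<lambda>a. a \<noteq> \<zero>\<^bsub>A\<^esub>"] by (simp add: compact_open_def)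
qed

context abelian_group
begin

lemma locally_constant_zero: "openin X V \<Longrightarrow> (\<lambda>_. \<zero>) \<in> locally_constant G X V"
proof -
  assume "openin X V"
  moreover have "{x \<in> V. \<zero> = a} = (if a = \<zero> then V else {})" for a by auto
  ultimately show ?thesis by (simp add: locally_constant_def)
qed

lemma locally_constant_cut_off:
  assumes f: "f \<in> locally_constant G X V" and K: "openin X K" "K \<subseteq> V"
  shows "cut_off G f K \<in> locally_constant G X K"
proof -
  have "{x \<in> K. cut_off G f K x = a} = K \<inter> {x \<in> V. f x = a}" for a
    using K by (auto simp: cut_off_def)
  then show ?thesis
    using assms by (auto simp: locally_constant_def cut_off_def openin_Int)
qed

lemma locally_constant_mono:
  assumes f: "f \<in> locally_constant G X K" and V: "compact_open_Hausdorff X V"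
    and K: "compact_open X K" "K \<subseteq> V"
  shows "f \<in> locally_constant G X V"
proof -
  have "{x \<in> V. f x = a} = {x \<in> K. f x = a} \<union> (if a = \<zero> then V - K else {})" for a
    using K locally_constantD(1)[OF f] by auto
  moreover have "openin X (V - K)"
    using V K by (auto simp: compact_open_Hausdorff_def compact_open_def intro!: openin_Diff_compactin)
  ultimately show ?thesis
    using f K by (auto simp: locally_constant_def)
qed

lemma locally_constant_add:
  assumes f: "f \<in> locally_constant G X V" and g: "g \<in> locally_constant G X V"
  shows "(\<lambda>x. f x \<oplus> g x) \<in> locally_constant G X V"
proof -
  have "{x \<in> V. f x \<oplus> g x = a} = (\<Union>b. {x \<in> V. f x = b} \<inter> {x \<in> V. b \<oplus> g x = a})" for a
    by auto
  moreover have "openin X ({x \<in> V. f x = b} \<inter> {x \<in> V. b \<oplus> g x = a})" for a b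
    by (rule openin_Int[OF locally_constantD(3)[OF f]
          locally_constant_openin_values[OF g, of "\<lambda>y. b \<oplus> y = a"]])
  then have "openin X (\<Union>b. {x \<in> V. f x = b} \<inter> {x \<in> V. b \<oplus> g x = a})" for a
    by blast
  ultimately have "openin X {x \<in> V. f x \<oplus> g x = a}" for a by simp
  then show ?thesis
    using locally_constantD(1,2)[OF f] locally_constantD(1,2)[OF g] by (simp add: locally_constant_def)
qed

lemma locally_constant_additive:
  assumes f: "f \<in> locally_constant G X V" and "h \<zero> = \<zero>" "\<And>a. a \<in> carrier G \<Longrightarrow> h a \<in> carrier G"
  shows "(\<lambda>x. h (f x)) \<in> locally_constant G X V"
  using assms(2,3) locally_constantD(1,2)[OF f] locally_constant_openin_values[OF f, of "\<lambda>y. h y = a" for a]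
  by (auto simp: locally_constant_def)

lemma cut_off_Un_disjoint:
  assumes "\<And>x. f x \<in> carrier G" "K \<inter> L = {}"
  shows "cut_off G f (K \<union> L) = (\<lambda>x. cut_off G f K x \<oplus> cut_off G f L x)"
  using assms by (auto simp: cut_off_def fun_eq_iff)

end

section \<open>Sums of locally constant functions on overlapping charts\<close>

text \<open>The sets \<open>V j\<close> are charts of \<open>X\<close>, and \<open>T j f\<close> stands for the function \<open>f\<close> on the chart \<open>V j\<close>, regarded as a
formal summand in \<open>H\<close>. The question is which formal sums represent the zero function.\<close>

locale gluing = A: abelian_group A + H: abelian_group H
  for A :: "('a, 'm) ring_scheme" and H :: "('h, 'n) ring_scheme" +
  fixes X :: "'x topology" and J :: "'j set" and V :: "'j \<Rightarrow> 'x set"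
    and T :: "'j \<Rightarrow> ('x \<Rightarrow> 'a) \<Rightarrow> 'h"
  assumes V: "j \<in> J \<Longrightarrow> compact_open_Hausdorff X (V j)"
    and T_closed: "\<lbrakk>j \<in> J; f \<in> locally_constant A X (V j)\<rbrakk> \<Longrightarrow> T j f \<in> carrier H"
    and T_add: "\<lbrakk>j \<in> J; f \<in> locally_constant A X (V j); g \<in> locally_constant A X (V j)\<rbrakk> \<Longrightarrow>
      T j (\<lambda>x. f x \<oplus>\<^bsub>A\<^esub> g x) = T j f \<oplus>\<^bsub>H\<^esub> T j g"
    and compact_open_basis: "\<lbrakk>openin X W; x \<in> W\<rbrakk> \<Longrightarrow> \<exists>K. compact_open X K \<and> x \<in> K \<and> K \<subseteq> W"
begin

text \<open>\<open>glued js h \<tau>\<close> holds if there are functions \<open>f\<^sub>j\<close> on the listed charts with pointwise sum \<open>h\<close> and formal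
sum \<open>\<tau>\<close>. Listing charts rather than functions makes the number of charts available as the measure of
the induction below: a listed chart may carry the zero function.\<close>

inductive glued :: "'j list \<Rightarrow> ('x \<Rightarrow> 'a) \<Rightarrow> 'h \<Rightarrow> bool" where
  Nil: "glued [] (\<lambda>_. \<zero>\<^bsub>A\<^esub>) \<zero>\<^bsub>H\<^esub>"
| Cons: "\<lbrakk>j \<in> J; f \<in> locally_constant A X (V j); glued js h \<tau>\<rbrakk> \<Longrightarrow>
    glued (j # js) (\<lambda>x. f x \<oplus>\<^bsub>A\<^esub> h x) (T j f \<oplus>\<^bsub>H\<^esub> \<tau>)"

lemma V_openin: "j \<in> J \<Longrightarrow> openin X (V j)"
  using V by (auto simp: compact_open_Hausdorff_def compact_open_def)

lemma locally_constant_zero_V: "j \<in> J \<Longrightarrow> (\<lambda>_. \<zero>\<^bsub>A\<^esub>) \<in> locally_constant A X (V j)"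
  by (rule A.locally_constant_zero) (rule V_openin)

lemma T_zero: "j \<in> J \<Longrightarrow> T j (\<lambda>_. \<zero>\<^bsub>A\<^esub>) = \<zero>\<^bsub>H\<^esub>"
  using T_add[of j "\<lambda>_. \<zero>\<^bsub>A\<^esub>" "\<lambda>_. \<zero>\<^bsub>A\<^esub>"] T_closed[of j "\<lambda>_. \<zero>\<^bsub>A\<^esub>"] locally_constant_zero_V
  by (simp add: H.add.r_cancel_one')

lemma glued_closed:
  assumes "glued js h \<tau>"
  shows "h x \<in> carrier A" "\<tau> \<in> carrier H" "set js \<subseteq> J"
  using assms by (induction) (auto simp: locally_constantD(2) T_closed)

lemma glued_support:
  assumes "glued js h \<tau>" "h x \<noteq> \<zero>\<^bsub>A\<^esub>"
  shows "\<exists>j\<in>set js. x \<in> V j"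
  using assms
proof induction
  case (Cons j f js h \<tau>)
  then show ?case
    using locally_constantD(1)[OF Cons.hyps(2), of x] glued_closed(1)[OF Cons.hyps(3), of x]
    by (cases "f x = \<zero>\<^bsub>A\<^esub>") auto
qed simp

lemma glued_zero: "set js \<subseteq> J \<Longrightarrow> glued js (\<lambda>_. \<zero>\<^bsub>A\<^esub>) \<zero>\<^bsub>H\<^esub>"
proof (induction js)
  case (Cons j js)
  then show ?case
    using glued.Cons[of j "\<lambda>_. \<zero>\<^bsub>A\<^esub>" js "\<lambda>_. \<zero>\<^bsub>A\<^esub>" "\<zero>\<^bsub>H\<^esub>"] T_zero locally_constant_zero_V by simp
qed (auto intro: glued.Nil)

lemma glued_add:
  assumes "glued js h \<tau>" "glued js h' \<tau>'"
  shows "glued js (\<lambda>x. h x \<oplus>\<^bsub>A\<^esub> h' x) (\<tau> \<oplus>\<^bsub>H\<^esub> \<tau>')"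
  using assms
proof (induction arbitrary: h' \<tau>')
  case Nil
  then have "h' = (\<lambda>_. \<zero>\<^bsub>A\<^esub>)" "\<tau>' = \<zero>\<^bsub>H\<^esub>" by (auto elim: glued.cases)
  then show ?case by (simp add: glued.Nil)
next
  case (Cons j f js h \<tau>)
  from Cons.prems obtain g k \<sigma> where g: "g \<in> locally_constant A X (V j)" "glued js k \<sigma>"
    and eq: "h' = (\<lambda>x. g x \<oplus>\<^bsub>A\<^esub> k x)" "\<tau>' = T j g \<oplus>\<^bsub>H\<^esub> \<sigma>"
    by (cases) auto
  have 1: "(\<lambda>x. (f x \<oplus>\<^bsub>A\<^esub> h x) \<oplus>\<^bsub>A\<^esub> h' x) = (\<lambda>x. (f x \<oplus>\<^bsub>A\<^esub> g x) \<oplus>\<^bsub>A\<^esub> (h x \<oplus>\<^bsub>A\<^esub> k x))"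
    unfolding eq using Cons.hyps g by (auto simp: A.a_ac locally_constantD(2) glued_closed)
  have 2: "(T j f \<oplus>\<^bsub>H\<^esub> \<tau>) \<oplus>\<^bsub>H\<^esub> \<tau>' = T j (\<lambda>x. f x \<oplus>\<^bsub>A\<^esub> g x) \<oplus>\<^bsub>H\<^esub> (\<tau> \<oplus>\<^bsub>H\<^esub> \<sigma>)"
    unfolding eq using Cons.hyps g by (simp add: T_add H.a_ac T_closed glued_closed)
  show ?case unfolding 1 2
    by (rule glued.Cons) (use Cons g A.locally_constant_add in auto)
qed

lemma glued_append:
  assumes "glued js h \<tau>" "glued ks h' \<tau>'"
  shows "glued (js @ ks) (\<lambda>x. h x \<oplus>\<^bsub>A\<^esub> h' x) (\<tau> \<oplus>\<^bsub>H\<^esub> \<tau>')"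
  using assms
proof (induction)
  case Nil
  then show ?case by (simp add: glued_closed)
next
  case (Cons j f js h \<tau>)
  then show ?case
    using glued.Cons[of j f "js @ ks" "\<lambda>x. h x \<oplus>\<^bsub>A\<^esub> h' x" "\<tau> \<oplus>\<^bsub>H\<^esub> \<tau>'"]
    by (simp add: A.a_assoc H.a_assoc locally_constantD(2) glued_closed T_closed)
qed

lemma glued_single:
  assumes "set js \<subseteq> J" "j \<in> set js" "f \<in> locally_constant A X (V j)"
  shows "glued js f (T j f)"
  using assms(1,2)
proof (induction js)
  case (Cons i js)
  show ?case
  proof (cases "i = j")
    case True
    then show ?thesis
      using glued.Cons[of j f js "\<lambda>_. \<zero>\<^bsub>A\<^esub>" "\<zero>\<^bsub>H\<^esub>"] glued_zero[of js] Cons.prems assms(3)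
      by (simp add: locally_constantD(2)[OF assms(3)] T_closed)
  next
    case False
    then have "glued js f (T j f)" using Cons by auto
    then show ?thesis
      using glued.Cons[of i "\<lambda>_. \<zero>\<^bsub>A\<^esub>" js f "T j f"] Cons.prems assms(3)
      by (auto simp: T_zero locally_constant_zero_V locally_constantD(2)[OF assms(3)] T_closed)
  qed
qed simp

text \<open>Induction on the number of charts. Outside \<open>D\<close> the functions add up to zero, so at every point of
the support of the function \<open>f\<close> on the first chart that lies outside \<open>D\<close>, the function of another chart
does not vanish. Hence the support of \<open>f\<close> is covered by open sets on which \<open>T j f\<close> either lies in \<open>N\<close> or
can be exchanged modulo \<open>N\<close> for the same function on another chart, and by compactness it splits into
finitely many pieces of this kind. Once all pieces have been moved, the first chart is gone.\<close>

theorem glued_mem_subgroup: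
  assumes "glued js h \<tau>" and D: "\<And>x. x \<notin> D \<Longrightarrow> h x = \<zero>\<^bsub>A\<^esub>"
    and N: "additive_subgroup N H"
    and overlap: "\<And>i j x. \<lbrakk>i \<in> J; j \<in> J; x \<in> V i; x \<in> V j\<rbrakk> \<Longrightarrow>
      \<exists>W. openin X W \<and> x \<in> W \<and> W \<subseteq> V i \<inter> V j \<and>
        (\<forall>K f. compact_open X K \<and> K \<subseteq> W \<and> f \<in> locally_constant A X K \<longrightarrow> T i f \<ominus>\<^bsub>H\<^esub> T j f \<in> N)"
    and inside: "\<And>i x. \<lbrakk>i \<in> J; x \<in> V i; x \<in> D\<rbrakk> \<Longrightarrow>
      \<exists>W. openin X W \<and> x \<in> W \<and> W \<subseteq> V i \<inter> D \<and>
        (\<forall>K f. compact_open X K \<and> K \<subseteq> W \<and> f \<in> locally_constant A X K \<longrightarrow> T i f \<in> N)"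
  shows "\<tau> \<in> N"
  using assms(1,2)
proof (induction js arbitrary: h \<tau>)
  case Nil
  then show ?case using N by (auto elim: glued.cases simp: additive_subgroup.zero_closed)
next
  case (Cons j js h' \<tau>')
  interpret N: additive_subgroup N H by fact
  from Cons.prems(1) obtain f h \<tau> where j: "j \<in> J" and f: "f \<in> locally_constant A X (V j)"
    and h: "glued js h \<tau>" and h': "h' = (\<lambda>x. f x \<oplus>\<^bsub>A\<^esub> h x)" and \<tau>': "\<tau>' = T j f \<oplus>\<^bsub>H\<^esub> \<tau>"
    by (cases) auto
  have js: "set js \<subseteq> J" using h glued_closed by blast
  let ?S = "{x \<in> V j. f x \<noteq> \<zero>\<^bsub>A\<^esub>}"
  \<comment> \<open>The part of \<open>f\<close> over \<open>K\<close> can be moved to the other charts.\<close>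
  define P where "P K \<longleftrightarrow> (\<exists>g \<sigma>. glued js g \<sigma> \<and> (\<forall>x. x \<notin> D \<longrightarrow> g x = cut_off A f K x) \<and>
      T j (cut_off A f K) \<ominus>\<^bsub>H\<^esub> \<sigma> \<in> N)" for K
  have Vj: "compact_open_Hausdorff X (V j)" "openin X (V j)" "Hausdorff_space (subtopology X (V j))"
    using V[OF j] by (auto simp: compact_open_Hausdorff_def compact_open_def)
  have cut: "cut_off A f K \<in> locally_constant A X K" "cut_off A f K \<in> locally_constant A X (V j)"
    if "compact_open X K" "K \<subseteq> V j" for K
    using A.locally_constant_cut_off[OF f, of K] that A.locally_constant_mono[OF _ Vj(1) that]
    by (auto simp: compact_open_def)
  have S: "compact_open X ?S"
    using locally_constant_support[OF f] V[OF j] by (simp add: compact_open_Hausdorff_def)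
  have "P ?S"
  proof (rule compact_open_induct[OF Vj(2,3) S])
    have "cut_off A f {} = (\<lambda>_. \<zero>\<^bsub>A\<^esub>)" by (auto simp: cut_off_def)
    then show "P {}" unfolding P_def
      using glued_zero[OF js] T_zero[OF j] by (auto intro!: exI[of _ "\<lambda>_. \<zero>\<^bsub>A\<^esub>"] exI[of _ "\<zero>\<^bsub>H\<^esub>"]
          simp: H.minus_eq)
  next
    fix L M assume LM: "compact_open X L" "compact_open X M" "L \<subseteq> ?S" "M \<subseteq> ?S" "L \<inter> M = {}"
    assume "P L"
    then obtain g \<sigma> where g: "glued js g \<sigma>" "\<And>x. x \<notin> D \<Longrightarrow> g x = cut_off A f L x"
      "T j (cut_off A f L) \<ominus>\<^bsub>H\<^esub> \<sigma> \<in> N" unfolding P_def by blast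
    assume "P M"
    then obtain g' \<sigma>' where g': "glued js g' \<sigma>'" "\<And>x. x \<notin> D \<Longrightarrow> g' x = cut_off A f M x"
      "T j (cut_off A f M) \<ominus>\<^bsub>H\<^esub> \<sigma>' \<in> N" unfolding P_def by blast
    have LMj: "cut_off A f L \<in> locally_constant A X (V j)" "cut_off A f M \<in> locally_constant A X (V j)"
      using cut LM by auto
    have eq: "cut_off A f (L \<union> M) = (\<lambda>x. cut_off A f L x \<oplus>\<^bsub>A\<^esub> cut_off A f M x)"
      by (rule A.cut_off_Un_disjoint) (use LM locally_constantD(2)[OF f] in auto)
    have "T j (cut_off A f (L \<union> M)) \<ominus>\<^bsub>H\<^esub> (\<sigma> \<oplus>\<^bsub>H\<^esub> \<sigma>')
        = (T j (cut_off A f L) \<ominus>\<^bsub>H\<^esub> \<sigma>) \<oplus>\<^bsub>H\<^esub> (T j (cut_off A f M) \<ominus>\<^bsub>H\<^esub> \<sigma>')"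
      unfolding eq T_add[OF j LMj] H.minus_eq
      using T_closed[OF j] LMj glued_closed(2)[OF g(1)] glued_closed(2)[OF g'(1)]
      by (simp add: H.a_ac H.minus_add)
    then have "T j (cut_off A f (L \<union> M)) \<ominus>\<^bsub>H\<^esub> (\<sigma> \<oplus>\<^bsub>H\<^esub> \<sigma>') \<in> N"
      using g(3) g'(3) N.a_closed by simp
    then show "P (L \<union> M)" unfolding P_def
      using glued_add[OF g(1) g'(1)] g(2) g'(2) eq by (intro exI conjI) auto
  next
    fix x assume x: "x \<in> ?S"
    have "\<exists>W. openin X W \<and> x \<in> W \<and> W \<subseteq> V j \<and> (\<forall>K. compact_open X K \<and> K \<subseteq> W \<longrightarrow> P K)"
    proof (cases "x \<in> D")
      case True
      then obtain W where W: "openin X W" "x \<in> W" "W \<subseteq> V j \<inter> D"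
        "\<And>K f. compact_open X K \<and> K \<subseteq> W \<and> f \<in> locally_constant A X K \<Longrightarrow> T j f \<in> N"
        using inside[OF j, of x] x by blast
      have "P K" if K: "compact_open X K" "K \<subseteq> W" for K
      proof -
        have KV: "K \<subseteq> V j" using K W by blast
        have "T j (cut_off A f K) \<in> N" using W(4) K cut(1)[OF K(1) KV] by blast
        moreover have "cut_off A f K x = \<zero>\<^bsub>A\<^esub>" if "x \<notin> D" for x
          using that W(3) K(2) by (auto simp: cut_off_def)
        ultimately show ?thesis unfolding P_def
          using glued_zero[OF js] T_closed[OF j cut(2)[OF K(1) KV]]
          by (intro exI[of _ "\<lambda>_. \<zero>\<^bsub>A\<^esub>"] exI[of _ "\<zero>\<^bsub>H\<^esub>"]) (auto simp: H.minus_eq)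
      qed
      then show ?thesis using W by blast
    next
      case False
      then have "h x \<noteq> \<zero>\<^bsub>A\<^esub>"
        using Cons.prems(2)[of x] x h' locally_constantD(2)[OF f, of x] by auto
      then obtain i where i: "i \<in> set js" "x \<in> V i"
        using glued_support[OF h] by blast
      then obtain W where W: "openin X W" "x \<in> W" "W \<subseteq> V j \<inter> V i"
        "\<And>K f. compact_open X K \<and> K \<subseteq> W \<and> f \<in> locally_constant A X K \<Longrightarrow> T j f \<ominus>\<^bsub>H\<^esub> T i f \<in> N"
        using overlap[OF j, of i x] x js by blast
      have "P K" if K: "compact_open X K" "K \<subseteq> W" for K
      proof -
        have KV: "K \<subseteq> V j" "K \<subseteq> V i" using K W by blast+
        have "cut_off A f K \<in> locally_constant A X (V i)"
          by (rule A.locally_constant_mono[OF cut(1)[OF K(1) KV(1)] V K(1) KV(2)]) (use i js in blast)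
        then show ?thesis unfolding P_def
          using glued_single[OF js i(1)] W(4) K cut(1)[OF K(1) KV(1)] by blast
      qed
      then show ?thesis using W by blast
    qed
    then obtain W where W: "openin X W" "x \<in> W" "W \<subseteq> V j"
      "\<And>K. compact_open X K \<and> K \<subseteq> W \<Longrightarrow> P K" by blast
    have "openin X (W \<inter> ?S)" "x \<in> W \<inter> ?S"
      using W S x by (auto simp: compact_open_def)
    then obtain K where "compact_open X K" "x \<in> K" "K \<subseteq> W \<inter> ?S"
      using compact_open_basis by blast
    then show "\<exists>W. compact_open X W \<and> x \<in> W \<and> W \<subseteq> ?S \<and> (\<forall>L. compact_open X L \<and> L \<subseteq> W \<longrightarrow> P L)"
      using W(4) by (intro exI[of _ K]) auto
  qed auto
  then obtain g \<sigma> where g: "glued js g \<sigma>" "\<And>x. x \<notin> D \<Longrightarrow> g x = cut_off A f ?S x"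
      "T j (cut_off A f ?S) \<ominus>\<^bsub>H\<^esub> \<sigma> \<in> N" unfolding P_def by blast
  \<comment> \<open>Once \<open>f\<close> is moved, \<open>\<tau> + \<sigma>\<close> is a formal sum over the remaining charts alone.\<close>
  have fS: "cut_off A f ?S = f" using locally_constantD(1)[OF f] by (auto simp: cut_off_def fun_eq_iff)
  have "\<tau> \<oplus>\<^bsub>H\<^esub> \<sigma> \<in> N"
  proof (rule Cons.IH[OF glued_add[OF h g(1)]])
    fix x assume "x \<notin> D"
    then show "h x \<oplus>\<^bsub>A\<^esub> g x = \<zero>\<^bsub>A\<^esub>"
      using g(2)[of x] fS Cons.prems(2)[of x] h' locally_constantD(2)[OF f] glued_closed(1)[OF h]
      by (simp add: A.a_comm)
  qed
  have "T j f \<oplus>\<^bsub>H\<^esub> \<tau> = (T j f \<ominus>\<^bsub>H\<^esub> \<sigma>) \<oplus>\<^bsub>H\<^esub> (\<tau> \<oplus>\<^bsub>H\<^esub> \<sigma>)"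
    using T_closed[OF j f] glued_closed(2)[OF h] glued_closed(2)[OF g(1)]
    by (simp add: H.a_comm[of \<tau> \<sigma>] H.minus_eq H.a_assoc H.r_neg1)
  then show ?case using \<open>\<tau> \<oplus>\<^bsub>H\<^esub> \<sigma> \<in> N\<close> g(3) fS N.a_closed \<tau>' by simp
qed

end

section \<open>Steinberg functions\<close>

text \<open>Closure under compact open subsets ensures that the pieces cut out of a basic set are basic.\<close>

locale compact_open_base =
  fixes X :: "'x topology" and \<B> :: "'x set set"
  assumes base_member: "K \<in> \<B> \<Longrightarrow> compact_open_Hausdorff X K"
    and base_subset: "\<lbrakk>K \<in> \<B>; compact_open X L; L \<subseteq> K\<rbrakk> \<Longrightarrow> L \<in> \<B>"
    and base_point: "\<lbrakk>openin X W; x \<in> W\<rbrakk> \<Longrightarrow> \<exists>K\<in>\<B>. x \<in> K \<and> K \<subseteq> W"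
begin

lemma base_compact_open: "K \<in> \<B> \<Longrightarrow> compact_open X K"
  using base_member by (simp add: compact_open_Hausdorff_def)

lemma base_openin: "K \<in> \<B> \<Longrightarrow> openin X K"
  using base_compact_open by (simp add: compact_open_def)

end

lemma steinberg_algebra_simps [simp]:
  "carrier (steinberg_algebra A \<Gamma>) = steinberg_functions A \<Gamma>"
  "monoid.mult (steinberg_algebra A \<Gamma>) = convolution A \<Gamma>"
  "zero (steinberg_algebra A \<Gamma>) = (\<lambda>_. \<zero>\<^bsub>A\<^esub>)"
  "add (steinberg_algebra A \<Gamma>) = (\<lambda>f g x. f x \<oplus>\<^bsub>A\<^esub> g x)"
  "lsmult (steinberg_algebra A \<Gamma>) = (\<lambda>r f x. r \<triangleright>\<^bsub>A\<^esub> f x)"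
  "rsmult (steinberg_algebra A \<Gamma>) = (\<lambda>f r x. f x \<triangleleft>\<^bsub>A\<^esub> r)"
  by (simp_all add: steinberg_algebra_def)

lemma locally_constant_steinberg:
  assumes V: "compact_open_Hausdorff (atop \<Gamma>) V" and f: "f \<in> locally_constant A (atop \<Gamma>) V"
  shows "f \<in> steinberg_functions A \<Gamma>"
proof -
  let ?Y = "subtopology (atop \<Gamma>) V"
  have V': "openin (atop \<Gamma>) V" "compactin (atop \<Gamma>) V" "Hausdorff_space ?Y"
    using V by (auto simp: compact_open_Hausdorff_def compact_open_def)
  have top: "topspace ?Y = V"
    using V' openin_subset by (metis inf.absorb2 topspace_subtopology)
  have "continuous_map ?Y (discrete_topology (carrier A)) f"
    unfolding continuous_map_def top
  proof (intro conjI allI impI)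
    fix U
    have "openin (atop \<Gamma>) {x \<in> V. f x \<in> U}"
      by (rule locally_constant_openin_values[OF f])
    then show "openin ?Y {x \<in> V. f x \<in> U}"
      using V'(1) by (simp add: openin_open_subtopology)
  qed (use locally_constantD(2)[OF f] in auto)
  moreover have "compactin ?Y (?Y closure_of {x \<in> V. f x \<noteq> \<zero>\<^bsub>A\<^esub>})"
  proof (rule closed_compactin)
    show "compactin ?Y V" using V'(2) by (simp add: compactin_subtopology)
    show "?Y closure_of {x \<in> V. f x \<noteq> \<zero>\<^bsub>A\<^esub>} \<subseteq> V"
      using closure_of_subset_topspace top by metis
  qed simp
  ultimately have "f \<in> steinberg_generators A \<Gamma>"
    unfolding steinberg_generators_def using V' locally_constantD(1)[OF f] by blast
  then show ?thesis by (rule steinberg_functions.generator)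
qed

context bimod_algebra
begin

lemma steinberg_function_closed:
  assumes "f \<in> steinberg_functions A \<Gamma>"
  shows "f x \<in> carrier A"
  using assms
proof induction
  case (generator f)
  then obtain V where V: "openin (atop \<Gamma>) V" "\<And>x. x \<notin> V \<Longrightarrow> f x = \<zero>"
    "continuous_map (subtopology (atop \<Gamma>) V) (discrete_topology (carrier A)) f"
    unfolding steinberg_generators_def by blast
  have "topspace (subtopology (atop \<Gamma>) V) = V"
    using V(1) openin_subset by (metis inf.absorb2 topspace_subtopology)
  then show ?case using V(2)[of x] V(3) by (cases "x \<in> V") (auto simp: continuous_map_def)
qed auto

lemma steinberg_abelian_group:
  shows "abelian_group (steinberg_algebra A \<Gamma>)"
    and "f \<in> steinberg_functions A \<Gamma> \<Longrightarrow> \<ominus>\<^bsub>steinberg_algebra A \<Gamma>\<^esub> f = (\<lambda>x. \<ominus> f x)"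
proof -
  have 1: "abelian_group A" by unfold_locales
  show "abelian_group (steinberg_algebra A \<Gamma>)"
    by (rule abelian_group_pointwise[OF 1])
      (auto intro: steinberg_functions.intros steinberg_function_closed)
  show "f \<in> steinberg_functions A \<Gamma> \<Longrightarrow> \<ominus>\<^bsub>steinberg_algebra A \<Gamma>\<^esub> f = (\<lambda>x. \<ominus> f x)"
    by (rule abelian_group_pointwise[OF 1])
      (auto intro: steinberg_functions.intros steinberg_function_closed)
qed

lemma zero_minus: "\<ominus> \<zero> = \<zero>"
  using add.inv_one by (simp add: a_inv_def)

lemma locally_constant_minus:
  assumes "f \<in> locally_constant A X V"
  shows "(\<lambda>x. \<ominus> f x) \<in> locally_constant A X V"
  by (rule locally_constant_additive[where h = "\<lambda>a. \<ominus> a", OF assms zero_minus a_inv_closed])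

text \<open>The support of a generator is compact open in its Hausdorff domain, so \<open>compact_open_induct\<close> cuts the
generator into locally constant functions on basic sets.\<close>

lemma steinberg_induct [consumes 2, case_names zero locally_constant add]:
  assumes f: "f \<in> steinberg_functions A \<Gamma>" and base: "compact_open_base (atop \<Gamma>) \<B>"
    and zero: "P (\<lambda>_. \<zero>)"
    and lc: "\<And>K f. K \<in> \<B> \<Longrightarrow> f \<in> locally_constant A (atop \<Gamma>) K \<Longrightarrow> P f"
    and add: "\<And>f g. f \<in> steinberg_functions A \<Gamma> \<Longrightarrow> g \<in> steinberg_functions A \<Gamma> \<Longrightarrow>
      P f \<Longrightarrow> P g \<Longrightarrow> P (\<lambda>x. f x \<oplus> g x)"
  shows "P f"
proof -
  interpret compact_open_base "atop \<Gamma>" \<B> by fact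
  let ?X = "atop \<Gamma>"
  \<comment> \<open>The predicate \<open>P\<close> need not respect negation, so the induction carries \<open>-f\<close> along.\<close>
  define Q where "Q f \<longleftrightarrow> f \<in> steinberg_functions A \<Gamma> \<and> P f \<and> P (\<lambda>x. \<ominus> f x)" for f
  have Q_zero: "Q (\<lambda>_. \<zero>)" unfolding Q_def zero_minus using zero by (simp add: steinberg_functions.zero)
  have Q_add: "Q (\<lambda>x. f x \<oplus> g x)" if "Q f" "Q g" for f g
  proof -
    have "(\<lambda>x. \<ominus> (f x \<oplus> g x)) = (\<lambda>x. \<ominus> f x \<oplus> \<ominus> g x)"
      using that steinberg_function_closed[of _ \<Gamma>] by (auto simp: Q_def minus_add fun_eq_iff)
    then show ?thesis
      using that add[of f g] add[of "\<lambda>x. \<ominus> f x" "\<lambda>x. \<ominus> g x"]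
      by (auto simp: Q_def intro: steinberg_functions.intros)
  qed
  have Q_lc: "Q f" if "K \<in> \<B>" "f \<in> locally_constant A ?X K" for K f
    using that lc[OF that] lc[OF that(1) locally_constant_minus[OF that(2)]]
      locally_constant_steinberg[OF base_member[OF that(1)] that(2)] by (simp add: Q_def)
  have "Q f" using f
  proof induction
    case (generator f)
    then obtain V where V: "openin ?X V" "Hausdorff_space (subtopology ?X V)"
      "\<And>x. x \<notin> V \<Longrightarrow> f x = \<zero>"
      and cont: "continuous_map (subtopology ?X V) (discrete_topology (carrier A)) f"
      and cpt: "compactin (subtopology ?X V) (subtopology ?X V closure_of {x \<in> V. f x \<noteq> \<zero>})"
      unfolding steinberg_generators_def by blast
    let ?S = "{x \<in> V. f x \<noteq> \<zero>}"
    have top: "topspace (subtopology ?X V) = V"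
      using V(1) openin_subset by (metis inf.absorb2 topspace_subtopology)
    have car: "f x \<in> carrier A" for x
      by (rule steinberg_function_closed[OF steinberg_functions.generator[OF generator]])
    have open_values: "openin ?X {x \<in> V. f x \<in> U}" if "U \<subseteq> carrier A" for U
    proof -
      have "openin (subtopology ?X V) {x \<in> V. f x \<in> U}"
        using openin_continuous_map_preimage[OF cont, of U] that unfolding top by simp
      then show ?thesis using openin_open_subtopology[OF V(1)] by blast
    qed
    have "?S = {x \<in> V. f x \<in> carrier A - {\<zero>}}" using car by auto
    then have S_open: "openin ?X ?S" using open_values[of "carrier A - {\<zero>}"] by simp
    have "closedin (subtopology ?X V) {x \<in> topspace (subtopology ?X V). f x \<in> carrier A - {\<zero>}}"
      by (rule closedin_continuous_map_preimage[OF cont]) simp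
    moreover have "{x \<in> topspace (subtopology ?X V). f x \<in> carrier A - {\<zero>}} = ?S"
      using car top by auto
    ultimately have "subtopology ?X V closure_of ?S = ?S"
      by (simp add: closure_of_closedin)
    then have S: "compact_open ?X ?S"
      using cpt S_open by (simp add: compact_open_def compactin_subtopology)
    have fS: "f \<in> locally_constant A ?X ?S"
    proof -
      have "{x \<in> ?S. f x = a} = {x \<in> V. f x \<in> {a} \<inter> carrier A - {\<zero>}}" for a
        using car by auto
      then have "openin ?X {x \<in> ?S. f x = a}" for a
        using open_values[of "{a} \<inter> carrier A - {\<zero>}"] by auto
      then show ?thesis
        using V(3) car unfolding locally_constant_def by blast
    qed
    have "Q (cut_off A f ?S)"
    proof (rule compact_open_induct[OF V(1,2) S, where P = "\<lambda>L. Q (cut_off A f L)"])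
      have "cut_off A f {} = (\<lambda>_. \<zero>)" by (auto simp: cut_off_def)
      then show "Q (cut_off A f {})" using Q_zero by simp
    next
      fix L M assume LM: "L \<inter> M = {}" "Q (cut_off A f L)" "Q (cut_off A f M)"
      show "Q (cut_off A f (L \<union> M))"
        unfolding cut_off_Un_disjoint[OF car LM(1)] by (rule Q_add[OF LM(2,3)])
    next
      fix x assume "x \<in> ?S"
      then obtain K where K: "K \<in> \<B>" "x \<in> K" "K \<subseteq> ?S" using base_point[OF S_open] by blast
      have "Q (cut_off A f L)" if L: "compact_open ?X L" "L \<subseteq> K" for L
      proof (rule Q_lc)
        show "L \<in> \<B>" using base_subset[OF K(1) L] .
        show "cut_off A f L \<in> locally_constant A ?X L"
          by (rule locally_constant_cut_off[OF fS]) (use L K in \<open>auto simp: compact_open_def\<close>)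
      qed
      then show "\<exists>W. compact_open ?X W \<and> x \<in> W \<and> W \<subseteq> ?S \<and>
          (\<forall>L. compact_open ?X L \<and> L \<subseteq> W \<longrightarrow> Q (cut_off A f L))"
        using K base_compact_open by blast
    qed auto
    moreover have "cut_off A f ?S = f" using V(3) by (auto simp: cut_off_def fun_eq_iff)
    ultimately show ?case by simp
  next
    case zero
    show ?case by (rule Q_zero)
  next
    case (minus f)
    have "(\<lambda>x. \<ominus> (\<ominus> f x)) = f" using steinberg_function_closed[OF minus.hyps] by simp
    then show ?case using minus by (simp add: Q_def steinberg_functions.minus)
  next
    case (add f g)
    then show ?case using Q_add by blast
  qed
  then show ?thesis by (simp add: Q_def)
qed

text \<open>The summands of \<open>f\<close> need not vanish outside \<open>D\<close>; only their sum does. The gluing theorem, applied with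
\<open>T j f = f\<close> and with \<open>N\<close> the functions having the desired property, replaces them by summands that do.\<close>

lemma steinberg_induct_supported:
  assumes f: "f \<in> steinberg_functions A \<Gamma>" and base: "compact_open_base (atop \<Gamma>) \<B>"
    and D: "openin (atop \<Gamma>) D" "\<And>x. x \<notin> D \<Longrightarrow> f x = \<zero>"
    and zero: "P (\<lambda>_. \<zero>)"
    and lc: "\<And>K f. K \<in> \<B> \<Longrightarrow> K \<subseteq> D \<Longrightarrow> f \<in> locally_constant A (atop \<Gamma>) K \<Longrightarrow> P f"
    and add: "\<And>f g. f \<in> steinberg_functions A \<Gamma> \<Longrightarrow> g \<in> steinberg_functions A \<Gamma> \<Longrightarrow>
      (\<And>x. x \<notin> D \<Longrightarrow> f x = \<zero>) \<Longrightarrow> (\<And>x. x \<notin> D \<Longrightarrow> g x = \<zero>) \<Longrightarrow>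
      P f \<Longrightarrow> P g \<Longrightarrow> P (\<lambda>x. f x \<oplus> g x)"
  shows "P f"
proof -
  interpret compact_open_base "atop \<Gamma>" \<B> by fact
  let ?X = "atop \<Gamma>" and ?M = "steinberg_algebra A \<Gamma>"
  interpret M: abelian_group ?M by (rule steinberg_abelian_group)
  have lc_in: "f \<in> steinberg_functions A \<Gamma>" if "K \<in> \<B>" "f \<in> locally_constant A ?X K" for K f
    using locally_constant_steinberg[OF base_member[OF that(1)] that(2)] .
  interpret gluing A ?M ?X \<B> "\<lambda>K. K" "\<lambda>K f. f"
  proof (unfold_locales, goal_cases)
    case (1 j)
    then show ?case by (rule base_member)
  next
    case (2 j f)
    then show ?case using lc_in by simp
  next
    case (4 W x)
    then show ?case using base_point base_compact_open by meson
  qed simp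
  define N where "N = {f \<in> steinberg_functions A \<Gamma>. (\<forall>x. x \<notin> D \<longrightarrow> f x = \<zero>) \<and> P f \<and> P (\<lambda>x. \<ominus> f x)}"
  have N: "additive_subgroup N ?M"
  proof (rule additive_subgroup.intro, rule M.add.subgroupI, goal_cases)
    case 1
    then show ?case by (auto simp: N_def)
  next
    case 2
    have "(\<lambda>_. \<zero>) \<in> N"
      unfolding N_def mem_Collect_eq zero_minus using zero by (simp add: steinberg_functions.zero)
    then show ?case by blast
  next
    case (3 f)
    then have f: "f \<in> steinberg_functions A \<Gamma>" by (simp add: N_def)
    have "(\<lambda>x. \<ominus> (\<ominus> f x)) = f" using steinberg_function_closed[OF f] by simp
    then show ?case
      using 3 by (simp add: N_def steinberg_functions.minus steinberg_abelian_group(2) zero_minus)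
  next
    case (4 f g)
    have "(\<lambda>x. \<ominus> (f x \<oplus> g x)) = (\<lambda>x. \<ominus> f x \<oplus> \<ominus> g x)"
      using 4 steinberg_function_closed[of _ \<Gamma>] by (auto simp: N_def minus_add fun_eq_iff)
    then show ?case
      using 4 add[of f g] add[of "\<lambda>x. \<ominus> f x" "\<lambda>x. \<ominus> g x"]
      by (auto simp: N_def intro: steinberg_functions.intros)
  qed
  have "\<exists>js. glued js f f"
    using f base
  proof (induction rule: steinberg_induct)
    case zero
    then show ?case using glued.Nil by auto
  next
    case (locally_constant K f)
    then show ?case using glued_single[of "[K]" K f] by auto
  next
    case (add f g)
    then show ?case using glued_append by fastforce
  qed
  then obtain js where js: "glued js f f" by blast
  have "f \<in> N"
  proof (rule glued_mem_subgroup[OF js _ N])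
    fix i j x assume ij: "i \<in> \<B>" "j \<in> \<B>" "x \<in> i" "x \<in> j"
    have "f \<ominus>\<^bsub>?M\<^esub> f \<in> N" if "compact_open ?X K" "K \<subseteq> i \<inter> j" "f \<in> locally_constant A ?X K" for K f
    proof -
      have "f \<in> carrier ?M" using lc_in[of K f] base_subset[OF ij(1)] that by auto
      then have "f \<ominus>\<^bsub>?M\<^esub> f = \<zero>\<^bsub>?M\<^esub>" by (simp only: M.minus_eq M.r_neg)
      then show ?thesis using N additive_subgroup.zero_closed by metis
    qed
    then show "\<exists>W. openin ?X W \<and> x \<in> W \<and> W \<subseteq> i \<inter> j \<and> (\<forall>K f. compact_open ?X K \<and> K \<subseteq> W \<and>
        f \<in> locally_constant A ?X K \<longrightarrow> f \<ominus>\<^bsub>?M\<^esub> f \<in> N)"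
      using ij base_openin by (intro exI[of _ "i \<inter> j"]) (auto simp: openin_Int)
  next
    fix i x assume i: "i \<in> \<B>" "x \<in> i" "x \<in> D"
    have "f \<in> N" if K: "compact_open ?X K" "K \<subseteq> i \<inter> D" "f \<in> locally_constant A ?X K" for K f
    proof -
      have "K \<in> \<B>" using base_subset[OF i(1)] K by auto
      then show ?thesis
        using K lc_in[of K f] lc[of K f] lc[of K "\<lambda>x. \<ominus> f x"] locally_constant_minus[OF K(3)]
          locally_constantD(1)[OF K(3)] by (auto simp: N_def)
    qed
    then show "\<exists>W. openin ?X W \<and> x \<in> W \<and> W \<subseteq> i \<inter> D \<and> (\<forall>K f. compact_open ?X K \<and> K \<subseteq> W \<and>
        f \<in> locally_constant A ?X K \<longrightarrow> f \<in> N)"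
      using i D base_openin by (intro exI[of _ "i \<inter> D"]) (auto simp: openin_Int)
  qed (use D in auto)
  then show ?thesis by (simp add: N_def)
qed

text \<open>Stated for an arbitrary additive map \<open>h\<close> in order to cover left and right scalars at once.\<close>

lemma steinberg_scalar:
  assumes f: "f \<in> steinberg_functions A \<Gamma>" and base: "compact_open_base (atop \<Gamma>) \<B>"
    and h: "\<And>a. a \<in> carrier A \<Longrightarrow> h a \<in> carrier A"
      "\<And>a b. a \<in> carrier A \<Longrightarrow> b \<in> carrier A \<Longrightarrow> h (a \<oplus> b) = h a \<oplus> h b"
  shows "(\<lambda>x. h (f x)) \<in> steinberg_functions A \<Gamma>"
proof -
  interpret compact_open_base "atop \<Gamma>" \<B> by fact
  have h0: "h \<zero> = \<zero>" using h(1)[of \<zero>] h(2)[of \<zero> \<zero>] by (simp add: add.r_cancel_one')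
  show ?thesis
  proof (rule steinberg_induct[OF f base, where P = "\<lambda>f. (\<lambda>x. h (f x)) \<in> steinberg_functions A \<Gamma>"])
    show "(\<lambda>x. h \<zero>) \<in> steinberg_functions A \<Gamma>" by (simp add: h0 steinberg_functions.zero)
    show "(\<lambda>x. h (f x)) \<in> steinberg_functions A \<Gamma>"
      if "K \<in> \<B>" "f \<in> locally_constant A (atop \<Gamma>) K" for K f
      by (rule locally_constant_steinberg[OF base_member[OF that(1)]
            locally_constant_additive[where h = h, OF that(2) h0 h(1)]])
    show "(\<lambda>x. h (f x \<oplus> g x)) \<in> steinberg_functions A \<Gamma>"
      if "f \<in> steinberg_functions A \<Gamma>" "g \<in> steinberg_functions A \<Gamma>"
        "(\<lambda>x. h (f x)) \<in> steinberg_functions A \<Gamma>" "(\<lambda>x. h (g x)) \<in> steinberg_functions A \<Gamma>" for f g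
    proof -
      have "(\<lambda>x. h (f x \<oplus> g x)) = (\<lambda>x. h (f x) \<oplus> h (g x))"
        by (rule ext) (rule h(2)[OF steinberg_function_closed[OF that(1)] steinberg_function_closed[OF that(2)]])
      then show ?thesis using that(3,4) by (simp add: steinberg_functions.add)
    qed
  qed
qed

end

section \<open>Convolution\<close>

definition fibre_finite ::
    "('r, 'a, 'k) bimod_algebra_scheme \<Rightarrow> ('g, 'v, 'l) semigroupoid_scheme \<Rightarrow> ('g \<Rightarrow> 'a) \<Rightarrow> bool" where
  "fibre_finite A \<Gamma> f \<longleftrightarrow> (\<forall>a. f a \<in> carrier A) \<and> (\<forall>v. finite {a \<in> arr \<Gamma>. src \<Gamma> a = v \<and> f a \<noteq> \<zero>\<^bsub>A\<^esub>})"

context bimod_algebra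
begin

lemma fibre_finite_zero: "fibre_finite A \<Gamma> (\<lambda>_. \<zero>)"
  by (simp add: fibre_finite_def)

lemma fibre_finite_add:
  assumes "fibre_finite A \<Gamma> f" "fibre_finite A \<Gamma> g"
  shows "fibre_finite A \<Gamma> (\<lambda>a. f a \<oplus> g a)"
proof -
  have "finite {a \<in> arr \<Gamma>. src \<Gamma> a = v \<and> f a \<oplus> g a \<noteq> \<zero>}" for v
  proof (rule finite_subset)
    show "{a \<in> arr \<Gamma>. src \<Gamma> a = v \<and> f a \<oplus> g a \<noteq> \<zero>} \<subseteq>
        {a \<in> arr \<Gamma>. src \<Gamma> a = v \<and> f a \<noteq> \<zero>} \<union> {a \<in> arr \<Gamma>. src \<Gamma> a = v \<and> g a \<noteq> \<zero>}"
      by auto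
  qed (use assms in \<open>auto simp: fibre_finite_def\<close>)
  then show ?thesis using assms by (simp add: fibre_finite_def)
qed

end

locale convolvable = bimod_algebra R A
  for R :: "('r, 'm) ring_scheme" and A :: "('r, 'a, 'k) bimod_algebra_scheme" (structure) +
  fixes \<Gamma> :: "('g, 'v, 'l) top_semigroupoid_scheme" (structure)
  assumes src_mult: "composable \<Gamma> a b \<Longrightarrow> src \<Gamma> (a \<cdot>\<^bsub>\<Gamma>\<^esub> b) = src \<Gamma> b"
begin

text \<open>In a factorization of \<open>\<gamma>\<close> the right factor has the source of \<open>\<gamma>\<close>, which leaves finitely many of them in
the support of \<open>g\<close>; each one fixes the source of the left factor.\<close>

lemma finite_convolution_support:
  assumes f: "fibre_finite A \<Gamma> f" and g: "fibre_finite A \<Gamma> g"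
  shows "finite {(a, b). composable \<Gamma> a b \<and> a \<cdot>\<^bsub>\<Gamma>\<^esub> b = \<gamma> \<and> f a \<noteq> \<zero> \<and> g b \<noteq> \<zero>}" (is "finite ?Z")
proof (rule finite_subset)
  show "?Z \<subseteq> (\<Union>b\<in>{b \<in> arr \<Gamma>. src \<Gamma> b = src \<Gamma> \<gamma> \<and> g b \<noteq> \<zero>}.
      {a \<in> arr \<Gamma>. src \<Gamma> a = rng \<Gamma> b \<and> f a \<noteq> \<zero>} \<times> {b})"
    using src_mult by (auto simp: composable_def)
  show "finite (\<Union>b\<in>{b \<in> arr \<Gamma>. src \<Gamma> b = src \<Gamma> \<gamma> \<and> g b \<noteq> \<zero>}.
      {a \<in> arr \<Gamma>. src \<Gamma> a = rng \<Gamma> b \<and> f a \<noteq> \<zero>} \<times> {b})"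
    using f g by (intro finite_UN_I finite_cartesian_product) (auto simp: fibre_finite_def)
qed

lemma convolution_fsum:
  assumes f: "fibre_finite A \<Gamma> f" and g: "fibre_finite A \<Gamma> g"
  shows "convolution A \<Gamma> f g \<gamma> = fsum A (\<lambda>(a, b). f a \<otimes> g b) {(a, b). composable \<Gamma> a b \<and> a \<cdot>\<^bsub>\<Gamma>\<^esub> b = \<gamma>}"
  unfolding convolution_def
  by (rule fsum_eq_finsum[symmetric, OF finite_convolution_support[OF f g]])
    (use f g in \<open>auto simp: fibre_finite_def l_null r_null intro: m_closed\<close>)

lemma finite_convolution_terms:
  assumes f: "fibre_finite A \<Gamma> f" and g: "fibre_finite A \<Gamma> g"
  shows "finite {p \<in> {(a, b). composable \<Gamma> a b \<and> a \<cdot>\<^bsub>\<Gamma>\<^esub> b = \<gamma>}. (case p of (a, b) \<Rightarrow> f a \<otimes> g b) \<noteq> \<zero>}"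
  by (rule finite_subset[OF _ finite_convolution_support[OF f g, of \<gamma>]])
    (use f g in \<open>auto simp: fibre_finite_def l_null r_null\<close>)

lemma convolution_value_closed:
  assumes "fibre_finite A \<Gamma> f" "fibre_finite A \<Gamma> g"
  shows "convolution A \<Gamma> f g \<gamma> \<in> carrier A"
  unfolding convolution_fsum[OF assms]
  by (rule fsum_closed) (use assms in \<open>auto simp: fibre_finite_def intro: m_closed\<close>)

lemma convolution_add_left:
  assumes f: "fibre_finite A \<Gamma> f" "fibre_finite A \<Gamma> f'" and g: "fibre_finite A \<Gamma> g"
  shows "convolution A \<Gamma> (\<lambda>x. f x \<oplus> f' x) g = (\<lambda>\<gamma>. convolution A \<Gamma> f g \<gamma> \<oplus> convolution A \<Gamma> f' g \<gamma>)"
proof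
  fix \<gamma>
  let ?X = "{(a, b). composable \<Gamma> a b \<and> a \<cdot>\<^bsub>\<Gamma>\<^esub> b = \<gamma>}"
  have c: "f a \<in> carrier A" "f' a \<in> carrier A" "g a \<in> carrier A" for a
    using f g by (auto simp: fibre_finite_def)
  have "fsum A (\<lambda>(a, b). (f a \<oplus> f' a) \<otimes> g b) ?X
      = fsum A (\<lambda>p. (case p of (a, b) \<Rightarrow> f a \<otimes> g b) \<oplus> (case p of (a, b) \<Rightarrow> f' a \<otimes> g b)) ?X"
    by (rule fsum_cong) (use c in \<open>auto simp: l_distr m_closed\<close>)
  also have "\<dots> = fsum A (\<lambda>(a, b). f a \<otimes> g b) ?X \<oplus> fsum A (\<lambda>(a, b). f' a \<otimes> g b) ?X"
    by (rule fsum_add[OF finite_convolution_terms[OF f(1) g] finite_convolution_terms[OF f(2) g]])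
      (use c in \<open>auto simp: m_closed\<close>)
  finally show "convolution A \<Gamma> (\<lambda>x. f x \<oplus> f' x) g \<gamma> = convolution A \<Gamma> f g \<gamma> \<oplus> convolution A \<Gamma> f' g \<gamma>"
    unfolding convolution_fsum[OF f(1) g] convolution_fsum[OF f(2) g]
      convolution_fsum[OF fibre_finite_add[OF f] g] .
qed

lemma convolution_add_right:
  assumes f: "fibre_finite A \<Gamma> f" and g: "fibre_finite A \<Gamma> g" "fibre_finite A \<Gamma> g'"
  shows "convolution A \<Gamma> f (\<lambda>x. g x \<oplus> g' x) = (\<lambda>\<gamma>. convolution A \<Gamma> f g \<gamma> \<oplus> convolution A \<Gamma> f g' \<gamma>)"
proof
  fix \<gamma>
  let ?X = "{(a, b). composable \<Gamma> a b \<and> a \<cdot>\<^bsub>\<Gamma>\<^esub> b = \<gamma>}"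
  have c: "f a \<in> carrier A" "g a \<in> carrier A" "g' a \<in> carrier A" for a
    using f g by (auto simp: fibre_finite_def)
  have "fsum A (\<lambda>(a, b). f a \<otimes> (g b \<oplus> g' b)) ?X
      = fsum A (\<lambda>p. (case p of (a, b) \<Rightarrow> f a \<otimes> g b) \<oplus> (case p of (a, b) \<Rightarrow> f a \<otimes> g' b)) ?X"
    by (rule fsum_cong) (use c in \<open>auto simp: r_distr m_closed\<close>)
  also have "\<dots> = fsum A (\<lambda>(a, b). f a \<otimes> g b) ?X \<oplus> fsum A (\<lambda>(a, b). f a \<otimes> g' b) ?X"
    by (rule fsum_add[OF finite_convolution_terms[OF f g(1)] finite_convolution_terms[OF f g(2)]])
      (use c in \<open>auto simp: m_closed\<close>)
  finally show "convolution A \<Gamma> f (\<lambda>x. g x \<oplus> g' x) \<gamma> = convolution A \<Gamma> f g \<gamma> \<oplus> convolution A \<Gamma> f g' \<gamma>"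
    unfolding convolution_fsum[OF f g(1)] convolution_fsum[OF f g(2)]
      convolution_fsum[OF f fibre_finite_add[OF g]] .
qed

lemma convolution_zero:
  "convolution A \<Gamma> (\<lambda>_. \<zero>) g = (\<lambda>_. \<zero>)" "convolution A \<Gamma> f (\<lambda>_. \<zero>) = (\<lambda>_. \<zero>)"
  by (simp_all add: convolution_def finsum_empty)

end

section \<open>Groupoids and their ideals\<close>

context groupoid
begin

definition ginv :: "'g \<Rightarrow> 'g" where
  "ginv a = (THE b. is_groupoid_inverse \<G> a b)"

lemma ginv:
  assumes a: "a \<in> arr \<G>"
  shows "is_groupoid_inverse \<G> a (ginv a)"
proof -
  obtain b where b: "is_groupoid_inverse \<G> a b" using ex_inverse[OF a] by blast
  have "c = b" if c: "is_groupoid_inverse \<G> a c" for c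
  proof -
    have cab: "composable \<G> c a" "composable \<G> a b"
      using b c by (auto simp: is_groupoid_inverse_def)
    have ids: "is_identity \<G> (rng \<G> a) (a \<cdot> b)" "is_identity \<G> (src \<G> a) (c \<cdot> a)"
      using b c by (auto simp: is_groupoid_inverse_def)
    have "c = c \<cdot> (a \<cdot> b)" using ids(1) cab by (simp add: is_identity_def composable_def)
    also have "\<dots> = (c \<cdot> a) \<cdot> b" using prd_assoc[OF cab] by simp
    also have "\<dots> = b" using ids(2) cab by (simp add: is_identity_def composable_def)
    finally show ?thesis .
  qed
  then show ?thesis unfolding ginv_def using b by (metis theI)
qed

lemma ginv_simps [simp]:
  assumes "a \<in> arr \<G>"
  shows "ginv a \<in> arr \<G>" "src \<G> (ginv a) = rng \<G> a" "rng \<G> (ginv a) = src \<G> a"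
proof -
  have "composable \<G> a (ginv a)" "composable \<G> (ginv a) a"
    using ginv[OF assms] by (simp_all add: is_groupoid_inverse_def)
  then show "ginv a \<in> arr \<G>" "src \<G> (ginv a) = rng \<G> a" "rng \<G> (ginv a) = src \<G> a"
    by (simp_all add: composable_def)
qed

lemma ginv_cancel_left:
  assumes "a \<in> arr \<G>" "b \<in> arr \<G>" "src \<G> a = rng \<G> b"
  shows "ginv a \<cdot> (a \<cdot> b) = b"
proof -
  have "ginv a \<cdot> (a \<cdot> b) = (ginv a \<cdot> a) \<cdot> b"
    using assms by (intro prd_assoc[symmetric]) (auto simp: composable_def)
  then show ?thesis
    using ginv[OF assms(1)] assms by (simp add: is_groupoid_inverse_def is_identity_def)
qed

lemma ginv_cancel_left':
  assumes "a \<in> arr \<G>" "b \<in> arr \<G>" "rng \<G> a = rng \<G> b"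
  shows "a \<cdot> (ginv a \<cdot> b) = b"
proof -
  have "a \<cdot> (ginv a \<cdot> b) = (a \<cdot> ginv a) \<cdot> b"
    using assms by (intro prd_assoc[symmetric]) (auto simp: composable_def)
  then show ?thesis
    using ginv[OF assms(1)] assms by (simp add: is_groupoid_inverse_def is_identity_def)
qed

lemma ginv_cancel_right:
  assumes "a \<in> arr \<G>" "b \<in> arr \<G>" "src \<G> b = rng \<G> a"
  shows "(b \<cdot> a) \<cdot> ginv a = b"
proof -
  have "(b \<cdot> a) \<cdot> ginv a = b \<cdot> (a \<cdot> ginv a)"
    using assms by (intro prd_assoc) (auto simp: composable_def)
  then show ?thesis
    using ginv[OF assms(1)] assms by (simp add: is_groupoid_inverse_def is_identity_def)
qed

text \<open>An ideal that contains \<open>a\<close> contains the unit \<open>a\<^sup>-\<^sup>1a\<close>, and multiplying \<open>b\<close> by this unit does not change it. It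
follows that ideals of a groupoid are unions of connected components.\<close>

lemma ideal_same_source:
  assumes I: "semigroupoid_ideal \<G> I" and a: "a \<in> I" and b: "b \<in> arr \<G>" "src \<G> b = src \<G> a"
  shows "b \<in> I"
proof -
  have aG: "a \<in> arr \<G>" using I a by (auto simp: semigroupoid_ideal_def)
  have ideal: "c \<cdot> d \<in> I" if "composable \<G> c d" "c \<in> I \<or> d \<in> I" for c d
    using I that by (simp add: semigroupoid_ideal_def)
  have "ginv a \<cdot> a \<in> I" by (rule ideal) (use aG a in \<open>auto simp: composable_def\<close>)
  moreover have unit: "is_identity \<G> (src \<G> a) (ginv a \<cdot> a)"
    using ginv[OF aG] by (simp add: is_groupoid_inverse_def)
  then have "b \<cdot> (ginv a \<cdot> a) = b" "composable \<G> b (ginv a \<cdot> a)"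
    using b by (simp_all add: is_identity_def composable_def)
  ultimately show ?thesis using ideal[of b "ginv a \<cdot> a"] by simp
qed

lemma ideal_ginv:
  assumes I: "semigroupoid_ideal \<G> I" and a: "a \<in> I"
  shows "ginv a \<in> I"
proof -
  have aG: "a \<in> arr \<G>" using I a by (auto simp: semigroupoid_ideal_def)
  have "ginv a \<cdot> a \<in> I"
    using I a aG by (auto simp: semigroupoid_ideal_def composable_def)
  moreover have "(ginv a \<cdot> a) \<cdot> ginv a = ginv a" using aG by (simp add: ginv_cancel_right)
  moreover have "composable \<G> (ginv a \<cdot> a) (ginv a)"
    using aG ginv[OF aG] by (simp add: composable_def is_groupoid_inverse_def is_identity_def)
  ultimately show ?thesis using I unfolding semigroupoid_ideal_def by metis
qed

lemma ideal_connected: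
  assumes I: "semigroupoid_ideal \<G> I" and a: "a \<in> I" and b: "b \<in> arr \<G>"
    and "src \<G> b = src \<G> a \<or> src \<G> b = rng \<G> a \<or> rng \<G> b = src \<G> a \<or> rng \<G> b = rng \<G> a"
  shows "b \<in> I"
proof -
  have aG: "a \<in> arr \<G>" using I a by (auto simp: semigroupoid_ideal_def)
  have "ginv b \<in> I \<Longrightarrow> b \<in> I"
    using ideal_same_source[OF I, of "ginv (ginv b)" b] ideal_ginv[OF I, of "ginv b"] b by simp
  then show ?thesis
    using assms(4) b aG a ideal_same_source[OF I] ideal_ginv[OF I a] ginv_simps by metis
qed

end

section \<open>Ample groupoids\<close>

lemma local_homeomorphism_open_map:
  assumes "local_homeomorphism_map X Y f"
  shows "open_map X Y f"
  unfolding open_map_def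
proof (intro allI impI)
  fix W assume W: "openin X W"
  show "openin Y (f ` W)"
  proof (subst openin_subopen, intro ballI)
    fix y assume "y \<in> f ` W"
    then obtain x where x: "x \<in> W" "y = f x" by blast
    then have "x \<in> topspace X" using W openin_subset by blast
    then obtain U where U: "openin X U" "x \<in> U" "openin Y (f ` U)"
      "homeomorphic_map (subtopology X U) (subtopology Y (f ` U)) f"
      using assms unfolding local_homeomorphism_map_def by blast
    have "openin (subtopology X U) (W \<inter> U)"
      using W U(1) by (simp add: openin_open_subtopology openin_Int)
    then have "openin (subtopology Y (f ` U)) (f ` (W \<inter> U))"
      using homeomorphic_imp_open_map[OF U(4)] by (simp add: open_map_def)
    then have "openin Y (f ` (W \<inter> U))"
      using openin_open_subtopology[OF U(3)] by blast
    then show "\<exists>T. openin Y T \<and> y \<in> T \<and> T \<subseteq> f ` W"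
      using x U(2) by (intro exI[of _ "f ` (W \<inter> U)"]) auto
  qed
qed

context ample_groupoid
begin

abbreviation "product_set K L \<equiv> {a \<cdot> b | a b. a \<in> K \<and> b \<in> L \<and> composable \<G> a b}"

definition compact_open_bisections :: "'g set set" where
  "compact_open_bisections = {U. compact_open (atop \<G>) U \<and> bisection \<G> U}"

lemma openin_arr: "openin (atop \<G>) U \<Longrightarrow> U \<subseteq> arr \<G>"
  using openin_subset topspace_atop by blast

lemma openin_product_set:
  assumes K: "openin (atop \<G>) K" and L: "openin (atop \<G>) L"
  shows "openin (atop \<G>) (product_set K L)"
proof (subst openin_subopen, intro ballI)
  let ?X = "atop \<G>"
  let ?C = "{(a, c). a \<in> arr \<G> \<and> c \<in> arr \<G> \<and> rng \<G> a = rng \<G> c}"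
  let ?Q = "subtopology (prod_topology ?X ?X) ?C"
  let ?m = "\<lambda>(a, c). ginv a \<cdot> c"
  \<comment> \<open>Near a given product \<open>ab\<close> every \<open>c\<close> factors as \<open>a'(a'\<^sup>-\<^sup>1c)\<close> with \<open>a'\<close> close to \<open>a\<close>.\<close>
  have inv: "continuous_map ?X ?X ginv"
    using continuous_inverse unfolding ginv_def .
  have 1: "continuous_map ?Q (prod_topology ?X ?X) (\<lambda>p. (ginv (fst p), snd p))"
    by (intro continuous_map_pairedI continuous_map_compose[OF _ inv, unfolded comp_def]
        continuous_map_from_subtopology continuous_map_fst continuous_map_snd)
  have 2: "continuous_map ?Q (subtopology (prod_topology ?X ?X) {(a, b). composable \<G> a b})
      (\<lambda>p. (ginv (fst p), snd p))"
    by (rule continuous_map_into_subtopology[OF 1])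
      (auto simp: composable_def topspace_atop)
  have cont: "continuous_map ?Q ?X ?m"
    using continuous_map_compose[OF 2 continuous_prd] by (simp add: comp_def case_prod_unfold)
  fix c assume "c \<in> product_set K L"
  then obtain a b where ab: "a \<in> K" "b \<in> L" "composable \<G> a b" "c = a \<cdot> b" by blast
  have arr: "a \<in> arr \<G>" "b \<in> arr \<G>" "c \<in> arr \<G>" "src \<G> a = rng \<G> b" "rng \<G> c = rng \<G> a"
    using ab prd_closed rng_prd by (auto simp: composable_def)
  have "openin ?Q {p \<in> topspace ?Q. ?m p \<in> L}"
    by (rule openin_continuous_map_preimage[OF cont L])
  then obtain T where T: "openin (prod_topology ?X ?X) T" "{p \<in> topspace ?Q. ?m p \<in> L} = T \<inter> ?C"
    unfolding openin_subtopology by blast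
  have "(a, c) \<in> {p \<in> topspace ?Q. ?m p \<in> L}"
    using arr ab ginv_cancel_left[of a b] by (simp add: topspace_atop)
  then have "(a, c) \<in> T" using T(2) by blast
  then obtain U W where UW: "openin ?X U" "openin ?X W" "a \<in> U" "c \<in> W" "U \<times> W \<subseteq> T"
    using T(1) unfolding openin_prod_topology_alt by meson
  have "open_map ?X (vtop \<G>) (rng \<G>)"
    by (rule local_homeomorphism_open_map[OF local_homeo_rng])
  then have "openin (vtop \<G>) (rng \<G> ` (U \<inter> K))"
    using UW K by (simp add: open_map_def openin_Int)
  then have "openin ?X {x \<in> topspace ?X. rng \<G> x \<in> rng \<G> ` (U \<inter> K)}"
    by (rule openin_continuous_map_preimage[OF continuous_rng])
  then have O: "openin ?X (W \<inter> {x \<in> arr \<G>. rng \<G> x \<in> rng \<G> ` (U \<inter> K)})"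
    using UW by (simp add: topspace_atop openin_Int)
  moreover have "W \<inter> {x \<in> arr \<G>. rng \<G> x \<in> rng \<G> ` (U \<inter> K)} \<subseteq> product_set K L"
  proof
    fix x assume "x \<in> W \<inter> {x \<in> arr \<G>. rng \<G> x \<in> rng \<G> ` (U \<inter> K)}"
    then obtain a' where x: "x \<in> W" "x \<in> arr \<G>" and a': "a' \<in> U" "a' \<in> K" "rng \<G> x = rng \<G> a'" by blast
    have a'G: "a' \<in> arr \<G>" using a' openin_arr[OF K] by blast
    have "(a', x) \<in> T \<inter> ?C" using UW x a' a'G by auto
    then have "ginv a' \<cdot> x \<in> L" unfolding T(2)[symmetric] by simp
    moreover have "a' \<cdot> (ginv a' \<cdot> x) = x" using ginv_cancel_left'[OF a'G x(2)] a' by simp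
    moreover have "composable \<G> a' (ginv a' \<cdot> x)"
    proof -
      have c: "composable \<G> (ginv a') x" using a'G x a' by (simp add: composable_def)
      then show ?thesis using a'G x rng_prd[OF c] prd_closed[OF c] by (simp add: composable_def)
    qed
    ultimately show "x \<in> product_set K L" using a' by (intro CollectI exI[of _ a'] exI[of _ "ginv a' \<cdot> x"]) simp
  qed
  moreover have "c \<in> W \<inter> {x \<in> arr \<G>. rng \<G> x \<in> rng \<G> ` (U \<inter> K)}"
    using arr UW ab by auto
  ultimately show "\<exists>T. openin ?X T \<and> c \<in> T \<and> T \<subseteq> product_set K L" by blast
qed

lemma compactin_product_set:
  assumes K: "compactin (atop \<G>) K" and L: "compactin (atop \<G>) L"
  shows "compactin (atop \<G>) (product_set K L)"
proof -
  let ?X = "atop \<G>"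
  let ?P = "prod_topology ?X ?X" and ?C = "{(a, b). composable \<G> a b}"
  have 1: "continuous_map ?P (vtop \<G>) (\<lambda>p. src \<G> (fst p))" "continuous_map ?P (vtop \<G>) (\<lambda>p. rng \<G> (snd p))"
    using continuous_map_compose[OF continuous_map_fst continuous_src]
      continuous_map_compose[OF continuous_map_snd continuous_rng] by (simp_all add: comp_def)
  have "closedin ?P {p \<in> topspace ?P. src \<G> (fst p) = rng \<G> (snd p)}"
    by (rule closedin_continuous_maps_eq[OF Hausdorff_vtop 1])
  then have "compactin ?P ({p \<in> topspace ?P. src \<G> (fst p) = rng \<G> (snd p)} \<inter> (K \<times> L))"
    by (rule closed_Int_compactin) (simp add: compactin_Times K L)
  moreover have "{p \<in> topspace ?P. src \<G> (fst p) = rng \<G> (snd p)} \<inter> (K \<times> L) \<subseteq> ?C"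
    by (auto simp: composable_def topspace_atop)
  ultimately have "compactin (subtopology ?P ?C) ({p \<in> topspace ?P. src \<G> (fst p) = rng \<G> (snd p)} \<inter> (K \<times> L))"
    by (simp add: compactin_subtopology)
  then have "compactin ?X ((\<lambda>(a, b). a \<cdot> b) ` ({p \<in> topspace ?P. src \<G> (fst p) = rng \<G> (snd p)} \<inter> (K \<times> L)))"
    by (rule image_compactin[OF _ continuous_prd])
  moreover have "(\<lambda>(a, b). a \<cdot> b) ` ({p \<in> topspace ?P. src \<G> (fst p) = rng \<G> (snd p)} \<inter> (K \<times> L)) = product_set K L"
    using compactin_subset_topspace[OF K] compactin_subset_topspace[OF L]
    by (force simp: composable_def topspace_atop image_iff)
  ultimately show ?thesis by simp
qed

lemma bisection_product_set:
  assumes K: "bisection \<G> K" and L: "bisection \<G> L"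
  shows "bisection \<G> (product_set K L)"
    and "\<lbrakk>a \<in> K; b \<in> L; composable \<G> a b; a' \<in> K; b' \<in> L; composable \<G> a' b'; a \<cdot> b = a' \<cdot> b'\<rbrakk> \<Longrightarrow> a = a' \<and> b = b'"
proof -
  have inj: "inj_on (src \<G>) K" "inj_on (rng \<G>) K" "inj_on (src \<G>) L" "inj_on (rng \<G>) L"
    using K L by (auto simp: bisection_def)
  have src: "a = a' \<and> b = b'"
    if "a \<in> K" "b \<in> L" "composable \<G> a b" "a' \<in> K" "b' \<in> L" "composable \<G> a' b'"
      "src \<G> (a \<cdot> b) = src \<G> (a' \<cdot> b')" for a b a' b'
    using that src_prd inj_onD[OF inj(3)] inj_onD[OF inj(1)] unfolding composable_def by metis
  have rng: "a = a' \<and> b = b'"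
    if "a \<in> K" "b \<in> L" "composable \<G> a b" "a' \<in> K" "b' \<in> L" "composable \<G> a' b'"
      "rng \<G> (a \<cdot> b) = rng \<G> (a' \<cdot> b')" for a b a' b'
    using that rng_prd inj_onD[OF inj(2)] inj_onD[OF inj(4)] unfolding composable_def by metis
  show "bisection \<G> (product_set K L)"
    unfolding bisection_def
  proof (intro conjI inj_onI)
    show "product_set K L \<subseteq> arr \<G>" using prd_closed by auto
    show "x = y" if "x \<in> product_set K L" "y \<in> product_set K L" "src \<G> x = src \<G> y" for x y
      using that src by blast
    show "x = y" if "x \<in> product_set K L" "y \<in> product_set K L" "rng \<G> x = rng \<G> y" for x y
      using that rng by blast
  qed
  show "\<lbrakk>a \<in> K; b \<in> L; composable \<G> a b; a' \<in> K; b' \<in> L; composable \<G> a' b'; a \<cdot> b = a' \<cdot> b'\<rbrakk> \<Longrightarrow> a = a' \<and> b = b'"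
    using src by metis
qed

lemma compact_open_base_bisections: "compact_open_base (atop \<G>) compact_open_bisections"
proof
  fix K assume K: "K \<in> compact_open_bisections"
  have "Hausdorff_space (subtopology (atop \<G>) K)"
  proof (rule Hausdorff_space_injective_preimage[OF Hausdorff_vtop])
    show "continuous_map (subtopology (atop \<G>) K) (vtop \<G>) (src \<G>)"
      by (rule continuous_map_from_subtopology[OF continuous_src])
    show "inj_on (src \<G>) (topspace (subtopology (atop \<G>) K))"
      using K by (auto simp: compact_open_bisections_def bisection_def intro: inj_on_subset)
  qed
  then show "compact_open_Hausdorff (atop \<G>) K"
    using K by (simp add: compact_open_Hausdorff_def compact_open_bisections_def)
next
  fix K L assume "K \<in> compact_open_bisections" "compact_open (atop \<G>) L" "L \<subseteq> K"
  then show "L \<in> compact_open_bisections"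
    by (auto simp: compact_open_bisections_def bisection_def intro: inj_on_subset)
next
  fix W x assume "openin (atop \<G>) W" "x \<in> W"
  then show "\<exists>K\<in>compact_open_bisections. x \<in> K \<and> K \<subseteq> W"
    using compact_open_bisection_basis[of W x]
    by (auto simp: compact_open_bisections_def compact_open_def)
qed

lemma product_set_bisections:
  assumes "K \<in> compact_open_bisections" "L \<in> compact_open_bisections"
  shows "product_set K L \<in> compact_open_bisections"
proof -
  have "openin (atop \<G>) K" "compactin (atop \<G>) K" "bisection \<G> K"
    "openin (atop \<G>) L" "compactin (atop \<G>) L" "bisection \<G> L"
    using assms by (simp_all add: compact_open_bisections_def compact_open_def)
  then show ?thesis
    unfolding compact_open_bisections_def compact_open_def mem_Collect_eq
    by (intro conjI openin_product_set compactin_product_set bisection_product_set(1))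
qed

end

locale ample_algebra = bimod_algebra R A + ample_groupoid \<G>
  for R :: "('r, 'm) ring_scheme" and A :: "('r, 'a, 'k) bimod_algebra_scheme" (structure)
    and \<G> :: "('g, 'v, 'l) top_semigroupoid_scheme" (structure)
begin

sublocale convolvable R A \<G>
  by unfold_locales (rule src_prd)
sublocale base: compact_open_base "atop \<G>" compact_open_bisections
  by (rule compact_open_base_bisections)

lemma steinberg_fibre_finite:
  assumes "f \<in> steinberg_functions A \<G>"
  shows "fibre_finite A \<G> f"
  using assms compact_open_base_bisections
proof (induction rule: steinberg_induct)
  case zero
  show ?case by (rule fibre_finite_zero)
next
  case (locally_constant K f)
  have "finite {a \<in> arr \<G>. src \<G> a = v \<and> f a \<noteq> \<zero>}" for v
  proof (rule finite_subset)
    have inj: "inj_on (src \<G>) K"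
      using locally_constant by (simp add: compact_open_bisections_def bisection_def)
    show "{a \<in> arr \<G>. src \<G> a = v \<and> f a \<noteq> \<zero>} \<subseteq> {THE a. a \<in> K \<and> src \<G> a = v}"
    proof
      fix a assume "a \<in> {a \<in> arr \<G>. src \<G> a = v \<and> f a \<noteq> \<zero>}"
      then have a: "a \<in> K" "src \<G> a = v"
        using locally_constantD(1)[OF locally_constant(2), of a] by auto
      then have "(THE a. a \<in> K \<and> src \<G> a = v) = a"
        using inj_onD[OF inj] by (intro the_equality) auto
      then show "a \<in> {THE a. a \<in> K \<and> src \<G> a = v}" by simp
    qed
  qed simp
  then show ?case using locally_constantD(2)[OF locally_constant(2)] by (simp add: fibre_finite_def)
next
  case (add f g)
  then show ?case by (intro fibre_finite_add)
qed

text \<open>An element of the product of two bisections \<open>K\<close> and \<open>L\<close> has a unique factorization \<open>ab\<close> with \<open>a \<in> K\<close> and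
\<open>b \<in> L\<close>, so the convolution takes the value \<open>f(a)g(b)\<close> there.\<close>

lemma locally_constant_convolution:
  assumes K: "K \<in> compact_open_bisections" and L: "L \<in> compact_open_bisections"
    and f: "f \<in> locally_constant A (atop \<G>) K" and g: "g \<in> locally_constant A (atop \<G>) L"
  shows "convolution A \<G> f g \<in> locally_constant A (atop \<G>) (product_set K L)"
proof -
  have ff: "fibre_finite A \<G> f" "fibre_finite A \<G> g"
    using steinberg_fibre_finite locally_constant_steinberg[OF base.base_member] K L f g by blast+
  note fD = locally_constantD[OF f] and gD = locally_constantD[OF g]
  have bis: "bisection \<G> K" "bisection \<G> L"
    using K L by (auto simp: compact_open_bisections_def)
  have at_product: "convolution A \<G> f g (a \<cdot>\<^bsub>\<G>\<^esub> b) = f a \<otimes> g b" if ab: "a \<in> K" "b \<in> L" "composable \<G> a b" for a b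
  proof -
    have "f a' \<otimes> g b' = \<zero>" if "composable \<G> a' b'" "a' \<cdot>\<^bsub>\<G>\<^esub> b' = a \<cdot>\<^bsub>\<G>\<^esub> b" "(a', b') \<noteq> (a, b)" for a' b'
    proof (cases "a' \<in> K \<and> b' \<in> L")
      case True
      then show ?thesis using bisection_product_set(2)[OF bis, of a' b' a b] ab that by auto
    next
      case False
      then show ?thesis using fD(1,2) gD(1,2) l_null r_null by metis
    qed
    then show ?thesis unfolding convolution_fsum[OF ff]
      using fsum_singleton[of "(a, b)" "{(a', b'). composable \<G> a' b' \<and> a' \<cdot>\<^bsub>\<G>\<^esub> b' = a \<cdot>\<^bsub>\<G>\<^esub> b}" "\<lambda>(a, b). f a \<otimes> g b"]
        ab fD(2) gD(2) m_closed by auto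
  qed
  have off: "convolution A \<G> f g c = \<zero>" if "c \<notin> product_set K L" for c
    unfolding convolution_fsum[OF ff]
  proof (rule fsum_zero, clarify)
    fix a b assume ab: "composable \<G> a b" "c = a \<cdot>\<^bsub>\<G>\<^esub> b"
    then have "a \<notin> K \<or> b \<notin> L" using that by blast
    then show "f a \<otimes> g b = \<zero>" using fD(1,2) gD(1,2) l_null r_null by metis
  qed
  have "{c \<in> product_set K L. convolution A \<G> f g c = x} =
      (\<Union>(y, z)\<in>{(y, z). y \<otimes> z = x}. product_set {a \<in> K. f a = y} {b \<in> L. g b = z})" for x
  proof safe
    fix a b assume "a \<in> K" "b \<in> L" "composable \<G> a b"
    then show "a \<cdot>\<^bsub>\<G>\<^esub> b \<in> (\<Union>(y, z)\<in>{(y, z). y \<otimes> z = convolution A \<G> f g (a \<cdot>\<^bsub>\<G>\<^esub> b)}.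
        product_set {a \<in> K. f a = y} {b \<in> L. g b = z})"
      using at_product by (intro UN_I[of "(f a, g b)"]) auto
  qed (use at_product in auto)
  moreover have "openin (atop \<G>) (\<Union>(y, z)\<in>{(y, z). y \<otimes> z = x}. product_set {a \<in> K. f a = y} {b \<in> L. g b = z})" for x
    using openin_product_set[OF fD(3) gD(3)] by (intro openin_Union) auto
  ultimately have "openin (atop \<G>) {c \<in> product_set K L. convolution A \<G> f g c = x}" for x by simp
  then show ?thesis
    using off convolution_value_closed[OF ff] by (simp add: locally_constant_def)
qed

lemma convolution_closed:
  assumes "f \<in> steinberg_functions A \<G>" and g: "g \<in> steinberg_functions A \<G>"
  shows "convolution A \<G> f g \<in> steinberg_functions A \<G>"
  using assms(1) compact_open_base_bisections
proof (induction rule: steinberg_induct)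
  case zero
  show ?case by (simp add: convolution_zero steinberg_functions.zero)
next
  case (locally_constant K f)
  have f: "fibre_finite A \<G> f"
    using steinberg_fibre_finite locally_constant_steinberg[OF base.base_member] locally_constant by blast
  show ?case using g compact_open_base_bisections
  proof (induction rule: steinberg_induct)
    case zero
    show ?case by (simp add: convolution_zero steinberg_functions.zero)
  next
    case (locally_constant L g)
    show ?case
      by (rule locally_constant_steinberg[OF base.base_member[OF product_set_bisections]
            locally_constant_convolution]; fact)
  next
    case (add g h)
    then show ?case
      by (simp add: convolution_add_right[OF f] steinberg_fibre_finite steinberg_functions.add)
  qed
next
  case (add f h)
  then show ?case
    using g by (simp add: convolution_add_left steinberg_fibre_finite steinberg_functions.add)
qed

end

section \<open>Inverse semigroupoids and their canonical order\<close>

context inverse_semigroupoid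
begin

lemma star: "s \<in> arr S \<Longrightarrow> is_star S s (star S s)"
  unfolding star_def by (rule theI'[OF ex1_star])

lemma star_unique: "is_star S s t \<Longrightarrow> star S s = t"
  using ex1_star star by (metis is_star_def)

lemma star_closed [simp]:
  assumes "s \<in> arr S"
  shows "star S s \<in> arr S" "src S (star S s) = rng S s" "rng S (star S s) = src S s"
  using star[OF assms] by (simp_all add: is_star_def)

lemma star_star: "s \<in> arr S \<Longrightarrow> star S (star S s) = s"
  using star[of s] by (intro star_unique) (simp add: is_star_def)

lemmas prd_simps = composable_def prd_closed src_prd rng_prd prd_assoc

lemma star_cancel:
  assumes "s \<in> arr S"
  shows "s \<cdot> (star S s \<cdot> s) = s" "star S s \<cdot> (s \<cdot> star S s) = star S s"
    "x \<in> arr S \<Longrightarrow> rng S x = src S s \<Longrightarrow> s \<cdot> (star S s \<cdot> (s \<cdot> x)) = s \<cdot> x"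
    "x \<in> arr S \<Longrightarrow> rng S x = rng S s \<Longrightarrow> star S s \<cdot> (s \<cdot> (star S s \<cdot> x)) = star S s \<cdot> x"
proof -
  have 1: "(s \<cdot> star S s) \<cdot> s = s" "(star S s \<cdot> s) \<cdot> star S s = star S s"
    using star[OF assms] by (simp_all add: is_star_def)
  show 2: "s \<cdot> (star S s \<cdot> s) = s" "star S s \<cdot> (s \<cdot> star S s) = star S s"
    using 1 assms by (simp_all add: prd_simps)
  show "s \<cdot> (star S s \<cdot> (s \<cdot> x)) = s \<cdot> x" if "x \<in> arr S" "rng S x = src S s"
  proof -
    have "(s \<cdot> (star S s \<cdot> s)) \<cdot> x = s \<cdot> (star S s \<cdot> (s \<cdot> x))"
      using that assms by (simp add: prd_simps)
    then show ?thesis by (simp add: 2)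
  qed
  show "star S s \<cdot> (s \<cdot> (star S s \<cdot> x)) = star S s \<cdot> x" if "x \<in> arr S" "rng S x = rng S s"
  proof -
    have "(star S s \<cdot> (s \<cdot> star S s)) \<cdot> x = star S s \<cdot> (s \<cdot> (star S s \<cdot> x))"
      using that assms by (simp add: prd_simps)
    then show ?thesis by (simp add: 2)
  qed
qed

definition idempotent :: "'w \<Rightarrow> 's \<Rightarrow> bool" where
  "idempotent v e \<longleftrightarrow> e \<in> arr S \<and> src S e = v \<and> rng S e = v \<and> e \<cdot> e = e"

lemma idempotentD:
  assumes "idempotent v e"
  shows "e \<in> arr S" "src S e = v" "rng S e = v" "e \<cdot> e = e"
    "x \<in> arr S \<Longrightarrow> rng S x = v \<Longrightarrow> e \<cdot> (e \<cdot> x) = e \<cdot> x"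
proof -
  show e: "e \<in> arr S" "src S e = v" "rng S e = v" "e \<cdot> e = e"
    using assms by (simp_all add: idempotent_def)
  assume x: "x \<in> arr S" "rng S x = v"
  have "(e \<cdot> e) \<cdot> x = e \<cdot> (e \<cdot> x)"
    by (rule prd_assoc) (use e x in \<open>simp_all add: composable_def\<close>)
  then show "e \<cdot> (e \<cdot> x) = e \<cdot> x" by (simp add: e(4))
qed

lemma star_idempotent: "idempotent v e \<Longrightarrow> star S e = e"
  by (rule star_unique) (simp add: is_star_def idempotent_def)

lemma idempotent_star_prd:
  assumes "s \<in> arr S"
  shows "idempotent (src S s) (star S s \<cdot> s)" "idempotent (rng S s) (s \<cdot> star S s)"
  using assms by (simp_all add: idempotent_def prd_simps star_cancel)

text \<open>Let \<open>x\<close> be the inverse of \<open>ef\<close>. Then \<open>fxe\<close> is an inverse of \<open>ef\<close> as well, hence equal to \<open>x\<close>, and it is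
idempotent. An idempotent is its own inverse, so \<open>ef = x\<close>.\<close>

lemma idempotent_prd:
  assumes e: "idempotent v e" and f: "idempotent v f"
  shows "idempotent v (e \<cdot> f)"
proof -
  note E = idempotentD[OF e] and F = idempotentD[OF f]
  define x where "x = star S (e \<cdot> f)"
  have ef: "e \<cdot> f \<in> arr S" "src S (e \<cdot> f) = v" "rng S (e \<cdot> f) = v"
    using E(1-3) F(1-3) by (simp_all add: prd_simps)
  have x: "x \<in> arr S" "src S x = v" "rng S x = v"
    using ef by (simp_all add: x_def)
  have 1: "e \<cdot> (f \<cdot> (x \<cdot> (e \<cdot> f))) = e \<cdot> f" and 2: "x \<cdot> (e \<cdot> (f \<cdot> x)) = x"
    using star_cancel(1,2)[OF ef(1)] E(1-3) F(1-3) x unfolding x_def[symmetric]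
    by (simp_all add: prd_simps)
  have 3: "x \<cdot> (e \<cdot> (f \<cdot> (x \<cdot> e))) = x \<cdot> e"
  proof -
    have "(x \<cdot> (e \<cdot> (f \<cdot> x))) \<cdot> e = x \<cdot> (e \<cdot> (f \<cdot> (x \<cdot> e)))"
      using E(1-3) F(1-3) x by (simp add: prd_simps)
    then show ?thesis using 2 by simp
  qed
  define y where "y = f \<cdot> (x \<cdot> e)"
  have y: "y \<in> arr S" "src S y = v" "rng S y = v"
    using E(1-3) F(1-3) x by (simp_all add: y_def prd_simps)
  have "(e \<cdot> f) \<cdot> y \<cdot> (e \<cdot> f) = e \<cdot> f"
    unfolding y_def using E F x 1 by (simp add: prd_simps)
  moreover have "y \<cdot> (e \<cdot> f) \<cdot> y = y"
    unfolding y_def using E F x 3 by (simp add: prd_simps)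
  ultimately have "is_star S (e \<cdot> f) y"
    using ef y by (simp add: is_star_def)
  then have xy: "x = y" unfolding x_def by (rule star_unique)
  have "y \<cdot> y = y"
    unfolding y_def using E F x 3 by (simp add: prd_simps)
  then have "idempotent v x" using x xy by (simp add: idempotent_def)
  moreover have "star S x = e \<cdot> f" using star_star[OF ef(1)] by (simp add: x_def)
  ultimately show ?thesis using star_idempotent by metis
qed

text \<open>Since \<open>ef\<close> and \<open>fe\<close> are idempotent, they are inverse to each other, and an idempotent is its own inverse.\<close>

lemma idempotent_commute:
  assumes e: "idempotent v e" and f: "idempotent v f"
  shows "e \<cdot> f = f \<cdot> e"
proof -
  note E = idempotentD[OF e] and F = idempotentD[OF f]
    and EF = idempotentD[OF idempotent_prd[OF e f]] and FE = idempotentD[OF idempotent_prd[OF f e]]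
  have "e \<cdot> (f \<cdot> (e \<cdot> f)) = e \<cdot> f" "f \<cdot> (e \<cdot> (f \<cdot> e)) = f \<cdot> e"
    using EF(4) FE(4) E(1-3) F(1-3) by (simp_all add: prd_simps)
  then have "is_star S (e \<cdot> f) (f \<cdot> e)"
    using E F by (simp add: is_star_def prd_simps)
  then show ?thesis using star_unique star_idempotent[OF idempotent_prd[OF e f]] by metis
qed

lemma star_prd:
  assumes "composable S s t"
  shows "star S (s \<cdot> t) = star S t \<cdot> star S s"
proof (rule star_unique)
  have st: "s \<in> arr S" "t \<in> arr S" "rng S t = src S s"
    using assms by (simp_all add: composable_def)
  have comm: "(t \<cdot> star S t) \<cdot> (star S s \<cdot> s) = (star S s \<cdot> s) \<cdot> (t \<cdot> star S t)"
    using idempotent_commute idempotent_star_prd st by metis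
  have "s \<cdot> ((t \<cdot> star S t) \<cdot> (star S s \<cdot> s)) \<cdot> t = s \<cdot> t"
    unfolding comm using st by (simp add: prd_simps star_cancel)
  moreover have "star S t \<cdot> ((star S s \<cdot> s) \<cdot> (t \<cdot> star S t)) \<cdot> star S s = star S t \<cdot> star S s"
    unfolding comm[symmetric] using st by (simp add: prd_simps star_cancel)
  ultimately show "is_star S (s \<cdot> t) (star S t \<cdot> star S s)"
    using st by (simp add: is_star_def prd_simps)
qed

lemma canonical_le_iff_right:
  "canonical_le S u s \<longleftrightarrow> s \<in> arr S \<and> (\<exists>e. idempotent (src S s) e \<and> u = s \<cdot> e)"
proof (intro iffI conjI)
  assume u: "canonical_le S u s"
  then show "s \<in> arr S" by (simp add: canonical_le_def)
  show "\<exists>e. idempotent (src S s) e \<and> u = s \<cdot> e"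
  proof (intro exI conjI)
    have u': "u \<in> arr S" "s \<in> arr S" "src S u = src S s" "rng S u = rng S s" "u = s \<cdot> star S u \<cdot> u"
      using u by (simp_all add: canonical_le_def)
    show "idempotent (src S s) (star S u \<cdot> u)" using idempotent_star_prd(1)[of u] u' by simp
    have "s \<cdot> star S u \<cdot> u = s \<cdot> (star S u \<cdot> u)"
      by (rule prd_assoc) (use u'(1-4) in \<open>simp_all add: composable_def\<close>)
    then show "u = s \<cdot> (star S u \<cdot> u)" using u'(5) by simp
  qed
next
  assume "s \<in> arr S \<and> (\<exists>e. idempotent (src S s) e \<and> u = s \<cdot> e)"
  then obtain e where s: "s \<in> arr S" and e: "idempotent (src S s) e" and u: "u = s \<cdot> e" by blast
  note E = idempotentD[OF e]
  have "star S u = e \<cdot> star S s"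
    unfolding u using s E star_idempotent[OF e] by (simp add: star_prd composable_def)
  moreover have "e \<cdot> (star S s \<cdot> s) = (star S s \<cdot> s) \<cdot> e"
    by (rule idempotent_commute[OF e idempotent_star_prd(1)[OF s]])
  then have "s \<cdot> (e \<cdot> (star S s \<cdot> s)) \<cdot> e = s \<cdot> e"
    using s E by (simp add: prd_simps star_cancel)
  ultimately show "canonical_le S u s"
    using s E by (simp add: canonical_le_def u prd_simps)
qed

lemma canonical_le_iff_left:
  "canonical_le S u s \<longleftrightarrow> s \<in> arr S \<and> (\<exists>f. idempotent (rng S s) f \<and> u = f \<cdot> s)"
proof (intro iffI conjI)
  assume u: "canonical_le S u s"
  then show s: "s \<in> arr S" by (simp add: canonical_le_def)
  obtain e where e: "idempotent (src S s) e" "u = s \<cdot> e" using u canonical_le_iff_right by blast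
  note E = idempotentD[OF e(1)]
  have comm: "e \<cdot> (star S s \<cdot> s) = (star S s \<cdot> s) \<cdot> e"
    by (rule idempotent_commute[OF e(1) idempotent_star_prd(1)[OF s]])
  show "\<exists>f. idempotent (rng S s) f \<and> u = f \<cdot> s"
  proof (intro exI conjI)
    have "s \<cdot> (e \<cdot> (star S s \<cdot> s)) = s \<cdot> e"
      unfolding comm using s E by (simp add: prd_simps star_cancel)
    then show "u = (s \<cdot> e \<cdot> star S s) \<cdot> s" using s E e(2) by (simp add: prd_simps)
    have "s \<cdot> (e \<cdot> (star S s \<cdot> s)) \<cdot> (e \<cdot> star S s) = s \<cdot> (e \<cdot> star S s)"
      unfolding comm using s E by (simp add: prd_simps star_cancel)
    then show "idempotent (rng S s) (s \<cdot> e \<cdot> star S s)"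
      using s E by (simp add: idempotent_def prd_simps)
  qed
next
  assume "s \<in> arr S \<and> (\<exists>f. idempotent (rng S s) f \<and> u = f \<cdot> s)"
  then obtain f where s: "s \<in> arr S" and f: "idempotent (rng S s) f" and u: "u = f \<cdot> s" by blast
  note F = idempotentD[OF f]
  have comm: "f \<cdot> (s \<cdot> star S s) = (s \<cdot> star S s) \<cdot> f"
    by (rule idempotent_commute[OF f idempotent_star_prd(2)[OF s]])
  have "(s \<cdot> star S s) \<cdot> f \<cdot> s = f \<cdot> s"
    unfolding comm[symmetric] using s F by (simp add: prd_simps star_cancel)
  then have "u = s \<cdot> (star S s \<cdot> f \<cdot> s)" using s F u by (simp add: prd_simps)
  moreover have "star S s \<cdot> (f \<cdot> (s \<cdot> star S s)) \<cdot> (f \<cdot> s) = star S s \<cdot> (f \<cdot> s)"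
    unfolding comm using s F by (simp add: prd_simps star_cancel)
  then have "idempotent (src S s) (star S s \<cdot> f \<cdot> s)"
    using s F by (simp add: idempotent_def prd_simps)
  ultimately show "canonical_le S u s" unfolding canonical_le_iff_right using s by blast
qed

lemma canonical_le_refl: "s \<in> arr S \<Longrightarrow> canonical_le S s s"
  unfolding canonical_le_iff_right using idempotent_star_prd(1) star_cancel(1) by metis

lemma canonical_leD:
  assumes "canonical_le S u s"
  shows "u \<in> arr S" "s \<in> arr S" "src S u = src S s" "rng S u = rng S s"
  using assms by (simp_all add: canonical_le_def)

lemma canonical_le_trans:
  assumes us: "canonical_le S u s" and st: "canonical_le S s t"
  shows "canonical_le S u t"
proof -
  obtain e where e: "idempotent (src S s) e" "u = s \<cdot> e" using us canonical_le_iff_right by blast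
  obtain f where f: "idempotent (src S t) f" "s = t \<cdot> f" using st canonical_le_iff_right by blast
  have v: "src S s = src S t" "t \<in> arr S" using st by (simp_all add: canonical_le_def)
  have "u = t \<cdot> (f \<cdot> e)"
    using idempotentD[OF e(1)] idempotentD[OF f(1)] v e f by (simp add: prd_simps)
  moreover have "idempotent (src S t) (f \<cdot> e)" using idempotent_prd f(1) e(1) v by simp
  ultimately show ?thesis using canonical_le_iff_right v by blast
qed

lemma canonical_le_star:
  assumes "canonical_le S u s"
  shows "canonical_le S (star S u) (star S s)"
proof -
  obtain e where e: "idempotent (src S s) e" "u = s \<cdot> e" and s: "s \<in> arr S"
    using assms canonical_le_iff_right by blast
  have "star S u = e \<cdot> star S s"
    using star_prd[of s e] star_idempotent[OF e(1)] idempotentD[OF e(1)] s e(2)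
    by (simp add: composable_def)
  then show ?thesis using e s canonical_le_iff_left[of "star S u" "star S s"] by auto
qed

lemma canonical_le_prd:
  assumes us: "canonical_le S u s" and vt: "canonical_le S v t" and st: "composable S s t"
  shows "canonical_le S (u \<cdot> v) (s \<cdot> t)"
proof -
  have arr: "s \<in> arr S" "t \<in> arr S" "rng S t = src S s" using st by (simp_all add: composable_def)
  obtain e where e: "idempotent (src S s) e" "u = s \<cdot> e" using us canonical_le_iff_right by blast
  obtain g where g: "idempotent (src S t) g" "v = t \<cdot> g" using vt canonical_le_iff_right by blast
  note E = idempotentD[OF e(1)] and Gd = idempotentD[OF g(1)]
  have "canonical_le S (e \<cdot> t) t" unfolding canonical_le_iff_left using arr e(1) by auto
  then obtain h where h: "idempotent (src S t) h" "e \<cdot> t = t \<cdot> h" using canonical_le_iff_right by blast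
  note Hd = idempotentD[OF h(1)]
  have "u \<cdot> v = s \<cdot> ((e \<cdot> t) \<cdot> g)" unfolding e(2) g(2) using arr E Gd by (simp add: prd_simps)
  also have "\<dots> = (s \<cdot> t) \<cdot> (h \<cdot> g)" unfolding h(2) using arr Hd Gd by (simp add: prd_simps)
  finally have "u \<cdot> v = (s \<cdot> t) \<cdot> (h \<cdot> g)" .
  moreover have "idempotent (src S (s \<cdot> t)) (h \<cdot> g)"
    using idempotent_prd[OF h(1) g(1)] st by (simp add: src_prd)
  ultimately show ?thesis unfolding canonical_le_iff_right using st prd_closed by blast
qed

text \<open>This common lower bound of \<open>u\<close> and \<open>v\<close> makes equality of germs transitive.\<close>

lemma canonical_le_meet:
  assumes us: "canonical_le S u s" and vs: "canonical_le S v s"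
  shows "canonical_le S (u \<cdot> (star S v \<cdot> v)) u" "canonical_le S (u \<cdot> (star S v \<cdot> v)) v"
proof -
  have arr: "u \<in> arr S" "v \<in> arr S" "s \<in> arr S" "src S u = src S s" "src S v = src S s"
    using us vs by (simp_all add: canonical_le_def)
  have p: "idempotent (src S s) (star S v \<cdot> v)" using idempotent_star_prd(1)[OF arr(2)] arr by simp
  then show "canonical_le S (u \<cdot> (star S v \<cdot> v)) u" unfolding canonical_le_iff_right using arr by auto
  obtain e where e: "idempotent (src S s) e" "u = s \<cdot> e" using us canonical_le_iff_right by blast
  note E = idempotentD[OF e(1)] and P = idempotentD[OF p]
  have "v = s \<cdot> (star S v \<cdot> v)"
  proof -
    have "s \<cdot> star S v \<cdot> v = s \<cdot> (star S v \<cdot> v)"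
      by (rule prd_assoc) (use vs in \<open>simp_all add: composable_def canonical_le_def\<close>)
    then show ?thesis using vs by (simp add: canonical_le_def)
  qed
  moreover have "u \<cdot> (star S v \<cdot> v) = s \<cdot> (e \<cdot> (star S v \<cdot> v))"
    unfolding e(2) by (rule prd_assoc) (use arr E P in \<open>simp_all add: composable_def\<close>)
  moreover have "\<dots> = s \<cdot> ((star S v \<cdot> v) \<cdot> e)" by (simp add: idempotent_commute[OF e(1) p])
  moreover have "\<dots> = (s \<cdot> (star S v \<cdot> v)) \<cdot> e"
    by (rule prd_assoc[symmetric]) (use arr E P in \<open>simp_all add: composable_def\<close>)
  ultimately have "u \<cdot> (star S v \<cdot> v) = v \<cdot> e" by simp
  then show "canonical_le S (u \<cdot> (star S v \<cdot> v)) v" unfolding canonical_le_iff_right using arr e(1) by auto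
qed

lemma canonical_le_prd_star_idempotent:
  assumes "canonical_le S u s"
  shows "composable S u (star S s)" "idempotent (rng S s) (u \<cdot> star S s)"
proof -
  obtain f where f: "idempotent (rng S s) f" "u = f \<cdot> s" and s: "s \<in> arr S"
    using assms canonical_le_iff_left by blast
  have "u \<cdot> star S s = f \<cdot> (s \<cdot> star S s)"
    unfolding f(2) by (rule prd_assoc) (use s idempotentD[OF f(1)] in \<open>simp_all add: composable_def\<close>)
  then show "idempotent (rng S s) (u \<cdot> star S s)"
    using idempotent_prd[OF f(1) idempotent_star_prd(2)[OF s]] by simp
  show "composable S u (star S s)" using assms s by (simp add: canonical_le_def composable_def)
qed

end

section \<open>Preactions on groupoids and their germs\<close>

locale groupoid_preaction = groupoid \<G> + S: inverse_semigroupoid S + wedge_preaction S \<G> \<theta>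
  for S :: "('s, 'w, 'k) top_semigroupoid_scheme"
    and \<G> :: "('g, 'v, 'l) top_semigroupoid_scheme"
    and \<theta> :: "'s \<Rightarrow> 'g \<rightharpoonup> 'g"
begin

abbreviation D :: "'s \<Rightarrow> 'g set" where "D s \<equiv> dom (\<theta> s)"

definition act :: "'s \<Rightarrow> 'g \<Rightarrow> 'g" where "act s g = the (\<theta> s g)"

lemma D_iff: "g \<in> D s \<longleftrightarrow> \<theta> s g = Some (act s g)"
  by (auto simp: act_def)

text \<open>The domain is only given as an ideal of the ideal \<open>I\<close>. An arrow of \<open>\<G>\<close> that is composable with an arrow
of \<open>I\<close> lies in \<open>I\<close>, so this makes it an ideal of \<open>\<G>\<close>.\<close>

lemma D_ideal:
  assumes s: "s \<in> arr S"
  shows "semigroupoid_ideal \<G> (D s)"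
proof -
  let ?I = "preaction_ideal S \<theta> (src S s)"
  have I: "semigroupoid_ideal \<G> ?I"
    by (rule preaction_ideal_ideal) (rule S.src_closed[OF s])
  have sub: "D s \<subseteq> ?I" using s by (auto simp: preaction_ideal_def)
  have D: "semigroupoid_ideal (\<G>\<lparr>arr := ?I\<rparr>) (D s)" by (rule dom_ideal[OF s])
  show ?thesis
    unfolding semigroupoid_ideal_def
  proof (intro conjI allI impI)
    show "D s \<subseteq> arr \<G>" using sub I by (auto simp: semigroupoid_ideal_def)
    fix a b assume ab: "composable \<G> a b \<and> (a \<in> D s \<or> b \<in> D s)"
    then have "a \<in> ?I" "b \<in> ?I"
      using ideal_connected[OF I, of a b] ideal_connected[OF I, of b a] sub by (auto simp: composable_def)
    then have "composable (\<G>\<lparr>arr := ?I\<rparr>) a b" using ab by (simp add: composable_def)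
    then show "a \<cdot>\<^bsub>\<G>\<^esub> b \<in> D s" using D ab by (simp add: semigroupoid_ideal_def)
  qed
qed

lemma D_arr: "s \<in> arr S \<Longrightarrow> g \<in> D s \<Longrightarrow> g \<in> arr \<G>"
  using D_ideal by (auto simp: semigroupoid_ideal_def)

lemmas D_connected = ideal_connected[OF D_ideal]

lemma act_star:
  assumes "s \<in> arr S" "g \<in> D s"
  shows "act s g \<in> D (star S s)" "act (star S s) (act s g) = g"
proof -
  have "\<theta> (star S s) (act s g) = Some g"
    using assms preaction_star[of s "act s g" g] by (simp add: D_iff)
  then show "act s g \<in> D (star S s)" "act (star S s) (act s g) = g"
    by (auto simp: act_def)
qed

lemma act_star':
  assumes "s \<in> arr S" "h \<in> D (star S s)"
  shows "act (star S s) h \<in> D s" "act s (act (star S s) h) = h"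
  using act_star[of "star S s" h] assms by (simp_all add: S.star_star)

lemma ran_eq: "s \<in> arr S \<Longrightarrow> ran (\<theta> s) = D (star S s)"
  using preaction_star by (auto simp: ran_def)

lemma act_inj: "s \<in> arr S \<Longrightarrow> inj_on (act s) (D s)"
  by (rule inj_on_inverseI[of _ "act (star S s)"]) (rule act_star)

lemma act_hom:
  assumes s: "s \<in> arr S" and ab: "a \<in> D s" "b \<in> D s" "composable \<G> a b"
  shows "composable \<G> (act s a) (act s b)" "act s (a \<cdot>\<^bsub>\<G>\<^esub> b) = act s a \<cdot>\<^bsub>\<G>\<^esub> act s b"
proof -
  have "semigroupoid_hom (\<G>\<lparr>arr := D s\<rparr>) (\<G>\<lparr>arr := ran (\<theta> s)\<rparr>) (\<lambda>a. the (\<theta> s a))"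
    using preaction_iso[OF s] by (simp add: semigroupoid_iso_def)
  moreover have "composable (\<G>\<lparr>arr := D s\<rparr>) a b" using ab by (simp add: composable_def)
  ultimately have "composable (\<G>\<lparr>arr := ran (\<theta> s)\<rparr>) (act s a) (act s b)"
    and 2: "act s (a \<cdot>\<^bsub>\<G>\<^esub> b) = act s a \<cdot>\<^bsub>\<G>\<^esub> act s b"
    unfolding semigroupoid_hom_def act_def by auto
  then show "composable \<G> (act s a) (act s b)"
    using ran_eq[OF s] D_arr[of "star S s"] s by (simp add: composable_def)
  show "act s (a \<cdot>\<^bsub>\<G>\<^esub> b) = act s a \<cdot>\<^bsub>\<G>\<^esub> act s b" by fact
qed

text \<open>The homomorphism \<open>\<theta>\<^sub>s\<close> comes without a map on vertices. That \<open>a\<close> and \<open>b\<close> have the same source is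
expressed by the composability of both with \<open>a\<^sup>-\<^sup>1\<close>, which \<open>\<theta>\<^sub>s\<close> preserves.\<close>

lemma act_src_cong:
  assumes s: "s \<in> arr S" and ab: "a \<in> D s" "b \<in> D s" "src \<G> a = src \<G> b"
  shows "src \<G> (act s a) = src \<G> (act s b)"
proof -
  have arr: "a \<in> arr \<G>" "b \<in> arr \<G>" using ab D_arr[OF s] by auto
  have g: "ginv a \<in> D s" using ideal_ginv[OF D_ideal[OF s]] ab by blast
  have "composable \<G> a (ginv a)" "composable \<G> b (ginv a)"
    using arr ab by (simp_all add: composable_def)
  then have "composable \<G> (act s a) (act s (ginv a))" "composable \<G> (act s b) (act s (ginv a))"
    using act_hom(1)[OF s] ab g by auto
  then show ?thesis by (simp add: composable_def)
qed

lemma act_rng_cong: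
  assumes s: "s \<in> arr S" and ab: "a \<in> D s" "b \<in> D s" "rng \<G> a = rng \<G> b"
  shows "rng \<G> (act s a) = rng \<G> (act s b)"
proof -
  have arr: "a \<in> arr \<G>" "b \<in> arr \<G>" using ab D_arr[OF s] by auto
  have g: "ginv a \<in> D s" using ideal_ginv[OF D_ideal[OF s]] ab by blast
  have "composable \<G> (ginv a) a" "composable \<G> (ginv a) b"
    using arr ab by (simp_all add: composable_def)
  then have "composable \<G> (act s (ginv a)) (act s a)" "composable \<G> (act s (ginv a)) (act s b)"
    using act_hom(1)[OF s] ab g by auto
  then show ?thesis by (simp add: composable_def)
qed

lemma act_prd:
  assumes st: "composable S s t" and g: "g \<in> D t" "act t g \<in> D s"
  shows "g \<in> D (s \<cdot>\<^bsub>S\<^esub> t)" "act (s \<cdot>\<^bsub>S\<^esub> t) g = act s (act t g)"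
proof -
  have "(\<theta> s \<circ>\<^sub>m \<theta> t) g = Some (act s (act t g))"
    using g by (simp add: D_iff map_comp_def)
  then have "\<theta> (s \<cdot>\<^bsub>S\<^esub> t) g = Some (act s (act t g))"
    using preaction_prd[OF st] by (metis domI map_le_def)
  then show "g \<in> D (s \<cdot>\<^bsub>S\<^esub> t)" "act (s \<cdot>\<^bsub>S\<^esub> t) g = act s (act t g)"
    by (auto simp: act_def)
qed

lemma act_idempotent:
  assumes e: "S.idempotent v e" and g: "g \<in> D e"
  shows "act e g = g"
proof -
  have arr: "e \<in> arr S" "composable S e e" "e \<cdot>\<^bsub>S\<^esub> e = e"
    using e by (simp_all add: S.idempotent_def composable_def)
  have "act e g \<in> D e" "act e (act e g) = g"
    using act_star[OF arr(1) g] S.star_idempotent[OF e] by simp_all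
  then show ?thesis using act_prd(2)[OF arr(2) g] arr(3) by simp
qed

text \<open>The maps \<open>\<theta>\<^sub>u\<close> and \<open>\<theta>\<^sub>s\<close> with \<open>u \<le> s\<close> need not extend each other, but they agree where both
  are defined, because \<open>us\<^sup>*\<close> is idempotent and \<open>\<theta>\<^sub>u\<theta>\<^sub>s\<^sup>-\<^sup>1\<close> is a restriction of the map of an idempotent.\<close>

lemma act_le:
  assumes us: "canonical_le S u s" and g: "g \<in> D u" "g \<in> D s"
  shows "act u g = act s g"
proof -
  have s: "s \<in> arr S" using us by (simp add: canonical_le_def)
  note us' = S.canonical_le_prd_star_idempotent[OF us]
  have "act s g \<in> D (star S s)" "act (star S s) (act s g) = g" using act_star[OF s g(2)] by auto
  then have "act s g \<in> D (u \<cdot>\<^bsub>S\<^esub> star S s)" "act (u \<cdot>\<^bsub>S\<^esub> star S s) (act s g) = act u g"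
    using act_prd[OF us'(1), of "act s g"] g by auto
  then show ?thesis using act_idempotent[OF us'(2)] by simp
qed

abbreviation P where "P \<equiv> semidirect_product S \<G> \<theta>"
abbreviation \<Gamma> where "\<Gamma> \<equiv> germ_groupoid S \<G> \<theta>"

lemma arr_P: "(s, a) \<in> arr P \<longleftrightarrow> s \<in> arr S \<and> a \<in> D s"
  using D_arr[of s a] unfolding semidirect_product_def Let_def by auto

lemma P_simps [simp]:
  "src P (s, a) = (src S s, src \<G> a)" "rng P (s, a) = (rng S s, rng \<G> (act s a))"
  by (simp_all add: semidirect_product_def Let_def act_def)

lemma prd_P: "(s, a) \<cdot>\<^bsub>P\<^esub> (t, b) = (s \<cdot>\<^bsub>S\<^esub> t, act (star S t) (a \<cdot>\<^bsub>\<G>\<^esub> act t b))"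
  by (simp add: semidirect_product_def Let_def act_def)

lemma composable_P:
  "composable P (s, a) (t, b) \<longleftrightarrow> composable S s t \<and> a \<in> D s \<and> b \<in> D t \<and> composable \<G> a (act t b)"
proof -
  have "act t b \<in> arr \<G>" if "t \<in> arr S" "b \<in> D t"
    using act_star(1)[OF that] D_arr[of "star S t"] that by simp
  then show ?thesis using D_arr[of s a] unfolding composable_def arr_P by auto
qed

lemma composable_P_product:
  assumes c: "composable P (s, a) (t, b)"
  defines "x \<equiv> a \<cdot>\<^bsub>\<G>\<^esub> act t b"
  shows "x \<in> D (star S t)" "x \<in> D s" "src \<G> (act (star S t) x) = src \<G> b"
    "act (star S t) x \<in> D t" "act t (act (star S t) x) = x"
    "(s \<cdot>\<^bsub>S\<^esub> t, act (star S t) x) \<in> arr P"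
proof -
  have st: "composable S s t" "s \<in> arr S" "t \<in> arr S" and ab: "a \<in> D s" "b \<in> D t" "composable \<G> a (act t b)"
    using c unfolding composable_P by (auto simp: composable_def)
  have x: "x \<in> arr \<G>" "rng \<G> x = rng \<G> a" "src \<G> x = src \<G> (act t b)"
    using ab(3) by (simp_all add: x_def prd_closed rng_prd src_prd)
  show 1: "x \<in> D (star S t)"
    using D_connected[of "star S t" "act t b" x] act_star(1)[OF st(3) ab(2)] x st by simp
  show 2: "x \<in> D s" using D_connected[OF st(2) ab(1) x(1)] x by simp
  show 3: "act (star S t) x \<in> D t" "act t (act (star S t) x) = x"
    using act_star'[OF st(3) 1] by auto
  show "src \<G> (act (star S t) x) = src \<G> b"
    using act_src_cong[of "star S t" x "act t b"] 1 act_star[OF st(3) ab(2)] x st by simp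
  show "(s \<cdot>\<^bsub>S\<^esub> t, act (star S t) x) \<in> arr P"
    using act_prd(1)[OF st(1) 3(1)] 3 2 S.prd_closed[OF st(1)] by (simp add: arr_P)
qed

abbreviation E where "E \<equiv> germ_rel S \<G> \<theta>"

lemma germ_rel_iff:
  "((s, g), (t, h)) \<in> E \<longleftrightarrow> (s, g) \<in> arr P \<and> (t, h) \<in> arr P \<and> g = h \<and>
    (\<exists>u. canonical_le S u s \<and> canonical_le S u t \<and> g \<in> D u)"
  by (simp add: germ_rel_def)

text \<open>If \<open>u\<close> and \<open>v\<close> witness two consecutive equivalences, then \<open>uv\<^sup>*v\<close> witnesses their composite.\<close>

lemma equiv_germ_rel: "equiv (arr P) E"
proof (rule equivI)
  show "E \<subseteq> arr P \<times> arr P" by (auto simp: germ_rel_def)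
  show "refl_on (arr P) E"
    unfolding refl_on_def
  proof clarify
    fix s g assume "(s, g) \<in> arr P"
    then show "((s, g), (s, g)) \<in> E"
      using S.canonical_le_refl[of s] unfolding germ_rel_iff arr_P by blast
  qed
  show "sym E" by (auto simp: sym_def germ_rel_iff)
  show "trans E"
  proof (rule transI, clarify)
    fix s g t h r k
    assume "((s, g), (t, h)) \<in> E" "((t, h), (r, k)) \<in> E"
    then obtain u v where *: "(s, g) \<in> arr P" "(r, k) \<in> arr P" "g = h" "h = k"
      and u: "canonical_le S u s" "canonical_le S u t" "g \<in> D u"
      and v: "canonical_le S v t" "canonical_le S v r" "g \<in> D v"
      by (auto simp: germ_rel_iff)
    \<comment> \<open>\<open>\<theta>\<close> of the idempotent \<open>v\<^sup>*v\<close> is the identity on its domain, which contains \<open>g\<close>.\<close>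
    let ?p = "star S v \<cdot>\<^bsub>S\<^esub> v" and ?w = "u \<cdot>\<^bsub>S\<^esub> (star S v \<cdot>\<^bsub>S\<^esub> v)"
    have arr: "u \<in> arr S" "v \<in> arr S" "src S u = src S v"
      using u v by (simp_all add: canonical_le_def)
    have p: "S.idempotent (src S v) ?p" by (rule S.idempotent_star_prd(1)[OF arr(2)])
    have "g \<in> D ?p"
      using act_prd(1)[of "star S v" v g] act_star(1)[OF arr(2) v(3)] arr v(3) by (simp add: composable_def)
    then have "g \<in> D ?w"
      using act_prd(1)[of u ?p g] act_idempotent[OF p] S.idempotentD[OF p] arr u(3) by (simp add: composable_def)
    moreover have "canonical_le S ?w s" "canonical_le S ?w r"
      using S.canonical_le_meet[OF u(2) v(1)] S.canonical_le_trans u(1) v(2) by blast+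
    ultimately show "((s, g), (r, k)) \<in> E" using * by (auto simp: germ_rel_iff)
  qed
qed

lemma germ_rel_invariant:
  assumes "((s, g), (t, h)) \<in> E"
  shows "act s g = act t h" "src S s = src S t" "rng S s = rng S t"
proof -
  obtain u where u: "canonical_le S u s" "canonical_le S u t" "g \<in> D u" "g = h" "g \<in> D s" "g \<in> D t"
    using assms by (auto simp: germ_rel_iff arr_P)
  then show "act s g = act t h" using act_le[of u s g] act_le[of u t g] by simp
  show "src S s = src S t" "rng S s = rng S t" using u by (simp_all add: canonical_le_def)
qed

lemma germ_rel_src_rng:
  assumes "(p, q) \<in> E"
  shows "src P p = src P q" "rng P p = rng P q"
proof -
  obtain s g t h where pq: "p = (s, g)" "q = (t, h)" by (cases p, cases q)
  then have "g = h" using assms by (simp add: germ_rel_iff)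
  then show "src P p = src P q" "rng P p = rng P q"
    using germ_rel_invariant[of s g t h] assms pq by simp_all
qed

lemma germ_rel_arr: "(p, q) \<in> E \<Longrightarrow> p \<in> arr P" "(p, q) \<in> E \<Longrightarrow> q \<in> arr P"
  using equiv_germ_rel by (auto simp: equiv_def)

lemma germ_rel_composable:
  assumes "(p, p') \<in> E" "(r, r') \<in> E"
  shows "composable P p r \<longleftrightarrow> composable P p' r'"
  unfolding composable_def germ_rel_src_rng(1)[OF assms(1)] germ_rel_src_rng(2)[OF assms(2)]
  using germ_rel_arr[OF assms(1)] germ_rel_arr[OF assms(2)] by blast

text \<open>If \<open>u\<close> and \<open>v\<close> witness the equivalence of the left and of the right factors, then \<open>uv\<close> witnesses the
equivalence of the products. Since \<open>v\<^sup>* \<le> t\<^sup>*, t'\<^sup>*\<close>, the second components agree by \<open>act_le\<close>.\<close>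

lemma germ_rel_prd:
  assumes pp: "(p, p') \<in> E" and rr: "(r, r') \<in> E" and c: "composable P p r"
  shows "(p \<cdot>\<^bsub>P\<^esub> r, p' \<cdot>\<^bsub>P\<^esub> r') \<in> E"
proof -
  obtain s a where p: "p = (s, a)" by (cases p)
  obtain t b where r: "r = (t, b)" by (cases r)
  obtain s' where p': "p' = (s', a)" using pp p by (cases p') (auto simp: germ_rel_iff)
  obtain t' where r': "r' = (t', b)" using rr r by (cases r') (auto simp: germ_rel_iff)
  obtain u where u: "canonical_le S u s" "canonical_le S u s'" "a \<in> D u"
    using pp p p' by (auto simp: germ_rel_iff)
  obtain v where v: "canonical_le S v t" "canonical_le S v t'" "b \<in> D v"
    using rr r r' by (auto simp: germ_rel_iff)
  have c': "composable P p' r'" using germ_rel_composable[OF pp rr] c by blast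
  note cP = composable_P_product[OF c[unfolded p r]] and cP' = composable_P_product[OF c'[unfolded p' r']]
  have act: "act t' b = act t b" using germ_rel_invariant(1)[of t b t' b] rr r r' by simp
  define x where "x = a \<cdot>\<^bsub>\<G>\<^esub> act t b"
  have arr: "u \<in> arr S" "v \<in> arr S" "s \<in> arr S" "t \<in> arr S" "t' \<in> arr S"
    using u v by (simp_all add: canonical_le_def)
  have ab: "a \<in> D s" "b \<in> D t" "composable \<G> a (act t b)" "composable S s t" "composable S s' t'"
    using c c' p r p' r' by (simp_all add: composable_P)
  have x: "x \<in> arr \<G>" "rng \<G> x = rng \<G> a" "src \<G> x = src \<G> (act t b)"
    using ab(3) by (simp_all add: x_def prd_closed rng_prd src_prd)
  have xt: "x \<in> D (star S t)" "x \<in> D (star S t')"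
    using cP(1) cP'(1) act by (simp_all add: x_def)
  have xv: "x \<in> D (star S v)"
    using D_connected[of "star S v" "act v b" x] act_star(1)[OF arr(2) v(3)] act_le[OF v(1,3) ab(2)] x arr by simp
  have xu: "x \<in> D u" using D_connected[OF arr(1) u(3) x(1)] x by simp
  have eq: "act (star S v) x = act (star S t) x" "act (star S v) x = act (star S t') x"
    using act_le[OF S.canonical_le_star[OF v(1)] xv xt(1)] act_le[OF S.canonical_le_star[OF v(2)] xv xt(2)] by auto
  have xv': "act (star S v) x \<in> D v" "act v (act (star S v) x) = x"
    using act_star'[OF arr(2) xv] by auto
  have uv: "composable S u v"
    using ab(4) u v by (simp add: composable_def canonical_le_def)
  have "act (star S v) x \<in> D (u \<cdot>\<^bsub>S\<^esub> v)"
    using act_prd(1)[OF uv xv'(1)] xv'(2) xu by simp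
  moreover have "canonical_le S (u \<cdot>\<^bsub>S\<^esub> v) (s \<cdot>\<^bsub>S\<^esub> t)" "canonical_le S (u \<cdot>\<^bsub>S\<^esub> v) (s' \<cdot>\<^bsub>S\<^esub> t')"
    using S.canonical_le_prd u v ab by blast+
  ultimately show ?thesis
    unfolding p r p' r' prd_P act germ_rel_iff
    using cP(6) cP'(6) eq unfolding x_def[symmetric] act by auto
qed

definition germ :: "'s \<Rightarrow> 'g \<Rightarrow> ('s \<times> 'g) set" where
  "germ s g = E `` {(s, g)}"

lemma arr_\<Gamma>: "c \<in> arr \<Gamma> \<longleftrightarrow> (\<exists>s g. s \<in> arr S \<and> g \<in> D s \<and> c = germ s g)"
proof -
  have "arr \<Gamma> = arr P // E" by (simp only: germ_groupoid_def Let_def semigroupoid.simps)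
  then have "c \<in> arr \<Gamma> \<longleftrightarrow> (\<exists>p\<in>arr P. c = E `` {p})" unfolding quotient_def by blast
  also have "\<dots> \<longleftrightarrow> (\<exists>s g. (s, g) \<in> arr P \<and> c = E `` {(s, g)})"
    by (simp only: Bex_def split_paired_Ex)
  finally show ?thesis unfolding arr_P germ_def by blast
qed

lemma mem_germ: "(t, h) \<in> germ s g \<longleftrightarrow> ((s, g), (t, h)) \<in> E"
  by (simp add: germ_def)

lemma germ_eq_iff:
  assumes "s \<in> arr S" "g \<in> D s" "t \<in> arr S" "h \<in> D t"
  shows "germ s g = germ t h \<longleftrightarrow> g = h \<and> (\<exists>u. canonical_le S u s \<and> canonical_le S u t \<and> g \<in> D u)"
proof -
  have "(s, g) \<in> arr P" "(t, h) \<in> arr P" using assms by (simp_all add: arr_P)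
  then show ?thesis
    unfolding germ_def eq_equiv_class_iff[OF equiv_germ_rel \<open>(s, g) \<in> arr P\<close> \<open>(t, h) \<in> arr P\<close>] germ_rel_iff
    by blast
qed

lemma germ_eq_self: "s \<in> arr S \<Longrightarrow> g \<in> D s \<Longrightarrow> (s, g) \<in> germ s g"
  using equiv_class_self[OF equiv_germ_rel, of "(s, g)"] by (simp add: germ_def arr_P)

lemma mem_germ_iff:
  assumes "s \<in> arr S" "g \<in> D s"
  shows "(t, h) \<in> germ s g \<longleftrightarrow> t \<in> arr S \<and> h \<in> D t \<and> germ t h = germ s g"
proof
  assume "(t, h) \<in> germ s g"
  then have *: "((s, g), (t, h)) \<in> E" by (simp add: mem_germ)
  then show "t \<in> arr S \<and> h \<in> D t \<and> germ t h = germ s g"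
    using equiv_class_eq[OF equiv_germ_rel *] germ_rel_arr(2)[OF *] by (simp add: germ_def arr_P)
next
  assume "t \<in> arr S \<and> h \<in> D t \<and> germ t h = germ s g"
  then show "(t, h) \<in> germ s g" using germ_eq_self[of t h] by simp
qed

lemma src_rng_germ:
  assumes "s \<in> arr S" "g \<in> D s"
  shows "src \<Gamma> (germ s g) = (src S s, src \<G> g)" "rng \<Gamma> (germ s g) = (rng S s, rng \<G> (act s g))"
proof -
  have ne: "(s, g) \<in> germ s g" by (rule germ_eq_self[OF assms])
  have *: "src P p = src P (s, g)" "rng P p = rng P (s, g)" if "p \<in> germ s g" for p
    using germ_rel_src_rng[of "(s, g)" p] that by (simp_all add: germ_def del: P_simps)
  have "src P ` germ s g = (\<lambda>_. src P (s, g)) ` germ s g" "rng P ` germ s g = (\<lambda>_. rng P (s, g)) ` germ s g"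
    by (rule image_cong[OF refl *(1)], assumption) (rule image_cong[OF refl *(2)])
  moreover have "(\<lambda>_. x) ` germ s g = {x}" for x :: "'w \<times> 'v" using ne by blast
  ultimately have "src P ` germ s g = {src P (s, g)}" "rng P ` germ s g = {rng P (s, g)}" by simp_all
  then show "src \<Gamma> (germ s g) = (src S s, src \<G> g)" "rng \<Gamma> (germ s g) = (rng S s, rng \<G> (act s g))"
    by (simp_all add: germ_groupoid_def Let_def)
qed

lemma composable_germ:
  assumes "s \<in> arr S" "a \<in> D s" "t \<in> arr S" "b \<in> D t"
  shows "composable \<Gamma> (germ s a) (germ t b) \<longleftrightarrow> composable P (s, a) (t, b)"
proof -
  have "germ s a \<in> arr \<Gamma>" "germ t b \<in> arr \<Gamma>" unfolding arr_\<Gamma> using assms by blast+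
  then show ?thesis using assms by (simp add: composable_def src_rng_germ arr_P)
qed

lemma prd_germ:
  assumes c: "composable P p r"
  shows "(E `` {p}) \<cdot>\<^bsub>\<Gamma>\<^esub> (E `` {r}) = E `` {p \<cdot>\<^bsub>P\<^esub> r}"
proof -
  have pr: "p \<in> arr P" "r \<in> arr P" using c unfolding composable_def by blast+
  have "E `` {x \<cdot>\<^bsub>P\<^esub> y} = E `` {p \<cdot>\<^bsub>P\<^esub> r}" if "x \<in> E `` {p}" "y \<in> E `` {r}" for x y
    using equiv_class_eq[OF equiv_germ_rel germ_rel_prd[OF _ _ c, of x y]] that
    by (metis Image_singleton_iff)
  moreover have "p \<in> E `` {p}" "r \<in> E `` {r}" using equiv_class_self[OF equiv_germ_rel] pr by blast+
  ultimately have "(\<Union>x\<in>E `` {p}. \<Union>y\<in>E `` {r}. E `` {x \<cdot>\<^bsub>P\<^esub> y}) = E `` {p \<cdot>\<^bsub>P\<^esub> r}"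
    by blast
  then show ?thesis by (simp add: germ_groupoid_def Let_def)
qed

lemma composable_germ_groupoid:
  assumes "composable \<Gamma> c d"
  shows "\<exists>s a t b. c = germ s a \<and> d = germ t b \<and> composable P (s, a) (t, b) \<and>
    s \<in> arr S \<and> a \<in> D s \<and> t \<in> arr S \<and> b \<in> D t"
proof -
  obtain s a where c: "s \<in> arr S" "a \<in> D s" "c = germ s a"
    using assms unfolding composable_def arr_\<Gamma> by blast
  obtain t b where d: "t \<in> arr S" "b \<in> D t" "d = germ t b"
    using assms unfolding composable_def arr_\<Gamma> by blast
  have "composable P (s, a) (t, b)"
    using assms unfolding c(3) d(3) composable_germ[OF c(1,2) d(1,2)] .
  then show ?thesis using c d by blast
qed

lemma src_prd_germ_groupoid:
  assumes "composable \<Gamma> c d"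
  shows "src \<Gamma> (c \<cdot>\<^bsub>\<Gamma>\<^esub> d) = src \<Gamma> d"
proof -
  obtain s a t b where *: "c = germ s a" "d = germ t b" "composable P (s, a) (t, b)"
    "s \<in> arr S" "a \<in> D s" "t \<in> arr S" "b \<in> D t" using composable_germ_groupoid[OF assms] by blast
  let ?x = "act (star S t) (a \<cdot>\<^bsub>\<G>\<^esub> act t b)"
  note cP = composable_P_product[OF *(3)]
  have "c \<cdot>\<^bsub>\<Gamma>\<^esub> d = germ (s \<cdot>\<^bsub>S\<^esub> t) ?x"
    using prd_germ[OF *(3)] unfolding *(1,2) germ_def prd_P .
  moreover have "src S (s \<cdot>\<^bsub>S\<^esub> t) = src S t" using *(3) S.src_prd by (simp add: composable_P)
  ultimately show ?thesis
    using cP(3,6) src_rng_germ(1)[OF *(6,7)] *(2) src_rng_germ(1)[of "s \<cdot>\<^bsub>S\<^esub> t" ?x]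
    by (simp add: arr_P)
qed

end

section \<open>The topology of the germ groupoid\<close>

locale ample_preaction = ample_algebra R A \<G> + groupoid_preaction S \<G> \<theta>
  for R :: "('r, 'm) ring_scheme" and A :: "('r, 'a, 'k) bimod_algebra_scheme" (structure)
    and S :: "('s, 'w, 'n) top_semigroupoid_scheme"
    and \<G> :: "('g, 'v, 'l) top_semigroupoid_scheme"
    and \<theta> :: "'s \<Rightarrow> 'g \<rightharpoonup> 'g" +
  assumes discrete: "discrete_semigroupoid S"
    and open_action: "open_preaction S \<G> \<theta>"
begin

lemma atop_P: "atop P = subtopology (prod_topology (discrete_topology (arr S)) (atop \<G>)) (arr P)"
  using discrete unfolding semidirect_product_def discrete_semigroupoid_def Let_def
  by (simp only: top_semigroupoid.simps semigroupoid.simps)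

lemma arr_P_subset: "arr P \<subseteq> arr S \<times> arr \<G>"
proof clarify
  fix s g assume "(s, g) \<in> arr P"
  then show "s \<in> arr S \<and> g \<in> arr \<G>" using D_arr[of s g] unfolding arr_P by blast
qed

lemma topspace_P: "topspace (atop P) = arr P"
  unfolding atop_P using arr_P_subset by (auto simp: topspace_atop)

lemma action_image: "action_map \<theta> ` ({s} \<times> U) = act s ` U"
  unfolding action_map_def act_def by force

lemma act_image_D: "s \<in> arr S \<Longrightarrow> act s ` D s = D (star S s)"
proof (intro equalityI subsetI)
  assume s: "s \<in> arr S"
  show "y \<in> D (star S s)" if "y \<in> act s ` D s" for y using that act_star(1)[OF s] by blast
  show "y \<in> act s ` D s" if "y \<in> D (star S s)" for y
    using act_star'[OF s that] by (metis imageI)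
qed

text \<open>\<open>D\<^sub>s\<close> is the image under the action map of the open set \<open>{s\<^sup>*} \<times> D\<^sub>s\<^sub>*\<close>.\<close>

lemma D_openin:
  assumes s: "s \<in> arr S"
  shows "openin (atop \<G>) (D s)"
proof -
  let ?t = "star S s"
  have t: "?t \<in> arr S" using s by simp
  have "{?t} \<times> D ?t = ({?t} \<times> arr \<G>) \<inter> arr P" using t D_arr[OF t] by (auto simp: arr_P)
  moreover have "openin (prod_topology (discrete_topology (arr S)) (atop \<G>)) ({?t} \<times> arr \<G>)"
    using t openin_topspace[of "atop \<G>"] by (simp add: openin_prod_Times_iff topspace_atop)
  ultimately have "openin (atop P) ({?t} \<times> D ?t)" unfolding atop_P openin_subtopology by blast
  then have "openin (atop \<G>) (action_map \<theta> ` ({?t} \<times> D ?t))"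
    using open_action by (simp add: open_preaction_def open_map_def)
  then show ?thesis using act_image_D[OF t] s by (simp add: action_image S.star_star)
qed

lemma openin_P:
  "openin (atop P) U \<longleftrightarrow> U \<subseteq> arr P \<and> (\<forall>s\<in>arr S. openin (atop \<G>) {g. (s, g) \<in> U})"
proof
  let ?Q = "prod_topology (discrete_topology (arr S)) (atop \<G>)"
  assume "openin (atop P) U"
  then obtain T where T: "openin ?Q T" "U = T \<inter> arr P" unfolding atop_P openin_subtopology by blast
  have "openin (atop \<G>) {g. (s, g) \<in> U}" if s: "s \<in> arr S" for s
  proof -
    have "openin (atop \<G>) {g. (s, g) \<in> T}"
    proof (subst openin_subopen, intro ballI)
      fix g assume "g \<in> {g. (s, g) \<in> T}"
      then have "\<exists>V W. openin (discrete_topology (arr S)) V \<and> openin (atop \<G>) W \<and> s \<in> V \<and> g \<in> W \<and> V \<times> W \<subseteq> T"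
        using T(1)[unfolded openin_prod_topology_alt, rule_format, of s g] by simp
      then obtain V W where "openin (atop \<G>) W" "s \<in> V" "g \<in> W" "V \<times> W \<subseteq> T" by blast
      then show "\<exists>W. openin (atop \<G>) W \<and> g \<in> W \<and> W \<subseteq> {g. (s, g) \<in> T}"
        by (intro exI[of _ W]) auto
    qed
    moreover have "{g. (s, g) \<in> U} = {g. (s, g) \<in> T} \<inter> D s" using s unfolding T(2) by (auto simp: arr_P)
    ultimately show ?thesis using D_openin[OF s] by (simp add: openin_Int)
  qed
  then show "U \<subseteq> arr P \<and> (\<forall>s\<in>arr S. openin (atop \<G>) {g. (s, g) \<in> U})" using T(2) by blast
next
  let ?Q = "prod_topology (discrete_topology (arr S)) (atop \<G>)"
  assume U: "U \<subseteq> arr P \<and> (\<forall>s\<in>arr S. openin (atop \<G>) {g. (s, g) \<in> U})"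
  have "U = (\<Union>s\<in>arr S. {s} \<times> {g. (s, g) \<in> U})" using U arr_P_subset by auto
  moreover have "openin ?Q ({s} \<times> {g. (s, g) \<in> U})" if "s \<in> arr S" for s
    using that U by (simp add: openin_prod_Times_iff)
  then have "openin ?Q (\<Union>s\<in>arr S. {s} \<times> {g. (s, g) \<in> U})"
    by (intro openin_Union) blast
  ultimately have "openin ?Q U" by simp
  then show "openin (atop P) U"
    unfolding atop_P openin_subtopology using U by blast
qed

lemma act_openin:
  assumes s: "s \<in> arr S" and U: "openin (atop \<G>) U" "U \<subseteq> D s"
  shows "openin (atop \<G>) (act s ` U)"
proof -
  have "{g. (t, g) \<in> {s} \<times> U} = (if t = s then U else {})" for t by auto
  then have "openin (atop P) ({s} \<times> U)"
    unfolding openin_P using s U by (auto simp: arr_P)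
  then show ?thesis
    using open_action unfolding open_preaction_def open_map_def action_image[symmetric] by blast
qed

text \<open>The preimage of a set under \<open>\<theta>\<^sub>s\<close> is its image under \<open>\<theta>\<^sub>s\<^sub>*\<close>, and the action is open.\<close>

lemma act_continuous:
  assumes s: "s \<in> arr S"
  shows "continuous_map (subtopology (atop \<G>) (D s)) (atop \<G>) (act s)"
proof -
  have top: "topspace (subtopology (atop \<G>) (D s)) = D s"
    unfolding topspace_subtopology topspace_atop using D_arr[OF s] by blast
  have "openin (subtopology (atop \<G>) (D s)) {g \<in> D s. act s g \<in> W}" if W: "openin (atop \<G>) W" for W
  proof -
    have "{g \<in> D s. act s g \<in> W} = act (star S s) ` (W \<inter> D (star S s))"
    proof (intro equalityI subsetI)
      show "g \<in> act (star S s) ` (W \<inter> D (star S s))" if "g \<in> {g \<in> D s. act s g \<in> W}" for g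
        using that act_star[OF s, of g] by (metis (mono_tags, lifting) IntI imageI mem_Collect_eq)
      show "g \<in> {g \<in> D s. act s g \<in> W}" if "g \<in> act (star S s) ` (W \<inter> D (star S s))" for g
      proof -
        obtain h where h: "h \<in> W" "h \<in> D (star S s)" "g = act (star S s) h" using \<open>g \<in> _\<close> by blast
        then show ?thesis using act_star'[OF s h(2)] by simp
      qed
    qed
    moreover have "openin (atop \<G>) (act (star S s) ` (W \<inter> D (star S s)))"
      by (rule act_openin) (use s W D_openin in \<open>auto intro: openin_Int\<close>)
    ultimately have "openin (atop \<G>) {g \<in> D s. act s g \<in> W}" by simp
    then show ?thesis using openin_open_subtopology[OF D_openin[OF s]] by blast
  qed
  then show ?thesis
    unfolding continuous_map_def top topspace_atop Pi_iff
    using act_star(1)[OF s] D_arr[OF S.star_closed(1)[OF s]] by blast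
qed

lemma act_compactin:
  assumes s: "s \<in> arr S" and K: "compactin (atop \<G>) K" "K \<subseteq> D s"
  shows "compactin (atop \<G>) (act s ` K)"
  by (rule image_compactin[OF _ act_continuous[OF s]]) (use K in \<open>simp add: compactin_subtopology\<close>)

lemma act_bisection:
  assumes s: "s \<in> arr S" and K: "K \<in> compact_open_bisections" "K \<subseteq> D s"
  shows "act s ` K \<in> compact_open_bisections"
proof -
  have K': "openin (atop \<G>) K" "compactin (atop \<G>) K" "inj_on (src \<G>) K" "inj_on (rng \<G>) K"
    using K by (simp_all add: compact_open_bisections_def compact_open_def bisection_def)
  have st: "star S s \<in> arr S" using s by simp
  have st_act: "act s g \<in> D (star S s)" "act (star S s) (act s g) = g" if "g \<in> K" for g
    using act_star[OF s, of g] K(2) that by auto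
  have "src \<G> a = src \<G> b" if "a \<in> K" "b \<in> K" "src \<G> (act s a) = src \<G> (act s b)" for a b
    using act_src_cong[OF st st_act(1) st_act(1), of a b] st_act(2) that by simp
  moreover have "rng \<G> a = rng \<G> b" if "a \<in> K" "b \<in> K" "rng \<G> (act s a) = rng \<G> (act s b)" for a b
    using act_rng_cong[OF st st_act(1) st_act(1), of a b] st_act(2) that by simp
  ultimately have "inj_on (src \<G>) (act s ` K)" "inj_on (rng \<G>) (act s ` K)"
    using K'(3,4) unfolding inj_on_def by blast+
  moreover have "act s ` K \<subseteq> arr \<G>" using st_act(1) D_arr[OF st] by blast
  ultimately show ?thesis
    using act_openin[OF s K'(1) K(2)] act_compactin[OF s K'(2) K(2)]
    by (simp add: compact_open_bisections_def compact_open_def bisection_def)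
qed

definition translate :: "'s \<Rightarrow> ('g \<Rightarrow> 'a) \<Rightarrow> 'g \<Rightarrow> 'a" where
  "translate s f = (\<lambda>y. if y \<in> D (star S s) then f (act (star S s) y) else \<zero>)"

lemma induced_preaction_eq:
  assumes s: "s \<in> arr S"
  shows "induced_preaction A \<G> \<theta> s f =
    (if f \<in> steinberg_functions A \<G> \<and> (\<forall>x. x \<notin> D s \<longrightarrow> f x = \<zero>) then Some (translate s f) else None)"
proof -
  have "(THE x. \<theta> s x = Some y) = act (star S s) y" if "y \<in> D (star S s)" for y
  proof (rule the_equality)
    have "\<theta> (star S s) y = Some (act (star S s) y)" using that by (simp add: D_iff[symmetric])
    then show "\<theta> s (act (star S s) y) = Some y" using preaction_star[OF s] by blast
    fix x assume "\<theta> s x = Some y"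
    then have "\<theta> (star S s) y = Some x" using preaction_star[OF s] by blast
    then show "x = act (star S s) y" by (simp add: act_def)
  qed
  then have "(\<lambda>y. if y \<in> ran (\<theta> s) then f (THE x. \<theta> s x = Some y) else \<zero>) = translate s f"
    unfolding translate_def ran_eq[OF s] by auto
  then show ?thesis unfolding induced_preaction_def steinberg_algebra_simps by (simp only:)
qed

lemma translate_locally_constant:
  assumes s: "s \<in> arr S" and K: "K \<in> compact_open_bisections" "K \<subseteq> D s"
    and f: "f \<in> locally_constant A (atop \<G>) K"
  shows "translate s f \<in> locally_constant A (atop \<G>) (act s ` K)"
proof -
  have at: "translate s f (act s x) = f x" if "x \<in> K" for x
  proof -
    have "x \<in> D s" using that K(2) by blast
    then show ?thesis using act_star[OF s, of x] by (simp add: translate_def)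
  qed
  have "translate s f y = \<zero>" if "y \<notin> act s ` K" for y
  proof (cases "y \<in> D (star S s)")
    case True
    then have "act (star S s) y \<notin> K" using that act_star'(2)[OF s True] by (metis imageI)
    then show ?thesis using locally_constantD(1)[OF f] True by (simp add: translate_def)
  qed (simp add: translate_def)
  moreover have "openin (atop \<G>) {y \<in> act s ` K. translate s f y = a}" for a
  proof -
    have "{y \<in> act s ` K. translate s f y = a} = act s ` {x \<in> K. f x = a}" using at by auto
    then show ?thesis using act_openin[OF s locally_constantD(3)[OF f, of a]] K(2) by auto
  qed
  moreover have "translate s f y \<in> carrier A" for y
    using locally_constantD(2)[OF f] by (simp add: translate_def)
  ultimately show ?thesis unfolding locally_constant_def by blast
qed

lemma translate_closed:
  assumes s: "s \<in> arr S" and f: "f \<in> steinberg_functions A \<G>" and supp: "\<And>x. x \<notin> D s \<Longrightarrow> f x = \<zero>"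
  shows "translate s f \<in> steinberg_functions A \<G>"
proof (rule steinberg_induct_supported[OF f compact_open_base_bisections D_openin[OF s] supp,
      where P = "\<lambda>f. translate s f \<in> steinberg_functions A \<G>"])
  have "translate s (\<lambda>_. \<zero>) = (\<lambda>_. \<zero>)" by (simp add: translate_def)
  then show "translate s (\<lambda>_. \<zero>) \<in> steinberg_functions A \<G>" by (simp add: steinberg_functions.zero)
next
  fix K f assume "K \<in> compact_open_bisections" "K \<subseteq> D s" "f \<in> locally_constant A (atop \<G>) K"
  then show "translate s f \<in> steinberg_functions A \<G>"
    using translate_locally_constant[OF s] act_bisection[OF s]
      locally_constant_steinberg[OF base.base_member] by blast
next
  fix f g
  assume "translate s f \<in> steinberg_functions A \<G>" "translate s g \<in> steinberg_functions A \<G>"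
  moreover have "translate s (\<lambda>x. f x \<oplus> g x) = (\<lambda>x. translate s f x \<oplus> translate s g x)"
    by (simp add: translate_def fun_eq_iff)
  ultimately show "translate s (\<lambda>x. f x \<oplus> g x) \<in> steinberg_functions A \<G>"
    by (simp add: steinberg_functions.add)
qed

lemma topspace_\<Gamma>: "topspace (atop \<Gamma>) = arr \<Gamma>"
proof -
  have "atop \<Gamma> = quotient_topology (atop P) (\<lambda>x. E `` {x})"
    by (simp only: germ_groupoid_def Let_def top_semigroupoid.simps)
  moreover have "topspace (quotient_topology (atop P) (\<lambda>x. E `` {x})) = (\<lambda>x. E `` {x}) ` arr P"
    using quotient_imp_surjective_map[OF quotient_map_quotient_topology] topspace_P by metis
  moreover have "(\<lambda>x. E `` {x}) ` arr P = arr \<Gamma>"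
    unfolding set_eq_iff arr_\<Gamma> image_iff Bex_def split_paired_Ex arr_P germ_def by blast
  ultimately show ?thesis by simp
qed

lemma openin_\<Gamma>:
  "openin (atop \<Gamma>) W \<longleftrightarrow> W \<subseteq> arr \<Gamma> \<and> (\<forall>s\<in>arr S. openin (atop \<G>) {g \<in> D s. germ s g \<in> W})"
proof -
  have 1: "atop \<Gamma> = quotient_topology (atop P) (\<lambda>x. E `` {x})"
    by (simp only: germ_groupoid_def Let_def top_semigroupoid.simps)
  have "(\<lambda>x. E `` {x}) ` arr P = arr \<Gamma>"
    unfolding set_eq_iff arr_\<Gamma> image_iff Bex_def split_paired_Ex arr_P germ_def by blast
  then have 2: "openin (atop \<Gamma>) W \<longleftrightarrow> W \<subseteq> arr \<Gamma> \<and> openin (atop P) {x \<in> arr P. E `` {x} \<in> W}"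
    unfolding 1 openin_quotient_topology topspace_P by simp
  have "{g. (s, g) \<in> {x \<in> arr P. E `` {x} \<in> W}} = {g \<in> D s. germ s g \<in> W}" if "s \<in> arr S" for s
    using that by (simp add: arr_P germ_def)
  then show ?thesis unfolding 2 openin_P by auto
qed

lemma germ_inj: "s \<in> arr S \<Longrightarrow> inj_on (germ s) (D s)"
  using germ_eq_iff by (meson inj_onI)

text \<open>The germs of \<open>t\<close> that are germs of \<open>s\<close> at a point of \<open>U\<close> are those at the points of \<open>U \<inter> D\<^sub>t \<inter> D\<^sub>u\<close>, where
\<open>u\<close> ranges over the common lower bounds of \<open>s\<close> and \<open>t\<close>.\<close>

lemma germ_openin:
  assumes s: "s \<in> arr S" and U: "openin (atop \<G>) U" "U \<subseteq> D s"
  shows "openin (atop \<Gamma>) (germ s ` U)"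
  unfolding openin_\<Gamma>
proof (intro conjI ballI)
  show "germ s ` U \<subseteq> arr \<Gamma>" unfolding arr_\<Gamma> subset_iff using s U by blast
  fix t assume t: "t \<in> arr S"
  let ?L = "{u. canonical_le S u s \<and> canonical_le S u t}"
  have "{g \<in> D t. germ t g \<in> germ s ` U} = (\<Union>u\<in>?L. U \<inter> D t \<inter> D u)"
  proof (intro equalityI subsetI)
    fix g assume "g \<in> {g \<in> D t. germ t g \<in> germ s ` U}"
    then obtain h where "g \<in> D t" "h \<in> U" "germ t g = germ s h" by blast
    then show "g \<in> (\<Union>u\<in>?L. U \<inter> D t \<inter> D u)"
      using germ_eq_iff[OF t _ s, of g h] U(2) by blast
  next
    fix g assume "g \<in> (\<Union>u\<in>?L. U \<inter> D t \<inter> D u)"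
    then have "g \<in> U" "g \<in> D t" "\<exists>u. canonical_le S u t \<and> canonical_le S u s \<and> g \<in> D u" by auto
    then show "g \<in> {g \<in> D t. germ t g \<in> germ s ` U}"
      using germ_eq_iff[OF t _ s, of g g] U(2) by blast
  qed
  moreover have "openin (atop \<G>) (U \<inter> D t \<inter> D u)" if "u \<in> ?L" for u
    using that U(1) D_openin[OF t] D_openin[OF S.canonical_leD(1)] by (intro openin_Int) blast+
  then have "openin (atop \<G>) (\<Union>u\<in>?L. U \<inter> D t \<inter> D u)"
    by (intro openin_Union) blast
  ultimately show "openin (atop \<G>) {g \<in> D t. germ t g \<in> germ s ` U}" by simp
qed

lemma germ_continuous:
  assumes s: "s \<in> arr S"
  shows "continuous_map (subtopology (atop \<G>) (D s)) (atop \<Gamma>) (germ s)"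
proof -
  have top: "topspace (subtopology (atop \<G>) (D s)) = D s"
    unfolding topspace_subtopology topspace_atop using D_arr[OF s] by blast
  have "openin (subtopology (atop \<G>) (D s)) {g \<in> D s. germ s g \<in> W}" if "openin (atop \<Gamma>) W" for W
    using that s openin_open_subtopology[OF D_openin[OF s]] unfolding openin_\<Gamma> by auto
  then show ?thesis
    unfolding continuous_map_def top topspace_\<Gamma> Pi_iff arr_\<Gamma> using s by blast
qed

lemma germ_compactin:
  assumes s: "s \<in> arr S" and K: "compactin (atop \<G>) K" "K \<subseteq> D s"
  shows "compactin (atop \<Gamma>) (germ s ` K)"
  by (rule image_compactin[OF _ germ_continuous[OF s]]) (use K in \<open>simp add: compactin_subtopology\<close>)

definition germ_bisections :: "('s \<times> 'g) set set set" where
  "germ_bisections = {germ s ` U | s U. s \<in> arr S \<and> U \<in> compact_open_bisections \<and> U \<subseteq> D s}"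

lemma germ_image_Hausdorff:
  assumes s: "s \<in> arr S" and U: "U \<in> compact_open_bisections" "U \<subseteq> D s"
  shows "compact_open_Hausdorff (atop \<Gamma>) (germ s ` U)"
proof -
  have U': "openin (atop \<G>) U" "compactin (atop \<G>) U" "Hausdorff_space (subtopology (atop \<G>) U)"
    using base.base_member[OF U(1)] by (simp_all add: compact_open_Hausdorff_def compact_open_def)
  have gU: "openin (atop \<Gamma>) (germ s ` U)" by (rule germ_openin[OF s U'(1) U(2)])
  have top: "topspace (subtopology (atop \<Gamma>) (germ s ` U)) = germ s ` U"
    "topspace (subtopology (atop \<G>) U) = U"
    using openin_subset[OF gU] openin_subset[OF U'(1)] by auto
  have inj: "inj_on (germ s) U" using germ_inj[OF s] U(2) inj_on_subset by blast
  have "Hausdorff_space (subtopology (atop \<Gamma>) (germ s ` U))"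
    unfolding Hausdorff_space_def top
  proof (intro allI impI)
    fix c d assume cd: "c \<in> germ s ` U \<and> d \<in> germ s ` U \<and> c \<noteq> d"
    then obtain g h where gh: "g \<in> U" "h \<in> U" "c = germ s g" "d = germ s h" "g \<noteq> h" by blast
    then obtain V W where VW: "openin (subtopology (atop \<G>) U) V" "openin (subtopology (atop \<G>) U) W"
      "g \<in> V" "h \<in> W" "disjnt V W"
      using U'(3) unfolding Hausdorff_space_def top by blast
    have VW': "openin (atop \<G>) V" "V \<subseteq> U" "openin (atop \<G>) W" "W \<subseteq> U"
      using VW(1,2) openin_open_subtopology[OF U'(1)] by blast+
    have "openin (atop \<Gamma>) (germ s ` V)" "openin (atop \<Gamma>) (germ s ` W)"
      using germ_openin[OF s] VW' U(2) by blast+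
    then have "openin (subtopology (atop \<Gamma>) (germ s ` U)) (germ s ` V)"
      "openin (subtopology (atop \<Gamma>) (germ s ` U)) (germ s ` W)"
      using VW' openin_open_subtopology[OF gU] by blast+
    moreover have "disjnt (germ s ` V) (germ s ` W)"
      using VW(5) VW' inj unfolding disjnt_def inj_on_def by blast
    ultimately show "\<exists>V W. openin (subtopology (atop \<Gamma>) (germ s ` U)) V \<and>
        openin (subtopology (atop \<Gamma>) (germ s ` U)) W \<and> c \<in> V \<and> d \<in> W \<and> disjnt V W"
      using VW(3,4) gh(3,4) by blast
  qed
  then show ?thesis
    using gU germ_compactin[OF s U'(2) U(2)] by (simp add: compact_open_Hausdorff_def compact_open_def)
qed

text \<open>The map \<open>germ s\<close> is an open embedding of \<open>D\<^sub>s\<close>, so the basis of \<open>\<G>\<close> can be transported. A compact open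
subset of the Hausdorff set \<open>germ s ` U\<close> has an open complement there, and this gives the compactness of
its preimage in \<open>U\<close>.\<close>

lemma compact_open_base_germs: "compact_open_base (atop \<Gamma>) germ_bisections"
proof
  fix K assume "K \<in> germ_bisections"
  then show "compact_open_Hausdorff (atop \<Gamma>) K"
    using germ_image_Hausdorff unfolding germ_bisections_def by blast
next
  fix K L assume "K \<in> germ_bisections" and L: "compact_open (atop \<Gamma>) L" "L \<subseteq> K"
  then obtain s U where s: "s \<in> arr S" and U: "U \<in> compact_open_bisections" "U \<subseteq> D s" and K: "K = germ s ` U"
    unfolding germ_bisections_def by blast
  have U': "openin (atop \<G>) U" "compactin (atop \<G>) U"
    using base.base_compact_open[OF U(1)] by (simp_all add: compact_open_def)
  have KH: "openin (atop \<Gamma>) K" "Hausdorff_space (subtopology (atop \<Gamma>) K)"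
    using germ_image_Hausdorff[OF s U] K by (simp_all add: compact_open_Hausdorff_def compact_open_def)
  let ?V = "{g \<in> D s. germ s g \<in> L} \<inter> U"
  have "openin (atop \<Gamma>) (K - L)"
    by (rule openin_Diff_compactin[OF KH]) (use L in \<open>simp_all add: compact_open_def\<close>)
  then have "openin (atop \<G>) {g \<in> D s. germ s g \<in> K - L}" unfolding openin_\<Gamma> using s by blast
  then have "compactin (atop \<G>) (U - {g \<in> D s. germ s g \<in> K - L})"
    by (rule compactin_Diff_openin[OF U'(2)])
  moreover have "U - {g \<in> D s. germ s g \<in> K - L} = ?V" using U(2) K by blast
  moreover have "openin (atop \<G>) ?V"
    using L(1) s U'(1) unfolding compact_open_def openin_\<Gamma> by (blast intro: openin_Int)
  ultimately have "compact_open (atop \<G>) ?V" by (simp add: compact_open_def)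
  then have "?V \<in> compact_open_bisections" using base.base_subset[OF U(1)] by blast
  moreover have "L = germ s ` ?V" using L(2) K U(2) by blast
  ultimately show "L \<in> germ_bisections"
    using s unfolding germ_bisections_def by blast
next
  fix W c assume W: "openin (atop \<Gamma>) W" "c \<in> W"
  then have "c \<in> arr \<Gamma>" using openin_subset topspace_\<Gamma> by blast
  then obtain s g where sg: "s \<in> arr S" "g \<in> D s" "c = germ s g" unfolding arr_\<Gamma> by blast
  have "openin (atop \<G>) {g \<in> D s. germ s g \<in> W}" using W(1) sg(1) unfolding openin_\<Gamma> by blast
  then obtain U where U: "U \<in> compact_open_bisections" "g \<in> U" "U \<subseteq> {g \<in> D s. germ s g \<in> W}"
    using base.base_point[of _ g] sg W(2) by blast
  then show "\<exists>K\<in>germ_bisections. c \<in> K \<and> K \<subseteq> W"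
    using sg unfolding germ_bisections_def by (intro bexI[of _ "germ s ` U"]) auto
qed

sublocale \<Gamma>: convolvable R A \<Gamma>
  by unfold_locales (rule src_prd_germ_groupoid)

end

section \<open>Quotients of bimodule algebras\<close>

text \<open>The isomorphism sends \<open>h\<close> to the fibre of \<open>\<psi>\<close> over \<open>h\<close>, which is a coset of the kernel.\<close>

lemma bimod_algebra_first_isomorphism:
  fixes B :: "('r, 'b, 'k) bimod_algebra_scheme" and C :: "('r, 'c, 'l) bimod_algebra_scheme"
  assumes "abelian_group B" "abelian_group C"
    and surj: "\<psi> ` carrier B = carrier C"
    and add: "\<And>x y. x \<in> carrier B \<Longrightarrow> y \<in> carrier B \<Longrightarrow> \<psi> (x \<oplus>\<^bsub>B\<^esub> y) = \<psi> x \<oplus>\<^bsub>C\<^esub> \<psi> y"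
    and mult_closed: "\<And>x y. x \<in> carrier B \<Longrightarrow> y \<in> carrier B \<Longrightarrow> x \<otimes>\<^bsub>B\<^esub> y \<in> carrier B"
    and mult: "\<And>x y. x \<in> carrier B \<Longrightarrow> y \<in> carrier B \<Longrightarrow> \<psi> (x \<otimes>\<^bsub>B\<^esub> y) = \<psi> x \<otimes>\<^bsub>C\<^esub> \<psi> y"
    and ls_closed: "\<And>r x. r \<in> carrier R \<Longrightarrow> x \<in> carrier B \<Longrightarrow> r \<triangleright>\<^bsub>B\<^esub> x \<in> carrier B"
    and ls: "\<And>r x. r \<in> carrier R \<Longrightarrow> x \<in> carrier B \<Longrightarrow> \<psi> (r \<triangleright>\<^bsub>B\<^esub> x) = r \<triangleright>\<^bsub>C\<^esub> \<psi> x"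
    and rs_closed: "\<And>r x. r \<in> carrier R \<Longrightarrow> x \<in> carrier B \<Longrightarrow> x \<triangleleft>\<^bsub>B\<^esub> r \<in> carrier B"
    and rs: "\<And>r x. r \<in> carrier R \<Longrightarrow> x \<in> carrier B \<Longrightarrow> \<psi> (x \<triangleleft>\<^bsub>B\<^esub> r) = \<psi> x \<triangleleft>\<^bsub>C\<^esub> r"
  shows "bimod_algebra_isomorphic R C (bimod_algebra_quotient B {x \<in> carrier B. \<psi> x = \<zero>\<^bsub>C\<^esub>})"
proof -
  interpret B: abelian_group B by fact
  interpret C: abelian_group C by fact
  let ?I = "{x \<in> carrier B. \<psi> x = \<zero>\<^bsub>C\<^esub>}"
  define \<phi> where "\<phi> h = {x \<in> carrier B. \<psi> x = h}" for h
  have cl: "\<psi> x \<in> carrier C" if "x \<in> carrier B" for x using surj that by blast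
  have zero: "\<psi> \<zero>\<^bsub>B\<^esub> = \<zero>\<^bsub>C\<^esub>"
    using add[of "\<zero>\<^bsub>B\<^esub>" "\<zero>\<^bsub>B\<^esub>"] cl[of "\<zero>\<^bsub>B\<^esub>"] by (simp add: C.add.r_cancel_one')
  have minus: "\<psi> (\<ominus>\<^bsub>B\<^esub> x) = \<ominus>\<^bsub>C\<^esub> \<psi> x" if x: "x \<in> carrier B" for x
  proof -
    have "\<psi> (\<ominus>\<^bsub>B\<^esub> x) \<oplus>\<^bsub>C\<^esub> \<psi> x = \<psi> (\<ominus>\<^bsub>B\<^esub> x \<oplus>\<^bsub>B\<^esub> x)" using add x by simp
    also have "\<dots> = \<zero>\<^bsub>C\<^esub>" using x zero by (simp add: B.l_neg)
    finally have "\<ominus>\<^bsub>C\<^esub> \<psi> x = \<psi> (\<ominus>\<^bsub>B\<^esub> x)" using C.minus_equality cl x by simp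
    then show ?thesis by simp
  qed
  have coset: "?I +>\<^bsub>B\<^esub> x = \<phi> (\<psi> x)" if x: "x \<in> carrier B" for x
  proof (intro equalityI subsetI)
    fix y assume "y \<in> ?I +>\<^bsub>B\<^esub> x"
    then obtain i where "i \<in> ?I" "y = i \<oplus>\<^bsub>B\<^esub> x" unfolding a_r_coset_def' by blast
    then show "y \<in> \<phi> (\<psi> x)" using x cl by (simp add: \<phi>_def add)
  next
    fix y assume "y \<in> \<phi> (\<psi> x)"
    then have y: "y \<in> carrier B" "\<psi> y = \<psi> x" by (simp_all add: \<phi>_def)
    have "y \<oplus>\<^bsub>B\<^esub> \<ominus>\<^bsub>B\<^esub> x \<in> ?I" using x y cl by (simp add: add minus C.r_neg)
    moreover have "y = (y \<oplus>\<^bsub>B\<^esub> \<ominus>\<^bsub>B\<^esub> x) \<oplus>\<^bsub>B\<^esub> x" using x y by (simp add: B.a_assoc B.l_neg)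
    ultimately show "y \<in> ?I +>\<^bsub>B\<^esub> x" unfolding a_r_coset_def' by blast
  qed
  have rep: "\<exists>x\<in>carrier B. \<psi> x = h" if "h \<in> carrier C" for h
    using that unfolding surj[symmetric] by blast
  have carrier: "carrier (bimod_algebra_quotient B ?I) = \<phi> ` carrier C"
  proof -
    have "carrier (bimod_algebra_quotient B ?I) = (\<lambda>x. ?I +>\<^bsub>B\<^esub> x) ` carrier B"
      by (auto simp: bimod_algebra_quotient_def A_RCOSETS_def')
    also have "\<dots> = (\<lambda>x. \<phi> (\<psi> x)) ` carrier B" by (rule image_cong) (simp_all add: coset)
    finally show ?thesis using surj by (metis image_image)
  qed
  have "inj_on \<phi> (carrier C)"
  proof (rule inj_onI)
    fix h k assume hk: "h \<in> carrier C" "k \<in> carrier C" "\<phi> h = \<phi> k"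
    obtain x where "x \<in> carrier B" "\<psi> x = h" using rep hk(1) by blast
    then have "x \<in> \<phi> k" using hk(3) by (auto simp: \<phi>_def)
    then show "h = k" using \<open>\<psi> x = h\<close> by (simp add: \<phi>_def)
  qed
  then have bij: "bij_betw \<phi> (carrier C) (carrier (bimod_algebra_quotient B ?I))"
    unfolding carrier by (rule inj_on_imp_bij_betw)
  have "\<phi> (h \<oplus>\<^bsub>C\<^esub> k) = \<phi> h <+>\<^bsub>B\<^esub> \<phi> k" if hk: "h \<in> carrier C" "k \<in> carrier C" for h k
  proof (intro equalityI subsetI)
    fix z assume "z \<in> \<phi> (h \<oplus>\<^bsub>C\<^esub> k)"
    then have z: "z \<in> carrier B" "\<psi> z = h \<oplus>\<^bsub>C\<^esub> k" by (simp_all add: \<phi>_def)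
    obtain x where x: "x \<in> carrier B" "\<psi> x = h" using rep hk(1) by blast
    have "\<psi> (\<ominus>\<^bsub>B\<^esub> x \<oplus>\<^bsub>B\<^esub> z) = k" using x z hk by (simp add: add minus C.r_neg1)
    then have "\<ominus>\<^bsub>B\<^esub> x \<oplus>\<^bsub>B\<^esub> z \<in> \<phi> k" using x z by (simp add: \<phi>_def)
    moreover have "z = x \<oplus>\<^bsub>B\<^esub> (\<ominus>\<^bsub>B\<^esub> x \<oplus>\<^bsub>B\<^esub> z)" using x z by (simp add: B.r_neg2)
    moreover have "x \<in> \<phi> h" using x by (simp add: \<phi>_def)
    ultimately show "z \<in> \<phi> h <+>\<^bsub>B\<^esub> \<phi> k" unfolding set_add_def' by blast
  next
    fix z assume "z \<in> \<phi> h <+>\<^bsub>B\<^esub> \<phi> k"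
    then obtain x y where "x \<in> \<phi> h" "y \<in> \<phi> k" "z = x \<oplus>\<^bsub>B\<^esub> y" unfolding set_add_def' by blast
    then show "z \<in> \<phi> (h \<oplus>\<^bsub>C\<^esub> k)" by (simp add: \<phi>_def add)
  qed
  moreover have "\<phi> (h \<otimes>\<^bsub>C\<^esub> k) = rcoset_mult B ?I (\<phi> h) (\<phi> k)" if hk: "h \<in> carrier C" "k \<in> carrier C" for h k
  proof -
    have "?I +>\<^bsub>B\<^esub> (x \<otimes>\<^bsub>B\<^esub> y) = \<phi> (h \<otimes>\<^bsub>C\<^esub> k)" if "x \<in> \<phi> h" "y \<in> \<phi> k" for x y
      using that coset[OF mult_closed] by (simp add: \<phi>_def mult)
    moreover have "\<phi> h \<noteq> {}" "\<phi> k \<noteq> {}" using rep hk by (auto simp: \<phi>_def)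
    ultimately show ?thesis unfolding rcoset_mult_def by auto
  qed
  moreover have "\<phi> (r \<triangleright>\<^bsub>C\<^esub> h) = (\<Union>x\<in>\<phi> h. ?I +>\<^bsub>B\<^esub> (r \<triangleright>\<^bsub>B\<^esub> x))"
    if rh: "r \<in> carrier R" "h \<in> carrier C" for r h
  proof -
    have "?I +>\<^bsub>B\<^esub> (r \<triangleright>\<^bsub>B\<^esub> x) = \<phi> (r \<triangleright>\<^bsub>C\<^esub> h)" if "x \<in> \<phi> h" for x
      using that coset[OF ls_closed[OF rh(1)]] rh by (simp add: \<phi>_def ls)
    moreover have "\<phi> h \<noteq> {}" using rep rh by (auto simp: \<phi>_def)
    ultimately show ?thesis by auto
  qed
  moreover have "\<phi> (h \<triangleleft>\<^bsub>C\<^esub> r) = (\<Union>x\<in>\<phi> h. ?I +>\<^bsub>B\<^esub> (x \<triangleleft>\<^bsub>B\<^esub> r))"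
    if rh: "r \<in> carrier R" "h \<in> carrier C" for r h
  proof -
    have "?I +>\<^bsub>B\<^esub> (x \<triangleleft>\<^bsub>B\<^esub> r) = \<phi> (h \<triangleleft>\<^bsub>C\<^esub> r)" if "x \<in> \<phi> h" for x
      using that coset[OF rs_closed[OF rh(1)]] rh by (simp add: \<phi>_def rs)
    moreover have "\<phi> h \<noteq> {}" using rep rh by (auto simp: \<phi>_def)
    ultimately show ?thesis by auto
  qed
  ultimately show ?thesis
    unfolding bimod_algebra_isomorphic_def
    by (intro exI[of _ \<phi>] conjI bij ballI) (simp_all add: bimod_algebra_quotient_def)
qed

section \<open>The crossed product\<close>

context ample_preaction
begin

abbreviation AG where "AG \<equiv> steinberg_algebra A \<G>"
abbreviation \<Theta> where "\<Theta> \<equiv> induced_preaction A \<G> \<theta>"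
abbreviation B where "B \<equiv> crossed_product S AG \<Theta>"

interpretation AG: abelian_group AG by (rule steinberg_abelian_group)

definition supported :: "'s \<Rightarrow> ('g \<Rightarrow> 'a) set" where
  "supported s = {k \<in> steinberg_functions A \<G>. \<forall>x. x \<notin> D s \<longrightarrow> k x = \<zero>}"

lemma dom_\<Theta>: "s \<in> arr S \<Longrightarrow> dom (\<Theta> s) = supported s"
proof -
  assume s: "s \<in> arr S"
  have "k \<in> dom (\<Theta> s) \<longleftrightarrow> k \<in> supported s" for k
    unfolding domIff[of k "\<Theta> s"] induced_preaction_eq[OF s] supported_def by simp
  then show "dom (\<Theta> s) = supported s" by blast
qed

lemma the_\<Theta>: "s \<in> arr S \<Longrightarrow> k \<in> supported s \<Longrightarrow> the (\<Theta> s k) = translate s k"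
  by (simp add: induced_preaction_eq supported_def)

lemma B_simps:
  "carrier B = {f. (\<forall>s\<in>arr S. f s \<in> supported s) \<and> (\<forall>s. s \<notin> arr S \<longrightarrow> f s = (\<lambda>_. \<zero>)) \<and>
    finite {s. f s \<noteq> (\<lambda>_. \<zero>)}}"
  "monoid.mult B = crossed_mult S AG \<Theta>"
  "zero B = (\<lambda>_ _. \<zero>)"
  "add B = (\<lambda>f g s x. f s x \<oplus> g s x)"
  "lsmult B = (\<lambda>r f s x. r \<triangleright> f s x)"
  "rsmult B = (\<lambda>f r s x. f s x \<triangleleft> r)"
  using dom_\<Theta> by (simp_all add: crossed_product_def)

lemma supported_zero: "(\<lambda>_. \<zero>) \<in> supported s"
  by (simp add: supported_def steinberg_functions.zero)

lemma B_memD: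
  assumes "f \<in> carrier B"
  shows "s \<in> arr S \<Longrightarrow> f s \<in> supported s" "s \<notin> arr S \<Longrightarrow> f s = (\<lambda>_. \<zero>)" "finite {s. f s \<noteq> (\<lambda>_. \<zero>)}"
    "f s \<in> supported s" "f s \<in> steinberg_functions A \<G>" "f s x \<in> carrier A" "f s x \<noteq> \<zero> \<Longrightarrow> s \<in> arr S \<and> x \<in> D s"
proof -
  show 1: "s \<in> arr S \<Longrightarrow> f s \<in> supported s" "s \<notin> arr S \<Longrightarrow> f s = (\<lambda>_. \<zero>)" "finite {s. f s \<noteq> (\<lambda>_. \<zero>)}"
    using assms unfolding B_simps by blast+
  show 2: "f s \<in> supported s" using 1 supported_zero by (cases "s \<in> arr S") auto
  then show 3: "f s \<in> steinberg_functions A \<G>" by (simp add: supported_def)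
  show "f s x \<in> carrier A" by (rule steinberg_function_closed[OF 3])
  show "f s x \<noteq> \<zero> \<Longrightarrow> s \<in> arr S \<and> x \<in> D s"
    using 1(2) 2 by (auto simp: supported_def)
qed

lemma B_memI:
  assumes "\<And>s. s \<in> arr S \<Longrightarrow> f s \<in> supported s" "\<And>s. s \<notin> arr S \<Longrightarrow> f s = (\<lambda>_. \<zero>)"
    "finite F" "\<And>s. s \<notin> F \<Longrightarrow> f s = (\<lambda>_. \<zero>)"
  shows "f \<in> carrier B"
proof -
  have "finite {s. f s \<noteq> (\<lambda>_. \<zero>)}" by (rule finite_subset[OF _ assms(3)]) (use assms(4) in blast)
  then show ?thesis unfolding B_simps using assms(1,2) by blast
qed

lemma supported_additive:
  assumes "k \<in> supported s" "\<And>a. a \<in> carrier A \<Longrightarrow> h a \<in> carrier A"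
    "\<And>a b. a \<in> carrier A \<Longrightarrow> b \<in> carrier A \<Longrightarrow> h (a \<oplus> b) = h a \<oplus> h b"
  shows "(\<lambda>x. h (k x)) \<in> supported s"
proof -
  have "h \<zero> = \<zero>" using assms(2)[of \<zero>] assms(3)[of \<zero> \<zero>] by (simp add: add.r_cancel_one')
  then show ?thesis
    using steinberg_scalar[OF _ compact_open_base_bisections assms(2,3), of k] assms(1)
    by (auto simp: supported_def)
qed

lemma B_additive:
  assumes f: "f \<in> carrier B" and h: "\<And>a. a \<in> carrier A \<Longrightarrow> h a \<in> carrier A"
    "\<And>a b. a \<in> carrier A \<Longrightarrow> b \<in> carrier A \<Longrightarrow> h (a \<oplus> b) = h a \<oplus> h b"
  shows "(\<lambda>s x. h (f s x)) \<in> carrier B"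
proof -
  have h0: "h \<zero> = \<zero>" using h(1)[of \<zero>] h(2)[of \<zero> \<zero>] by (simp add: add.r_cancel_one')
  show ?thesis
    by (rule B_memI[OF _ _ B_memD(3)[OF f]])
      (use B_memD(1,2)[OF f] h0 supported_additive[OF _ h] in \<open>auto\<close>)
qed

lemma B_add:
  assumes f: "f \<in> carrier B" and g: "g \<in> carrier B"
  shows "(\<lambda>s x. f s x \<oplus> g s x) \<in> carrier B"
proof (rule B_memI)
  show "finite ({s. f s \<noteq> (\<lambda>_. \<zero>)} \<union> {s. g s \<noteq> (\<lambda>_. \<zero>)})"
    using B_memD(3)[OF f] B_memD(3)[OF g] by simp
  show "(\<lambda>x. f s x \<oplus> g s x) \<in> supported s" for s
    using B_memD(4)[OF f, of s] B_memD(4)[OF g, of s] unfolding supported_def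
    by (simp add: steinberg_functions.add)
qed (use B_memD(2)[OF f] B_memD(2)[OF g] in auto)

lemma B_abelian_group: "abelian_group B"
proof (rule abelian_group_pointwise[OF AG.abelian_group_axioms])
  show "(\<lambda>s. \<ominus>\<^bsub>AG\<^esub> f s) \<in> carrier B" if f: "f \<in> carrier B" for f
  proof -
    have "(\<lambda>s. \<ominus>\<^bsub>AG\<^esub> f s) = (\<lambda>s x. \<ominus> f s x)"
      using steinberg_abelian_group(2)[OF B_memD(5)[OF f]] by simp
    then show ?thesis using B_additive[OF f, of "\<lambda>a. \<ominus> a"] minus_add by simp
  qed
  show "(\<lambda>_. \<zero>\<^bsub>AG\<^esub>) \<in> carrier B"
    by (rule B_memI[of _ "{}"]) (simp_all add: supported_zero)
qed (simp_all add: B_simps(3,4) B_memD(5) B_add)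

lemma delta_AG: "delta AG s k = (\<lambda>t x. if t = s then k x else \<zero>)"
  by (auto simp: delta_def fun_eq_iff)

lemma delta_closed:
  assumes "s \<in> arr S" "k \<in> supported s"
  shows "delta AG s k \<in> carrier B"
proof (rule B_memI[of _ "{s}"])
  show "delta AG s k t \<in> supported t" for t
    using assms supported_zero by (cases "t = s") (simp_all add: delta_def)
qed (use assms in \<open>auto simp: delta_AG\<close>)

lemma locally_constant_supported:
  assumes "U \<in> compact_open_bisections" "U \<subseteq> D s" "k \<in> locally_constant A (atop \<G>) U"
  shows "k \<in> supported s"
  using locally_constant_steinberg[OF base.base_member[OF assms(1)] assms(3)] locally_constantD(1)[OF assms(3)] assms(2)
  unfolding supported_def by blast

text \<open>An element \<open>\<delta>\<^sub>sk\<close> with arbitrary \<open>k\<close> in the domain of \<open>\<Theta>\<^sub>s\<close> reduces to the case treated here because \<open>k\<close> is a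
sum of locally constant functions on bisections that are contained in \<open>D\<^sub>s\<close>.\<close>

lemma B_induct:
  assumes f: "f \<in> carrier B" and zero: "Q \<zero>\<^bsub>B\<^esub>"
    and delta: "\<And>s U k. s \<in> arr S \<Longrightarrow> U \<in> compact_open_bisections \<Longrightarrow> U \<subseteq> D s \<Longrightarrow>
      k \<in> locally_constant A (atop \<G>) U \<Longrightarrow> Q (delta AG s k)"
    and add: "\<And>f g. f \<in> carrier B \<Longrightarrow> g \<in> carrier B \<Longrightarrow> Q f \<Longrightarrow> Q g \<Longrightarrow> Q (f \<oplus>\<^bsub>B\<^esub> g)"
  shows "Q f"
proof -
  have Q_delta: "Q (delta AG s k)" if s: "s \<in> arr S" and k: "k \<in> supported s" for s k
  proof -
    have k': "k \<in> steinberg_functions A \<G>" "\<And>x. x \<notin> D s \<Longrightarrow> k x = \<zero>" using k by (auto simp: supported_def)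
    show ?thesis
    proof (rule steinberg_induct_supported[OF k'(1) compact_open_base_bisections D_openin[OF s] k'(2),
          where P = "\<lambda>k. Q (delta AG s k)"])
      have "delta AG s (\<lambda>_. \<zero>) = \<zero>\<^bsub>B\<^esub>" by (auto simp: delta_AG B_simps)
      then show "Q (delta AG s (\<lambda>_. \<zero>))" using zero by simp
      show "Q (delta AG s k)" if "K \<in> compact_open_bisections" "K \<subseteq> D s"
        "k \<in> locally_constant A (atop \<G>) K" for K k using delta[OF s that] .
      show "Q (delta AG s (\<lambda>x. k x \<oplus> k' x))"
        if "k \<in> steinberg_functions A \<G>" "k' \<in> steinberg_functions A \<G>"
          "\<And>x. x \<notin> D s \<Longrightarrow> k x = \<zero>" "\<And>x. x \<notin> D s \<Longrightarrow> k' x = \<zero>" "Q (delta AG s k)" "Q (delta AG s k')" for k k'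
      proof -
        have "delta AG s (\<lambda>x. k x \<oplus> k' x) = delta AG s k \<oplus>\<^bsub>B\<^esub> delta AG s k'"
          by (auto simp: delta_AG B_simps fun_eq_iff)
        moreover have "delta AG s k \<in> carrier B" "delta AG s k' \<in> carrier B"
          using delta_closed[OF s] that(1-4) by (auto simp: supported_def)
        ultimately show ?thesis using add that(5,6) by simp
      qed
    qed
  qed
  have "Q f" if "finite F" "f \<in> carrier B" "\<And>s. s \<notin> F \<Longrightarrow> f s = (\<lambda>_. \<zero>)" for F f
    using that
  proof (induction F arbitrary: f rule: finite_induct)
    case empty
    then have "f = \<zero>\<^bsub>B\<^esub>" by (auto simp: B_simps)
    then show ?case using zero by simp
  next
    case (insert s F)
    note f = insert.prems(1)
    let ?f = "f(s := (\<lambda>_. \<zero>))"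
    have f1: "?f \<in> carrier B"
      by (rule B_memI[OF _ _ B_memD(3)[OF f]]) (use B_memD(1,2)[OF f] supported_zero in auto)
    have Q1: "Q ?f" by (rule insert.IH[OF f1]) (use insert.prems(2) in auto)
    show ?case
    proof (cases "s \<in> arr S")
      case True
      have "f = delta AG s (f s) \<oplus>\<^bsub>B\<^esub> ?f"
        using B_memD(6)[OF f] by (auto simp: delta_AG B_simps fun_eq_iff)
      then show ?thesis
        using add[OF delta_closed[OF True B_memD(4)[OF f]] f1 Q_delta[OF True B_memD(4)[OF f]] Q1] by metis
    next
      case False
      then have "?f = f" using B_memD(2)[OF f, of s] by auto
      then show ?thesis using Q1 by simp
    qed
  qed
  then show ?thesis using f B_memD(3)[OF f] by blast
qed

interpretation B: abelian_group B by (rule B_abelian_group)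

section \<open>Direct images along the germ map\<close>

definition pushforward :: "('s \<Rightarrow> 'g \<Rightarrow> 'a) \<Rightarrow> ('s \<times> 'g) set \<Rightarrow> 'a" where
  "pushforward f c = (if c \<in> arr \<Gamma> then fsum A (\<lambda>(s, g). f s g) c else \<zero>)"

lemma finite_germ_terms:
  assumes f: "f \<in> carrier B" and c: "c \<in> arr \<Gamma>"
  shows "finite {p \<in> c. (case p of (s, g) \<Rightarrow> f s g) \<noteq> \<zero>}"
proof -
  obtain s g where c: "s \<in> arr S" "g \<in> D s" "c = germ s g" using c unfolding arr_\<Gamma> by blast
  have "{p \<in> c. (case p of (s, g) \<Rightarrow> f s g) \<noteq> \<zero>} \<subseteq> {s. f s \<noteq> (\<lambda>_. \<zero>)} \<times> {g}"
    using mem_germ[of _ _ s g] c(3) by (auto simp: germ_rel_iff)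
  then show ?thesis by (rule finite_subset) (simp add: B_memD(3)[OF f])
qed

lemma pushforward_closed:
  assumes f: "f \<in> carrier B"
  shows "pushforward f c \<in> carrier A"
proof -
  have "fsum A (\<lambda>(s, g). f s g) c \<in> carrier A"
    by (rule fsum_closed) (auto simp: B_memD(6)[OF f])
  then show ?thesis by (simp add: pushforward_def)
qed

lemma pushforward_add:
  assumes f: "f \<in> carrier B" and g: "g \<in> carrier B"
  shows "pushforward (f \<oplus>\<^bsub>B\<^esub> g) = (\<lambda>c. pushforward f c \<oplus> pushforward g c)"
proof
  fix c
  show "pushforward (f \<oplus>\<^bsub>B\<^esub> g) c = pushforward f c \<oplus> pushforward g c"
  proof (cases "c \<in> arr \<Gamma>")
    case True
    have "fsum A (\<lambda>(s, x). f s x \<oplus> g s x) c =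
        fsum A (\<lambda>p. (case p of (s, x) \<Rightarrow> f s x) \<oplus> (case p of (s, x) \<Rightarrow> g s x)) c"
      by (rule fsum_cong) (auto simp: B_memD(6)[OF f] B_memD(6)[OF g])
    also have "\<dots> = fsum A (\<lambda>(s, x). f s x) c \<oplus> fsum A (\<lambda>(s, x). g s x) c"
      by (rule fsum_add[OF finite_germ_terms[OF f True] finite_germ_terms[OF g True]])
        (auto simp: B_memD(6)[OF f] B_memD(6)[OF g])
    finally show ?thesis using True by (simp add: pushforward_def B_simps)
  qed (simp add: pushforward_def)
qed

lemma pushforward_additive:
  assumes f: "f \<in> carrier B" and h: "\<And>a. a \<in> carrier A \<Longrightarrow> h a \<in> carrier A"
    "\<And>a b. a \<in> carrier A \<Longrightarrow> b \<in> carrier A \<Longrightarrow> h (a \<oplus> b) = h a \<oplus> h b"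
  shows "pushforward (\<lambda>s x. h (f s x)) = (\<lambda>c. h (pushforward f c))"
proof
  fix c
  have h0: "h \<zero> = \<zero>" using h(1)[of \<zero>] h(2)[of \<zero> \<zero>] by (simp add: add.r_cancel_one')
  show "pushforward (\<lambda>s x. h (f s x)) c = h (pushforward f c)"
  proof (cases "c \<in> arr \<Gamma>")
    case True
    have "h (fsum A (\<lambda>(s, x). f s x) c) = fsum A (\<lambda>p. h (case p of (s, x) \<Rightarrow> f s x)) c"
      by (rule fsum_additive[OF finite_germ_terms[OF f True] h]) (auto simp: B_memD(6)[OF f])
    also have "(\<lambda>p. h (case p of (s, x) \<Rightarrow> f s x)) = (\<lambda>(s, x). h (f s x))" by auto
    finally show ?thesis using True by (simp add: pushforward_def)
  qed (simp add: pushforward_def h0)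
qed

lemma pushforward_delta:
  assumes s: "s \<in> arr S" and k: "k \<in> supported s"
  shows "g \<in> D s \<Longrightarrow> pushforward (delta AG s k) (germ s g) = k g"
    and "c \<notin> germ s ` D s \<Longrightarrow> pushforward (delta AG s k) c = \<zero>"
proof -
  have kA: "k x \<in> carrier A" for x using k steinberg_function_closed by (auto simp: supported_def)
  show "pushforward (delta AG s k) (germ s g) = k g" if g: "g \<in> D s"
  proof -
    have "germ s g \<in> arr \<Gamma>" unfolding arr_\<Gamma> using s g by blast
    moreover have "fsum A (\<lambda>(t, x). delta AG s k t x) (germ s g) = (\<lambda>(t, x). delta AG s k t x) (s, g)"
    proof (rule fsum_singleton[OF germ_eq_self[OF s g]])
      fix p assume p: "p \<in> germ s g" "p \<noteq> (s, g)"
      then obtain t where "p = (t, g)" "t \<noteq> s"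
        by (cases p) (auto simp: mem_germ germ_rel_iff)
      then show "(\<lambda>(t, x). delta AG s k t x) p = \<zero>" by (simp add: delta_AG)
    qed (simp add: delta_AG kA)
    ultimately show ?thesis by (simp add: pushforward_def delta_AG)
  qed
  show "pushforward (delta AG s k) c = \<zero>" if c: "c \<notin> germ s ` D s"
  proof (cases "c \<in> arr \<Gamma>")
    case True
    then obtain t h where th: "t \<in> arr S" "h \<in> D t" "c = germ t h" unfolding arr_\<Gamma> by blast
    have "fsum A (\<lambda>(t, x). delta AG s k t x) c = \<zero>"
    proof (rule fsum_zero, clarify)
      fix r x assume rx: "(r, x) \<in> c"
      have "r \<noteq> s"
        using rx c mem_germ_iff[OF th(1,2), of r x] th(3) by blast
      then show "delta AG s k r x = \<zero>" by (simp add: delta_AG)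
    qed
    then show ?thesis by (simp add: pushforward_def)
  qed (simp add: pushforward_def)
qed

text \<open>The inverse of the direct image over one chart \<open>germ s ` U\<close>.\<close>

definition pullback :: "'s \<Rightarrow> 'g set \<Rightarrow> (('s \<times> 'g) set \<Rightarrow> 'a) \<Rightarrow> 'g \<Rightarrow> 'a" where
  "pullback s U h = (\<lambda>g. if g \<in> U then h (germ s g) else \<zero>)"

lemma pullback_locally_constant:
  assumes s: "s \<in> arr S" and U: "U \<in> compact_open_bisections" "U \<subseteq> D s"
    and h: "h \<in> locally_constant A (atop \<Gamma>) (germ s ` U)"
  shows "pullback s U h \<in> locally_constant A (atop \<G>) U"
proof -
  have "openin (atop \<G>) {g \<in> U. pullback s U h g = a}" for a
  proof -
    have "openin (atop \<G>) {g \<in> D s. germ s g \<in> {c \<in> germ s ` U. h c = a}}"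
      using locally_constantD(3)[OF h, of a] s unfolding openin_\<Gamma> by blast
    then have "openin (atop \<G>) (U \<inter> {g \<in> D s. germ s g \<in> {c \<in> germ s ` U. h c = a}})"
      by (rule openin_Int[OF base.base_openin[OF U(1)]])
    moreover have "U \<inter> {g \<in> D s. germ s g \<in> {c \<in> germ s ` U. h c = a}} = {g \<in> U. pullback s U h g = a}"
      using U(2) unfolding pullback_def by auto
    ultimately show ?thesis by simp
  qed
  then show ?thesis
    using locally_constantD(2)[OF h] by (simp add: locally_constant_def pullback_def)
qed

lemma pushforward_pullback:
  assumes s: "s \<in> arr S" and U: "U \<in> compact_open_bisections" "U \<subseteq> D s"
    and h: "h \<in> locally_constant A (atop \<Gamma>) (germ s ` U)"
  shows "pushforward (delta AG s (pullback s U h)) = h"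
proof
  fix c
  have k: "pullback s U h \<in> supported s"
    by (rule locally_constant_supported[OF U pullback_locally_constant[OF s U h]])
  show "pushforward (delta AG s (pullback s U h)) c = h c"
  proof (cases "c \<in> germ s ` D s")
    case True
    then obtain g where g: "g \<in> D s" "c = germ s g" by blast
    have "h c = \<zero>" if "g \<notin> U"
    proof (rule locally_constantD(1)[OF h])
      show "c \<notin> germ s ` U" using that g U(2) inj_onD[OF germ_inj[OF s]] by blast
    qed
    then show ?thesis using pushforward_delta(1)[OF s k g(1)] g(2) by (simp add: pullback_def)
  next
    case False
    then have "c \<notin> germ s ` U" using U(2) by blast
    then have "h c = \<zero>" by (rule locally_constantD(1)[OF h])
    then show ?thesis using pushforward_delta(2)[OF s k False] by simp
  qed
qed

lemma pushforward_locally_constant: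
  assumes s: "s \<in> arr S" and U: "U \<in> compact_open_bisections" "U \<subseteq> D s"
    and k: "k \<in> locally_constant A (atop \<G>) U"
  shows "pushforward (delta AG s k) \<in> locally_constant A (atop \<Gamma>) (germ s ` U)"
    and "pullback s U (pushforward (delta AG s k)) = k"
proof -
  have ks: "k \<in> supported s" by (rule locally_constant_supported[OF U k])
  have at: "pushforward (delta AG s k) (germ s g) = k g" if "g \<in> U" for g
    using pushforward_delta(1)[OF s ks] U(2) that by blast
  have "pushforward (delta AG s k) c = \<zero>" if c: "c \<notin> germ s ` U" for c
  proof (cases "c \<in> germ s ` D s")
    case True
    then obtain g where "g \<in> D s" "c = germ s g" "g \<notin> U" using c by blast
    then show ?thesis using pushforward_delta(1)[OF s ks] locally_constantD(1)[OF k] by simp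
  qed (rule pushforward_delta(2)[OF s ks])
  moreover have "openin (atop \<Gamma>) {c \<in> germ s ` U. pushforward (delta AG s k) c = a}" for a
  proof -
    have "{c \<in> germ s ` U. pushforward (delta AG s k) c = a} = germ s ` {g \<in> U. k g = a}"
      using at by auto
    moreover have "{g \<in> U. k g = a} \<subseteq> D s" using U(2) by blast
    ultimately show ?thesis using germ_openin[OF s locally_constantD(3)[OF k, of a]] by simp
  qed
  moreover have "pushforward (delta AG s k) c \<in> carrier A" for c
    by (rule pushforward_closed[OF delta_closed[OF s ks]])
  ultimately show "pushforward (delta AG s k) \<in> locally_constant A (atop \<Gamma>) (germ s ` U)"
    unfolding locally_constant_def by blast
  show "pullback s U (pushforward (delta AG s k)) = k"
    using at locally_constantD(1)[OF k] by (auto simp: pullback_def fun_eq_iff)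
qed

lemma pushforward_zero: "pushforward \<zero>\<^bsub>B\<^esub> = (\<lambda>_. \<zero>)"
  by (auto simp: pushforward_def B_simps fun_eq_iff intro!: fsum_zero)

lemma pushforward_steinberg:
  assumes "f \<in> carrier B"
  shows "pushforward f \<in> steinberg_functions A \<Gamma>"
proof (rule B_induct[OF assms, where Q = "\<lambda>f. pushforward f \<in> steinberg_functions A \<Gamma>"])
  show "pushforward \<zero>\<^bsub>B\<^esub> \<in> steinberg_functions A \<Gamma>"
    unfolding pushforward_zero by (rule steinberg_functions.zero)
  show "pushforward (delta AG s k) \<in> steinberg_functions A \<Gamma>"
    if "s \<in> arr S" "U \<in> compact_open_bisections" "U \<subseteq> D s" "k \<in> locally_constant A (atop \<G>) U" for s U k
    by (rule locally_constant_steinberg[OF germ_image_Hausdorff[OF that(1-3)]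
          pushforward_locally_constant(1)[OF that]])
  show "pushforward (f \<oplus>\<^bsub>B\<^esub> g) \<in> steinberg_functions A \<Gamma>"
    if "f \<in> carrier B" "g \<in> carrier B" "pushforward f \<in> steinberg_functions A \<Gamma>"
      "pushforward g \<in> steinberg_functions A \<Gamma>" for f g
    unfolding pushforward_add[OF that(1,2)] by (rule steinberg_functions.add[OF that(3,4)])
qed

lemma pushforward_surj: "pushforward ` carrier B = steinberg_functions A \<Gamma>"
proof (intro equalityI subsetI)
  show "h \<in> steinberg_functions A \<Gamma>" if "h \<in> pushforward ` carrier B" for h
    using that pushforward_steinberg by blast
  fix h assume h: "h \<in> steinberg_functions A \<Gamma>"
  show "h \<in> pushforward ` carrier B"
  proof (rule steinberg_induct[OF h compact_open_base_germs])
    show "(\<lambda>_. \<zero>) \<in> pushforward ` carrier B"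
      using pushforward_zero B.zero_closed by (metis imageI)
    fix K h assume K: "K \<in> germ_bisections" and h: "h \<in> locally_constant A (atop \<Gamma>) K"
    obtain s U where sU: "s \<in> arr S" "U \<in> compact_open_bisections" "U \<subseteq> D s" "K = germ s ` U"
      using K unfolding germ_bisections_def by blast
    note h' = h[unfolded sU(4)]
    show "h \<in> pushforward ` carrier B"
      using pushforward_pullback[OF sU(1-3) h']
        delta_closed[OF sU(1) locally_constant_supported[OF sU(2,3) pullback_locally_constant[OF sU(1-3) h']]]
      by (metis imageI)
  next
    fix f g assume "f \<in> pushforward ` carrier B" "g \<in> pushforward ` carrier B"
    then obtain f' g' where fg: "f' \<in> carrier B" "g' \<in> carrier B" "f = pushforward f'" "g = pushforward g'" by blast
    show "(\<lambda>x. f x \<oplus> g x) \<in> pushforward ` carrier B"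
      unfolding fg(3,4) pushforward_add[OF fg(1,2), symmetric] by (rule imageI) (rule B.a_closed[OF fg(1,2)])
  qed
qed

text \<open>The gluing theorem for the charts \<open>germ s ` U\<close> of the germ groupoid, with \<open>\<delta>\<^sub>sk\<close> as the formal summand given by
the function \<open>k\<close> on \<open>U\<close>, and with empty \<open>D\<close>.\<close>

lemma pushforward_kernel:
  assumes N: "additive_subgroup N B"
    and relations: "\<And>s t k. canonical_le S s t \<Longrightarrow> k \<in> supported s \<Longrightarrow> k \<in> supported t \<Longrightarrow>
      delta AG s k \<ominus>\<^bsub>B\<^esub> delta AG t k \<in> N"
    and f: "f \<in> carrier B" "pushforward f = (\<lambda>_. \<zero>)"
  shows "f \<in> N"
proof -
  let ?J = "{(s, U). s \<in> arr S \<and> U \<in> compact_open_bisections \<and> U \<subseteq> D s}"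
  let ?V = "\<lambda>(s, U). germ s ` U" and ?T = "\<lambda>(s, U) h. delta AG s (pullback s U h)"
  have T_closed: "delta AG s (pullback s U h) \<in> carrier B"
    if "s \<in> arr S" "U \<in> compact_open_bisections" "U \<subseteq> D s" "h \<in> locally_constant A (atop \<Gamma>) (germ s ` U)" for s U h
    by (rule delta_closed[OF that(1) locally_constant_supported[OF that(2,3) pullback_locally_constant[OF that]]])
  interpret gluing A B "atop \<Gamma>" ?J ?V ?T
  proof (unfold_locales, goal_cases)
    case (1 j)
    then show ?case using germ_image_Hausdorff by (cases j) simp
  next
    case (2 j h)
    then show ?case using T_closed by (cases j) simp
  next
    case (3 j h k)
    then show ?case by (cases j) (simp add: pullback_def delta_AG B_simps fun_eq_iff)
  next
    case (4 W c)
    interpret germs: compact_open_base "atop \<Gamma>" germ_bisections by (rule compact_open_base_germs)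
    show ?case using germs.base_point[OF 4] germs.base_compact_open by blast
  qed
  have "\<exists>js. glued js (pushforward f) f"
  proof (rule B_induct[OF f(1), where Q = "\<lambda>f. \<exists>js. glued js (pushforward f) f"])
    show "\<exists>js. glued js (pushforward \<zero>\<^bsub>B\<^esub>) \<zero>\<^bsub>B\<^esub>" unfolding pushforward_zero using glued.Nil by blast
    show "\<exists>js. glued js (pushforward (delta AG s k)) (delta AG s k)"
      if "s \<in> arr S" "U \<in> compact_open_bisections" "U \<subseteq> D s" "k \<in> locally_constant A (atop \<G>) U" for s U k
      using glued_single[of "[(s, U)]" "(s, U)" "pushforward (delta AG s k)"]
        pushforward_locally_constant[OF that] that by auto
    show "\<exists>js. glued js (pushforward (f \<oplus>\<^bsub>B\<^esub> g)) (f \<oplus>\<^bsub>B\<^esub> g)"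
      if "f \<in> carrier B" "g \<in> carrier B" "\<exists>js. glued js (pushforward f) f" "\<exists>js. glued js (pushforward g) g" for f g
      unfolding pushforward_add[OF that(1,2)] using that(3,4) glued_append by blast
  qed
  then obtain js where js: "glued js (pushforward f) f" by blast
  show ?thesis
  proof (rule glued_mem_subgroup[OF js _ N, where D = "{}"])
    show "pushforward f x = \<zero>" for x using f(2) by simp
    fix i j c assume ij: "i \<in> ?J" "j \<in> ?J" "c \<in> ?V i" "c \<in> ?V j"
    obtain s U where i: "i = (s, U)" "s \<in> arr S" "U \<in> compact_open_bisections" "U \<subseteq> D s"
      using ij(1) by blast
    obtain t U' where j: "j = (t, U')" "t \<in> arr S" "U' \<in> compact_open_bisections" "U' \<subseteq> D t"
      using ij(2) by blast
    obtain g where g: "g \<in> U" "c = germ s g" using ij(3) i(1) by auto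
    obtain g' where g': "g' \<in> U'" "c = germ t g'" using ij(4) j(1) by auto
    have "g = g' \<and> (\<exists>u. canonical_le S u s \<and> canonical_le S u t \<and> g \<in> D u)"
      using germ_eq_iff[of s g t g'] g g' i j by blast
    then obtain u where u: "canonical_le S u s" "canonical_le S u t" "g \<in> D u" and gg: "g' = g" by blast
    have uS: "u \<in> arr S" by (rule S.canonical_leD(1)[OF u(1)])
    let ?O = "U \<inter> U' \<inter> D u"
    have O: "openin (atop \<G>) ?O"
      using base.base_openin[OF i(3)] base.base_openin[OF j(3)] D_openin[OF uS] by (intro openin_Int)
    have same: "germ s x = germ t x" if "x \<in> ?O" for x
      using germ_eq_iff[OF i(2) _ j(2), of x x] that u(1,2) i(4) j(4) by blast
    have "?T i h \<ominus>\<^bsub>B\<^esub> ?T j h \<in> N"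
      if K: "compact_open (atop \<Gamma>) K" "K \<subseteq> germ s ` ?O" and h: "h \<in> locally_constant A (atop \<Gamma>) K" for K h
    proof -
      have h_off: "h c = \<zero>" if "c \<notin> germ s ` ?O" for c
        using locally_constantD(1)[OF h] K(2) that by blast
      have inO: "x \<in> ?O" if "x \<in> D s" "germ s x \<in> germ s ` ?O" for x
        using that inj_onD[OF germ_inj[OF i(2)]] i(4) by blast
      have inO': "x \<in> ?O" if x: "x \<in> D t" "germ t x \<in> germ s ` ?O" for x
      proof -
        obtain y where y: "y \<in> ?O" "germ t x = germ s y" using x(2) by blast
        then have "germ t x = germ t y" using same by simp
        moreover have "y \<in> D t" using y(1) j(4) by blast
        ultimately show ?thesis using inj_onD[OF germ_inj[OF j(2)] _ x(1)] y(1) by blast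
      qed
      \<comment> \<open>On \<open>?O\<close> the germs of \<open>s\<close> and \<open>t\<close> coincide, so \<open>h\<close> has the same pullback along both.\<close>
      define k where "k = (\<lambda>x. if x \<in> ?O then h (germ s x) else \<zero>)"
      have k1: "pullback s U h = k"
      proof
        fix x show "pullback s U h x = k x"
        proof (cases "x \<in> U \<and> x \<notin> ?O")
          case True
          then have "germ s x \<notin> germ s ` ?O" using inO[of x] i(4) by blast
          then show ?thesis using True h_off by (simp add: pullback_def k_def)
        qed (auto simp: pullback_def k_def)
      qed
      have k2: "pullback t U' h = k"
      proof
        fix x show "pullback t U' h x = k x"
        proof (cases "x \<in> U' \<and> x \<notin> ?O")
          case True
          then have "germ t x \<notin> germ s ` ?O" using inO'[of x] j(4) by blast
          then have "h (germ t x) = \<zero>" by (rule h_off)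
          then show ?thesis using True by (auto simp: pullback_def k_def)
        next
          case False
          then show ?thesis using same[of x] by (auto simp: pullback_def k_def)
        qed
      qed
      have "h \<in> locally_constant A (atop \<Gamma>) (germ s ` U)"
        by (rule locally_constant_mono[OF h germ_image_Hausdorff[OF i(2-4)] K(1)]) (use K(2) in blast)
      then have ks: "k \<in> supported s"
        unfolding k1[symmetric] by (rule locally_constant_supported[OF i(3,4) pullback_locally_constant[OF i(2-4)]])
      have kt: "k \<in> supported t" and ku: "k \<in> supported u"
        using ks j(4) unfolding supported_def k_def by auto
      let ?s = "delta AG s k" and ?t = "delta AG t k" and ?u = "delta AG u k"
      have c: "?s \<in> carrier B" "?t \<in> carrier B" "?u \<in> carrier B"
        using delta_closed i(2) j(2) uS ks kt ku by blast+
      have "?u \<ominus>\<^bsub>B\<^esub> ?t \<in> N" "\<ominus>\<^bsub>B\<^esub> (?u \<ominus>\<^bsub>B\<^esub> ?s) \<in> N"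
        using relations[OF u(2) ku kt] relations[OF u(1) ku ks]
          additive_subgroup.a_inv_closed[OF N] by blast+
      then have "\<ominus>\<^bsub>B\<^esub> (?u \<ominus>\<^bsub>B\<^esub> ?s) \<oplus>\<^bsub>B\<^esub> (?u \<ominus>\<^bsub>B\<^esub> ?t) \<in> N"
        using additive_subgroup.a_closed[OF N] by blast
      moreover have "\<ominus>\<^bsub>B\<^esub> (?u \<ominus>\<^bsub>B\<^esub> ?s) \<oplus>\<^bsub>B\<^esub> (?u \<ominus>\<^bsub>B\<^esub> ?t) = ?s \<ominus>\<^bsub>B\<^esub> ?t"
        using c by (simp add: B.minus_eq B.minus_add B.a_assoc B.r_neg1 B.a_comm[of "\<ominus>\<^bsub>B\<^esub> ?u" ?s])
      ultimately show ?thesis by (simp add: i(1) j(1) k1 k2)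
    qed
    moreover have "openin (atop \<Gamma>) (germ s ` ?O)"
      by (rule germ_openin[OF i(2) O]) (use i(4) in blast)
    moreover have "c \<in> germ s ` ?O" using g g' gg u(3) by blast
    moreover have "germ s ` ?O \<subseteq> ?V i \<inter> ?V j"
      using same i(1) j(1) by auto
    ultimately show "\<exists>W. openin (atop \<Gamma>) W \<and> c \<in> W \<and> W \<subseteq> ?V i \<inter> ?V j \<and>
        (\<forall>K h. compact_open (atop \<Gamma>) K \<and> K \<subseteq> W \<and> h \<in> locally_constant A (atop \<Gamma>) K \<longrightarrow>
          ?T i h \<ominus>\<^bsub>B\<^esub> ?T j h \<in> N)"
      by blast
  qed auto
qed

lemma fibre_finite_pushforward:
  assumes f: "f \<in> carrier B"
  shows "fibre_finite A \<Gamma> (pushforward f)"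
proof -
  have "finite {c \<in> arr \<Gamma>. src \<Gamma> c = v \<and> pushforward f c \<noteq> \<zero>}" for v
  proof (rule finite_subset)
    let ?X = "SIGMA s:{s. f s \<noteq> (\<lambda>_. \<zero>)}. {g \<in> arr \<G>. src \<G> g = snd v \<and> f s g \<noteq> \<zero>}"
    show "finite ((\<lambda>(s, g). germ s g) ` ?X)"
      using B_memD(3)[OF f] steinberg_fibre_finite[OF B_memD(5)[OF f]]
      by (intro finite_imageI finite_SigmaI) (auto simp: fibre_finite_def)
    show "{c \<in> arr \<Gamma>. src \<Gamma> c = v \<and> pushforward f c \<noteq> \<zero>} \<subseteq> (\<lambda>(s, g). germ s g) ` ?X"
    proof
      fix c assume c: "c \<in> {c \<in> arr \<Gamma>. src \<Gamma> c = v \<and> pushforward f c \<noteq> \<zero>}"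
      then have "fsum A (\<lambda>(s, g). f s g) c \<noteq> \<zero>" by (auto simp: pushforward_def)
      then obtain s g where sg: "(s, g) \<in> c" "f s g \<noteq> \<zero>"
        using fsum_zero[of c "\<lambda>(s, g). f s g"] by auto
      obtain t h where th: "t \<in> arr S" "h \<in> D t" "c = germ t h" using c unfolding arr_\<Gamma> by blast
      have *: "s \<in> arr S" "g \<in> D s" "c = germ s g" using mem_germ_iff[OF th(1,2)] sg(1) th(3) by auto
      then have "(s, g) \<in> ?X"
        using c sg(2) D_arr[OF *(1,2)] by (auto simp: src_rng_germ)
      then show "c \<in> (\<lambda>(s, g). germ s g) ` ?X" using *(3) by (intro image_eqI[of _ _ "(s, g)"]) simp_all
    qed
  qed
  then show ?thesis by (simp add: fibre_finite_def pushforward_closed[OF f])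
qed

section \<open>Multiplicativity of the direct image\<close>

text \<open>If \<open>\<pi>\<close> is the identity, these are the pairs that occur in a convolution over \<open>P\<close>. If \<open>\<pi>\<close> sends an arrow
to its germ, they index the sum to which both sides of \<open>pushforward_mult\<close> are reduced.\<close>

definition factorizations :: "('s \<times> 'g \<Rightarrow> 'x) \<Rightarrow> 'x \<Rightarrow> (('s \<times> 'g) \<times> ('s \<times> 'g)) set" where
  "factorizations \<pi> z = {(p, r). composable P p r \<and> \<pi> (p \<cdot>\<^bsub>P\<^esub> r) = z}"

abbreviation term_at :: "('s \<Rightarrow> 'g \<Rightarrow> 'a) \<Rightarrow> ('s \<Rightarrow> 'g \<Rightarrow> 'a) \<Rightarrow> ('s \<times> 'g) \<times> ('s \<times> 'g) \<Rightarrow> 'a" where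
  "term_at f g \<equiv> \<lambda>(p, r). (case p of (s, a) \<Rightarrow> f s a) \<otimes> (case r of (t, b) \<Rightarrow> g t b)"

lemma term_at_closed: "f \<in> carrier B \<Longrightarrow> g \<in> carrier B \<Longrightarrow> term_at f g x \<in> carrier A"
  by (auto simp: B_memD(6) m_closed split: prod.split)

lemma term_at_nonzero:
  assumes f: "f \<in> carrier B" and g: "g \<in> carrier B" and "term_at f g ((s, a), (t, b)) \<noteq> \<zero>"
  shows "f s a \<noteq> \<zero>" "g t b \<noteq> \<zero>"
  using assms(3) l_null[OF B_memD(6)[OF g, of t b]] r_null[OF B_memD(6)[OF f, of s a]] by auto

lemma finite_composable_terms:
  assumes f: "f \<in> carrier B" and g: "g \<in> carrier B"
  shows "finite {x \<in> {(p, r). composable P p r \<and> snd (src P r) = v}. term_at f g x \<noteq> \<zero>}"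
proof (rule finite_subset)
  let ?Y = "SIGMA t:{t. g t \<noteq> (\<lambda>_. \<zero>)}. {b \<in> arr \<G>. src \<G> b = v \<and> g t b \<noteq> \<zero>}"
  let ?X = "\<lambda>r. case r of (t, b) \<Rightarrow> SIGMA s:{s. f s \<noteq> (\<lambda>_. \<zero>)}. {a \<in> arr \<G>. src \<G> a = rng \<G> (act t b) \<and> f s a \<noteq> \<zero>}"
  have "finite (?X r)" for r
    using B_memD(3)[OF f] steinberg_fibre_finite[OF B_memD(5)[OF f]]
    by (cases r) (auto intro!: finite_SigmaI simp: fibre_finite_def)
  moreover have "finite ?Y"
    using B_memD(3)[OF g] steinberg_fibre_finite[OF B_memD(5)[OF g]]
    by (auto intro!: finite_SigmaI simp: fibre_finite_def)
  ultimately show "finite (\<Union>r\<in>?Y. (\<lambda>p. (p, r)) ` ?X r)" by blast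
  show "{x \<in> {(p, r). composable P p r \<and> snd (src P r) = v}. term_at f g x \<noteq> \<zero>} \<subseteq> (\<Union>r\<in>?Y. (\<lambda>p. (p, r)) ` ?X r)"
  proof
    fix x assume x: "x \<in> {x \<in> {(p, r). composable P p r \<and> snd (src P r) = v}. term_at f g x \<noteq> \<zero>}"
    obtain s a t b where x_eq: "x = ((s, a), (t, b))" by (metis surj_pair)
    have c: "composable P (s, a) (t, b)" and v: "v = snd (src P (t, b))"
      and nz: "term_at f g ((s, a), (t, b)) \<noteq> \<zero>" using x unfolding x_eq by auto
    have nz': "f s a \<noteq> \<zero>" "g t b \<noteq> \<zero>" using term_at_nonzero[OF f g nz] by auto
    have "composable S s t" "b \<in> D t" "composable \<G> a (act t b)"
      using c by (simp_all add: composable_P)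
    then have "a \<in> arr \<G>" "b \<in> arr \<G>" "src \<G> a = rng \<G> (act t b)"
      using D_arr[of t b] unfolding composable_def by blast+
    then have "(t, b) \<in> ?Y" "(s, a) \<in> ?X (t, b)" using nz' v by auto
    then show "x \<in> (\<Union>r\<in>?Y. (\<lambda>p. (p, r)) ` ?X r)" unfolding x_eq by blast
  qed
qed

lemma composable_P_src:
  assumes "composable P p r"
  shows "src P (p \<cdot>\<^bsub>P\<^esub> r) = src P r" "p \<cdot>\<^bsub>P\<^esub> r \<in> arr P"
proof -
  obtain s a t b where pr: "p = (s, a)" "r = (t, b)" by (cases p, cases r)
  note c = composable_P_product[OF assms[unfolded pr]]
  have "src S (s \<cdot>\<^bsub>S\<^esub> t) = src S t" using assms unfolding pr composable_P by (simp add: S.src_prd)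
  then show "src P (p \<cdot>\<^bsub>P\<^esub> r) = src P r" unfolding pr prd_P by (simp add: c(3))
  show "p \<cdot>\<^bsub>P\<^esub> r \<in> arr P" unfolding pr prd_P by (rule c(6))
qed

lemma finite_factorization_terms:
  assumes f: "f \<in> carrier B" and g: "g \<in> carrier B"
    and \<pi>: "\<And>p. p \<in> arr P \<Longrightarrow> \<pi> p = z \<Longrightarrow> snd (src P p) = v"
  shows "finite {x \<in> factorizations \<pi> z. term_at f g x \<noteq> \<zero>}"
proof (rule finite_subset[OF _ finite_composable_terms[OF f g, of v]])
  have "snd (src P r) = v" if "composable P p r" "\<pi> (p \<cdot>\<^bsub>P\<^esub> r) = z" for p r
    using composable_P_src[OF that(1)] \<pi>[of "p \<cdot>\<^bsub>P\<^esub> r"] that(2) by simp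
  then show "{x \<in> factorizations \<pi> z. term_at f g x \<noteq> \<zero>} \<subseteq>
      {x \<in> {(p, r). composable P p r \<and> snd (src P r) = v}. term_at f g x \<noteq> \<zero>}"
    unfolding factorizations_def by auto
qed

lemma crossed_term:
  assumes xy: "composable S x y" and k: "k \<in> supported x" and l: "l \<in> supported y"
  shows "k \<in> steinberg_functions A \<G>" "translate y l \<in> supported (star S y)"
    "convolution A \<G> k (translate y l) \<in> supported (star S y)"
    "the (\<Theta> (star S y) (k \<otimes>\<^bsub>AG\<^esub> the (\<Theta> y l))) = translate (star S y) (convolution A \<G> k (translate y l))"
proof -
  have y: "y \<in> arr S" "x \<in> arr S" using xy by (simp_all add: composable_def)
  show k': "k \<in> steinberg_functions A \<G>" using k by (simp add: supported_def)
  have t: "translate y l \<in> steinberg_functions A \<G>"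
    using translate_closed[OF y(1)] l unfolding supported_def by blast
  show 2: "translate y l \<in> supported (star S y)" using t by (simp add: supported_def translate_def)
  have ff: "fibre_finite A \<G> k" "fibre_finite A \<G> (translate y l)"
    using steinberg_fibre_finite k' t by blast+
  have "convolution A \<G> k (translate y l) c = \<zero>" if c: "c \<notin> D (star S y)" for c
    unfolding convolution_fsum[OF ff]
  proof (rule fsum_zero, clarify)
    fix a b assume ab: "composable \<G> a b" "c = a \<cdot>\<^bsub>\<G>\<^esub> b"
    have "b \<notin> D (star S y)"
      using c D_connected[of "star S y" b c] ab y prd_closed[OF ab(1)] src_prd[OF ab(1)] by auto
    then show "k a \<otimes> translate y l b = \<zero>"
      using steinberg_function_closed[OF k'] by (simp add: translate_def r_null)
  qed
  then show 3: "convolution A \<G> k (translate y l) \<in> supported (star S y)"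
    using convolution_closed[OF k' t] by (simp add: supported_def)
  show "the (\<Theta> (star S y) (k \<otimes>\<^bsub>AG\<^esub> the (\<Theta> y l))) = translate (star S y) (convolution A \<G> k (translate y l))"
    using the_\<Theta>[OF y(1) l] the_\<Theta>[OF S.star_closed(1)[OF y(1)] 3] by simp
qed

text \<open>The left side is a sum over factorizations \<open>ab' = \<theta>\<^sub>y(h)\<close> in \<open>\<G>\<close>. Those with \<open>a \<in> D\<^sub>x\<close> and \<open>b'\<close> in the range of
\<open>\<theta>\<^sub>y\<close>, which include all nonzero terms, correspond to \<open>(x, a)(y, \<theta>\<^sub>y\<^sup>-\<^sup>1(b')) = (xy, h)\<close>.\<close>

lemma crossed_term_value:
  assumes f: "f \<in> carrier B" and g: "g \<in> carrier B" and xy: "composable S x y"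
  shows "translate (star S y) (convolution A \<G> (f x) (translate y (g y))) h =
    fsum A (term_at f g) {z \<in> factorizations (\<lambda>p. p) (x \<cdot>\<^bsub>S\<^esub> y, h). (\<lambda>(p, r). (fst p, fst r)) z = (x, y)}"
    (is "?L = fsum A _ ?Q")
proof -
  have arr: "x \<in> arr S" "y \<in> arr S" "star S y \<in> arr S" using xy by (simp_all add: composable_def)
  note t = crossed_term[OF xy B_memD(4)[OF f] B_memD(4)[OF g]]
  have t': "translate y (g y) \<in> steinberg_functions A \<G>" using t(2) by (simp add: supported_def)
  have ff: "fibre_finite A \<G> (f x)" "fibre_finite A \<G> (translate y (g y))"
    using steinberg_fibre_finite[OF t(1)] steinberg_fibre_finite[OF t'] by blast+
  show ?thesis
  proof (cases "h \<in> D y")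
    case False
    have "?Q = {}"
    proof (rule equals0I)
      fix q assume "q \<in> ?Q"
      then obtain a b where "composable P (x, a) (y, b)" "h = act (star S y) (a \<cdot>\<^bsub>\<G>\<^esub> act y b)"
        by (auto simp: factorizations_def prd_P)
      then show False using composable_P_product(4) False by blast
    qed
    then have "fsum A (term_at f g) ?Q = \<zero>" by (intro fsum_zero) blast
    then show ?thesis using False arr by (simp add: translate_def S.star_star)
  next
    case True
    let ?W = "{(a, b). composable \<G> a b \<and> a \<cdot>\<^bsub>\<G>\<^esub> b = act y h}"
    let ?W' = "{(a, b). composable \<G> a b \<and> a \<cdot>\<^bsub>\<G>\<^esub> b = act y h \<and> a \<in> D x \<and> b \<in> D (star S y)}"
    let ?F = "\<lambda>(a, b). f x a \<otimes> translate y (g y) b"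
    let ?\<sigma> = "\<lambda>(a, b). ((x, a), (y, act (star S y) b))"
    have FA: "?F p \<in> carrier A" for p
      using B_memD(6)[OF f] steinberg_function_closed[OF t'] by (cases p) (simp add: m_closed)
    have "?L = convolution A \<G> (f x) (translate y (g y)) (act y h)"
      using True arr by (simp add: translate_def[of "star S y"] S.star_star)
    also have "\<dots> = fsum A ?F ?W" by (rule convolution_fsum[OF ff])
    also have "\<dots> = fsum A ?F ?W'"
    proof (rule fsum_mono_neutral[symmetric])
      fix p assume p: "p \<in> ?W - ?W'"
      obtain a b where ab: "p = (a, b)" by (cases p)
      have "a \<notin> D x \<or> b \<notin> D (star S y)" using p ab by auto
      then have "f x a = \<zero> \<or> translate y (g y) b = \<zero>"
        using B_memD(4)[OF f, of x] t(2) by (auto simp: supported_def)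
      then show "?F p = \<zero>"
        using ab B_memD(6)[OF f] steinberg_function_closed[OF t'] l_null r_null by auto
    qed auto
    also have "\<dots> = fsum A (\<lambda>p. term_at f g (?\<sigma> p)) ?W'"
    proof (rule fsum_cong[OF refl])
      fix p assume "p \<in> ?W'"
      then show "?F p = term_at f g (?\<sigma> p)" by (auto simp: translate_def)
    qed (rule term_at_closed[OF f g])
    also have "\<dots> = fsum A (term_at f g) ?Q"
    proof (rule fsum_reindex[symmetric])
      show "bij_betw ?\<sigma> ?W' ?Q"
      proof (rule bij_betwI')
        fix p p' assume "p \<in> ?W'" "p' \<in> ?W'"
        then show "(?\<sigma> p = ?\<sigma> p') = (p = p')"
          using inj_onD[OF act_inj[OF arr(3)]] by (cases p, cases p') auto
      next
        fix p assume "p \<in> ?W'"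
        then obtain a b where p: "p = (a, b)" "composable \<G> a b" "a \<cdot>\<^bsub>\<G>\<^esub> b = act y h" "a \<in> D x" "b \<in> D (star S y)"
          by auto
        note b = act_star'[OF arr(2) p(5)]
        have "composable P (x, a) (y, act (star S y) b)" using p b xy by (simp add: composable_P)
        moreover have "act (star S y) (a \<cdot>\<^bsub>\<G>\<^esub> act y (act (star S y) b)) = h"
          using b p(3) act_star(2)[OF arr(2) True] by simp
        ultimately show "?\<sigma> p \<in> ?Q" using p(1) by (simp add: factorizations_def prd_P)
      next
        fix q assume "q \<in> ?Q"
        then obtain a b where q: "q = ((x, a), (y, b))" "composable P (x, a) (y, b)"
          "act (star S y) (a \<cdot>\<^bsub>\<G>\<^esub> act y b) = h"
          by (auto simp: factorizations_def prd_P)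
        have "a \<cdot>\<^bsub>\<G>\<^esub> act y b = act y h" using composable_P_product(5)[OF q(2)] q(3) by simp
        moreover have "a \<in> D x" "b \<in> D y" "composable \<G> a (act y b)" using q(2) by (simp_all add: composable_P)
        ultimately have "(a, act y b) \<in> ?W'" "q = ?\<sigma> (a, act y b)"
          using act_star[OF arr(2), of b] q(1) by auto
        then show "\<exists>p\<in>?W'. q = ?\<sigma> p" by blast
      qed
    qed (rule term_at_closed[OF f g])
    finally show ?thesis .
  qed
qed

text \<open>Read on the semidirect product, the crossed multiplication is convolution.\<close>

lemma crossed_mult_value:
  assumes f: "f \<in> carrier B" and g: "g \<in> carrier B"
  shows "crossed_mult S AG \<Theta> f g s \<in> steinberg_functions A \<G>"
    and "crossed_mult S AG \<Theta> f g s h = fsum A (term_at f g) (factorizations (\<lambda>p. p) (s, h))"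
proof -
  let ?Z = "{(x, y). composable S x y \<and> x \<cdot>\<^bsub>S\<^esub> y = s \<and> f x \<noteq> (\<lambda>_. \<zero>) \<and> g y \<noteq> (\<lambda>_. \<zero>)}"
  let ?t = "\<lambda>(x, y). translate (star S y) (convolution A \<G> (f x) (translate y (g y)))"
  have fin: "finite ?Z"
    by (rule finite_subset[of _ "{x. f x \<noteq> (\<lambda>_. \<zero>)} \<times> {y. g y \<noteq> (\<lambda>_. \<zero>)}"])
      (use B_memD(3)[OF f] B_memD(3)[OF g] in auto)
  have t: "?t z \<in> carrier AG" if Z: "z \<in> ?Z" for z
  proof -
    obtain x y where z: "z = (x, y)" "composable S x y" using Z by blast
    have y: "star S y \<in> arr S" using z(2) by (simp add: composable_def)
    show ?thesis
      using translate_closed[OF y] crossed_term(3)[OF z(2) B_memD(4)[OF f] B_memD(4)[OF g]] z(1)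
      by (simp add: supported_def)
  qed
  have eq: "crossed_mult S AG \<Theta> f g s = finsum AG ?t ?Z"
    unfolding crossed_mult_def steinberg_algebra_simps(3)
  proof (rule AG.finsum_cong'[OF refl])
    show "?t \<in> ?Z \<rightarrow> carrier AG" using t by blast
    fix z assume "z \<in> ?Z"
    then obtain x y where z: "z = (x, y)" "composable S x y" by blast
    show "(case z of (x, y) \<Rightarrow> the (\<Theta> (star S y) (f x \<otimes>\<^bsub>AG\<^esub> the (\<Theta> y (g y))))) = ?t z"
      using crossed_term(4)[OF z(2) B_memD(4)[OF f] B_memD(4)[OF g]] z(1) by simp
  qed
  have "finsum AG ?t ?Z \<in> carrier AG" by (rule AG.finsum_closed) (use t in blast)
  then show "crossed_mult S AG \<Theta> f g s \<in> steinberg_functions A \<G>" unfolding eq by simp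
  have "crossed_mult S AG \<Theta> f g s h = finsum A (\<lambda>z. ?t z h) ?Z"
    unfolding eq
    by (rule finsum_pointwise[OF abelian_group_axioms AG.abelian_group_axioms])
      (use fin t steinberg_function_closed in auto)
  also have "\<dots> = fsum A (\<lambda>z. ?t z h) ?Z"
    by (rule fsum_eq_finsum[symmetric, OF fin])
      (use steinberg_function_closed[OF t[unfolded steinberg_algebra_simps]] in blast)+
  also have "\<dots> = fsum A (\<lambda>z. fsum A (term_at f g)
      {w \<in> factorizations (\<lambda>p. p) (s, h). (\<lambda>(p, r). (fst p, fst r)) w = z}) ?Z"
  proof (rule fsum_cong[OF refl])
    fix z assume "z \<in> ?Z"
    then obtain x y where z: "z = (x, y)" "composable S x y" "x \<cdot>\<^bsub>S\<^esub> y = s" by blast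
    show "?t z h = fsum A (term_at f g)
        {w \<in> factorizations (\<lambda>p. p) (s, h). (\<lambda>(p, r). (fst p, fst r)) w = z}"
      using crossed_term_value[OF f g z(2), of h] z(1,3) by simp
    show "fsum A (term_at f g)
        {w \<in> factorizations (\<lambda>p. p) (s, h). (\<lambda>(p, r). (fst p, fst r)) w = z} \<in> carrier A"
      by (rule fsum_closed) (rule term_at_closed[OF f g])
  qed
  also have "\<dots> = fsum A (term_at f g) (factorizations (\<lambda>p. p) (s, h))"
  proof (rule fsum_fibres[symmetric])
    show "finite {w \<in> factorizations (\<lambda>p. p) (s, h). term_at f g w \<noteq> \<zero>}"
      by (rule finite_factorization_terms[OF f g, of _ _ "src \<G> h"]) auto
    show "term_at f g w \<in> carrier A" for w by (rule term_at_closed[OF f g])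
    fix w assume w: "w \<in> factorizations (\<lambda>p. p) (s, h)" "term_at f g w \<noteq> \<zero>"
    obtain x a y b where w_eq: "w = ((x, a), (y, b))" by (metis surj_pair)
    have "composable S x y" "x \<cdot>\<^bsub>S\<^esub> y = s"
      using w(1) unfolding w_eq factorizations_def by (auto simp: composable_P prd_P)
    moreover have "f x a \<noteq> \<zero>" "g y b \<noteq> \<zero>" using term_at_nonzero[OF f g] w(2) unfolding w_eq by blast+
    then have "f x \<noteq> (\<lambda>_. \<zero>)" "g y \<noteq> (\<lambda>_. \<zero>)" by auto
    ultimately show "(\<lambda>(p, r). (fst p, fst r)) w \<in> ?Z" by (simp add: w_eq)
  qed
  finally show "crossed_mult S AG \<Theta> f g s h = fsum A (term_at f g) (factorizations (\<lambda>p. p) (s, h))" .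
qed

lemma crossed_mult_closed:
  assumes f: "f \<in> carrier B" and g: "g \<in> carrier B"
  shows "crossed_mult S AG \<Theta> f g \<in> carrier B"
proof (rule B_memI)
  have off: "crossed_mult S AG \<Theta> f g s h = \<zero>" if "(s, h) \<notin> arr P" for s h
  proof -
    have "factorizations (\<lambda>p. p) (s, h) = {}"
      using composable_P_src(2) that unfolding factorizations_def by force
    then show ?thesis unfolding crossed_mult_value(2)[OF f g] by (intro fsum_zero) blast
  qed
  show "crossed_mult S AG \<Theta> f g s \<in> supported s" if "s \<in> arr S" for s
    using crossed_mult_value(1)[OF f g] off that unfolding supported_def arr_P by blast
  show "crossed_mult S AG \<Theta> f g s = (\<lambda>_. \<zero>)" if "s \<notin> arr S" for s
    using off that unfolding arr_P by blast
  let ?F = "(\<lambda>(x, y). x \<cdot>\<^bsub>S\<^esub> y) ` ({x. f x \<noteq> (\<lambda>_. \<zero>)} \<times> {y. g y \<noteq> (\<lambda>_. \<zero>)})"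
  show "finite ?F" using B_memD(3)[OF f] B_memD(3)[OF g] by blast
  show "crossed_mult S AG \<Theta> f g s = (\<lambda>_. \<zero>)" if s: "s \<notin> ?F" for s
  proof
    fix h
    have "term_at f g w = \<zero>" if w: "w \<in> factorizations (\<lambda>p. p) (s, h)" for w
    proof (rule ccontr)
      assume nz: "term_at f g w \<noteq> \<zero>"
      obtain x a y b where w_eq: "w = ((x, a), (y, b))" by (metis surj_pair)
      have "x \<cdot>\<^bsub>S\<^esub> y = s" using w unfolding w_eq factorizations_def by (auto simp: prd_P)
      moreover have "f x a \<noteq> \<zero>" "g y b \<noteq> \<zero>" using term_at_nonzero[OF f g] nz unfolding w_eq by blast+
      then have "f x \<noteq> (\<lambda>_. \<zero>)" "g y \<noteq> (\<lambda>_. \<zero>)" by auto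
      ultimately show False using s by (auto simp: image_iff)
    qed
    then show "crossed_mult S AG \<Theta> f g s h = \<zero>"
      unfolding crossed_mult_value(2)[OF f g] by (rule fsum_zero)
  qed
qed

text \<open>Composability and products of germs can be computed on arbitrary representatives. Hence both sides
are the sum of \<open>f(p)g(r)\<close> over all composable pairs \<open>(p, r)\<close> whose product belongs to the class \<open>c\<close>.\<close>

lemma pushforward_mult:
  assumes f: "f \<in> carrier B" and g: "g \<in> carrier B"
  shows "pushforward (crossed_mult S AG \<Theta> f g) = convolution A \<Gamma> (pushforward f) (pushforward g)"
proof
  fix c
  let ?M = "factorizations (\<lambda>p. E `` {p}) c" and ?Z = "{(d, e). composable \<Gamma> d e \<and> d \<cdot>\<^bsub>\<Gamma>\<^esub> e = c}"
  have cls: "E `` {p} = d" if "d \<in> arr \<Gamma>" "p \<in> d" for p d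
  proof -
    obtain s a where d: "s \<in> arr S" "a \<in> D s" "d = germ s a" using \<open>d \<in> arr \<Gamma>\<close> unfolding arr_\<Gamma> by blast
    show ?thesis
      using that(2) mem_germ_iff[OF d(1,2), of "fst p" "snd p"] by (simp add: d(3) germ_def)
  qed
  have class_arr: "E `` {p} \<in> arr \<Gamma>" "p \<in> E `` {p}" if "p \<in> arr P" for p
  proof -
    obtain s a where p: "p = (s, a)" by (cases p)
    have sa: "s \<in> arr S" "a \<in> D s" using that by (simp_all add: p arr_P)
    show "E `` {p} \<in> arr \<Gamma>" unfolding arr_\<Gamma> p using sa by (auto simp: germ_def)
    show "p \<in> E `` {p}" using germ_eq_self[OF sa] by (simp add: p germ_def)
  qed
  have M: "p \<in> arr P \<and> r \<in> arr P \<and> composable \<Gamma> (E `` {p}) (E `` {r}) \<and>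
      (E `` {p}) \<cdot>\<^bsub>\<Gamma>\<^esub> (E `` {r}) = E `` {p \<cdot>\<^bsub>P\<^esub> r}" if c: "composable P p r" for p r
  proof -
    obtain s a t b where pr: "p = (s, a)" "r = (t, b)" by (cases p, cases r)
    have arr: "p \<in> arr P" "r \<in> arr P" using c unfolding composable_def by blast+
    then have st: "s \<in> arr S" "a \<in> D s" "t \<in> arr S" "b \<in> D t" by (simp_all add: pr arr_P)
    show ?thesis
      using arr prd_germ[OF c] composable_germ[OF st] c by (simp add: pr germ_def)
  qed
  have fin: "finite {x \<in> ?M. term_at f g x \<noteq> \<zero>}"
  proof (rule finite_factorization_terms[OF f g, of _ _ "snd (src \<Gamma> c)"])
    fix p assume p: "p \<in> arr P" "E `` {p} = c"
    obtain s a where "p = (s, a)" by (cases p)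
    then show "snd (src P p) = snd (src \<Gamma> c)"
      using p src_rng_germ(1)[of s a] by (simp add: arr_P germ_def)
  qed
  have T: "term_at f g x \<in> carrier A" for x by (rule term_at_closed[OF f g])
  have "convolution A \<Gamma> (pushforward f) (pushforward g) c =
      fsum A (\<lambda>(d, e). pushforward f d \<otimes> pushforward g e) ?Z"
    by (rule \<Gamma>.convolution_fsum[OF fibre_finite_pushforward[OF f] fibre_finite_pushforward[OF g]])
  also have "\<dots> = fsum A (\<lambda>z. fsum A (term_at f g) {x \<in> ?M. (\<lambda>(p, r). (E `` {p}, E `` {r})) x = z}) ?Z"
  proof (rule fsum_cong[OF refl])
    fix z assume "z \<in> ?Z"
    then obtain d e where z: "z = (d, e)" "composable \<Gamma> d e" "d \<cdot>\<^bsub>\<Gamma>\<^esub> e = c" by blast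
    have de: "d \<in> arr \<Gamma>" "e \<in> arr \<Gamma>" using z(2) by (simp_all add: composable_def)
    have "{x \<in> ?M. (\<lambda>(p, r). (E `` {p}, E `` {r})) x = z} = d \<times> e"
    proof (intro equalityI subsetI)
      fix x assume x: "x \<in> {x \<in> ?M. (\<lambda>(p, r). (E `` {p}, E `` {r})) x = z}"
      obtain p r where pr: "x = (p, r)" by (cases x)
      have "composable P p r" "E `` {p} = d" "E `` {r} = e" using x unfolding pr z(1) factorizations_def by auto
      then show "x \<in> d \<times> e" using M class_arr(2) unfolding pr by blast
    next
      fix x assume "x \<in> d \<times> e"
      then obtain p r where pr: "x = (p, r)" "p \<in> d" "r \<in> e" by blast
      have cl: "E `` {p} = d" "E `` {r} = e" using cls de pr by blast+
      obtain s a t b where st: "p = (s, a)" "r = (t, b)" by (cases p, cases r)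
      obtain s' a' where d: "s' \<in> arr S" "a' \<in> D s'" "d = germ s' a'" using de(1) unfolding arr_\<Gamma> by blast
      obtain t' b' where e: "t' \<in> arr S" "b' \<in> D t'" "e = germ t' b'" using de(2) unfolding arr_\<Gamma> by blast
      have arr: "s \<in> arr S" "a \<in> D s" "t \<in> arr S" "b \<in> D t"
        using mem_germ_iff[OF d(1,2)] mem_germ_iff[OF e(1,2)] pr(2,3) unfolding st d(3) e(3) by blast+
      have "composable P p r"
        using composable_germ[OF arr] z(2) cl unfolding st germ_def by simp
      moreover have "E `` {p \<cdot>\<^bsub>P\<^esub> r} = c" using M[OF calculation] cl z(3) by simp
      ultimately show "x \<in> {x \<in> ?M. (\<lambda>(p, r). (E `` {p}, E `` {r})) x = z}"
        using cl by (simp add: pr(1) z(1) factorizations_def)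
    qed
    moreover have "pushforward f d \<otimes> pushforward g e = fsum A (term_at f g) (d \<times> e)"
      using fsum_mult[OF finite_germ_terms[OF f de(1)] _ finite_germ_terms[OF g de(2)]] de
      by (auto simp: pushforward_def B_memD(6)[OF f] B_memD(6)[OF g])
    ultimately show "(case z of (d, e) \<Rightarrow> pushforward f d \<otimes> pushforward g e) =
        fsum A (term_at f g) {x \<in> ?M. (\<lambda>(p, r). (E `` {p}, E `` {r})) x = z}"
      by (simp add: z(1))
  qed (rule fsum_closed[OF T])
  also have "\<dots> = fsum A (term_at f g) ?M"
  proof (rule fsum_fibres[symmetric, OF fin T])
    fix x assume "x \<in> ?M"
    then show "(\<lambda>(p, r). (E `` {p}, E `` {r})) x \<in> ?Z" using M by (cases x) (auto simp: factorizations_def)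
  qed
  finally have R: "convolution A \<Gamma> (pushforward f) (pushforward g) c = fsum A (term_at f g) ?M" .
  show "pushforward (crossed_mult S AG \<Theta> f g) c = convolution A \<Gamma> (pushforward f) (pushforward g) c"
  proof (cases "c \<in> arr \<Gamma>")
    case True
    have "fsum A (term_at f g) ?M =
        fsum A (\<lambda>q. fsum A (term_at f g) {x \<in> ?M. (\<lambda>(p, r). p \<cdot>\<^bsub>P\<^esub> r) x = q}) c"
    proof (rule fsum_fibres[OF fin T])
      fix x assume x: "x \<in> ?M"
      obtain p r where pr: "x = (p, r)" by (cases x)
      have c: "composable P p r" "E `` {p \<cdot>\<^bsub>P\<^esub> r} = c" using x unfolding pr factorizations_def by auto
      show "(\<lambda>(p, r). p \<cdot>\<^bsub>P\<^esub> r) x \<in> c"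
        using class_arr(2)[OF composable_P_src(2)[OF c(1)]] unfolding pr prod.case c(2) .
    qed
    also have "\<dots> = fsum A (\<lambda>(s, h). crossed_mult S AG \<Theta> f g s h) c"
    proof (rule fsum_cong[OF refl])
      fix q assume q: "q \<in> c"
      obtain s h where sh: "q = (s, h)" by (cases q)
      have "{x \<in> ?M. (\<lambda>(p, r). p \<cdot>\<^bsub>P\<^esub> r) x = q} = factorizations (\<lambda>p. p) (s, h)"
        using cls[OF True q] unfolding factorizations_def sh by auto
      then show "fsum A (term_at f g) {x \<in> ?M. (\<lambda>(p, r). p \<cdot>\<^bsub>P\<^esub> r) x = q} =
          (case q of (s, h) \<Rightarrow> crossed_mult S AG \<Theta> f g s h)"
        using crossed_mult_value(2)[OF f g] by (simp add: sh)
      show "(case q of (s, h) \<Rightarrow> crossed_mult S AG \<Theta> f g s h) \<in> carrier A"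
        using steinberg_function_closed[OF crossed_mult_value(1)[OF f g]] by (simp add: sh)
    qed
    finally show ?thesis unfolding R using True by (simp add: pushforward_def)
  next
    case False
    have "?M = {}"
      using False class_arr(1)[OF composable_P_src(2)] unfolding factorizations_def by blast
    then have "fsum A (term_at f g) ?M = \<zero>" by (intro fsum_zero) blast
    then show ?thesis unfolding R using False by (simp add: pushforward_def)
  qed
qed

section \<open>The isomorphism\<close>

text \<open>At an arrow of \<open>D\<^sub>s \<inter> D\<^sub>t\<close> the germs of \<open>s\<close> and \<open>t\<close> coincide, and \<open>a\<close> vanishes elsewhere.\<close>

lemma pushforward_delta_le:
  assumes st: "canonical_le S s t" and a: "a \<in> supported s" "a \<in> supported t"
  shows "pushforward (delta AG s a) = pushforward (delta AG t a)"
proof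
  fix c
  have arr: "s \<in> arr S" "t \<in> arr S" using S.canonical_leD(1,2)[OF st] .
  have eq: "germ s g = germ t g" if "g \<in> D s" "g \<in> D t" for g
    using germ_eq_iff[OF arr(1) that(1) arr(2) that(2)] S.canonical_le_refl[OF arr(1)] st that(1) by blast
  show "pushforward (delta AG s a) c = pushforward (delta AG t a) c"
  proof (cases "c \<in> germ s ` (D s \<inter> D t)")
    case True
    then obtain g where "g \<in> D s" "g \<in> D t" "c = germ s g" by blast
    then show ?thesis
      using pushforward_delta(1)[OF arr(1) a(1), of g] pushforward_delta(1)[OF arr(2) a(2), of g] eq by simp
  next
    case False
    have "pushforward (delta AG s a) c = \<zero>"
    proof (cases "c \<in> germ s ` D s")
      case True
      then obtain g where "g \<in> D s" "c = germ s g" "g \<notin> D t" using False by blast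
      then show ?thesis using pushforward_delta(1)[OF arr(1) a(1), of g] a(2) by (simp add: supported_def)
    qed (rule pushforward_delta(2)[OF arr(1) a(1)])
    moreover have "pushforward (delta AG t a) c = \<zero>"
    proof (cases "c \<in> germ t ` D t")
      case True
      then obtain g where g: "g \<in> D t" "c = germ t g" by blast
      then have "g \<notin> D s" using False eq by blast
      then show ?thesis using g pushforward_delta(1)[OF arr(2) a(2), of g] a(1) by (simp add: supported_def)
    qed (rule pushforward_delta(2)[OF arr(2) a(2)])
    ultimately show ?thesis by simp
  qed
qed

theorem germ_algebra_isomorphic:
  "bimod_algebra_isomorphic R (steinberg_algebra A \<Gamma>)
    (bimod_algebra_quotient B (bimod_algebra_genideal R B
      {delta AG s a \<ominus>\<^bsub>B\<^esub> delta AG t a | s t a.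
        canonical_le S s t \<and> a \<in> dom (\<Theta> s) \<inter> dom (\<Theta> t)}))"
proof -
  let ?X = "{delta AG s a \<ominus>\<^bsub>B\<^esub> delta AG t a | s t a.
    canonical_le S s t \<and> a \<in> dom (\<Theta> s) \<inter> dom (\<Theta> t)}"
  let ?K = "{f \<in> carrier B. pushforward f = \<zero>\<^bsub>steinberg_algebra A \<Gamma>\<^esub>}"
  let ?C = "steinberg_algebra A \<Gamma>"
  interpret C: abelian_group ?C by (rule steinberg_abelian_group)
  have ls: "(\<lambda>s x. r \<triangleright> f s x) \<in> carrier B" "pushforward (\<lambda>s x. r \<triangleright> f s x) = (\<lambda>c. r \<triangleright> pushforward f c)"
    and rs: "(\<lambda>s x. f s x \<triangleleft> r) \<in> carrier B" "pushforward (\<lambda>s x. f s x \<triangleleft> r) = (\<lambda>c. pushforward f c \<triangleleft> r)"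
    if "r \<in> carrier R" "f \<in> carrier B" for r f
    using that B_additive[of f "\<lambda>a. r \<triangleright> a"] pushforward_additive[of f "\<lambda>a. r \<triangleright> a"]
      B_additive[of f "\<lambda>a. a \<triangleleft> r"] pushforward_additive[of f "\<lambda>a. a \<triangleleft> r"]
      lsmult_closed lsmult_r_distr rsmult_closed rsmult_l_distr by simp_all
  have add: "pushforward (f \<oplus>\<^bsub>B\<^esub> g) = pushforward f \<oplus>\<^bsub>steinberg_algebra A \<Gamma>\<^esub> pushforward g"
    if "f \<in> carrier B" "g \<in> carrier B" for f g
    using pushforward_add[OF that] by simp
  have minus: "pushforward (\<ominus>\<^bsub>B\<^esub> f) = \<ominus>\<^bsub>?C\<^esub> pushforward f" if f: "f \<in> carrier B" for f
  proof (rule C.minus_equality[symmetric])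
    show "pushforward (\<ominus>\<^bsub>B\<^esub> f) \<oplus>\<^bsub>?C\<^esub> pushforward f = \<zero>\<^bsub>?C\<^esub>"
      unfolding add[OF B.a_inv_closed[OF f] f, symmetric] B.l_neg[OF f] pushforward_zero by simp
  qed (use pushforward_steinberg f in simp_all)
  have "bimod_algebra_isomorphic R (steinberg_algebra A \<Gamma>) (bimod_algebra_quotient B ?K)"
  proof (rule bimod_algebra_first_isomorphism[OF B_abelian_group C.abelian_group_axioms])
    show "pushforward ` carrier B = carrier (steinberg_algebra A \<Gamma>)" by (simp add: pushforward_surj)
  qed (use add crossed_mult_closed pushforward_mult ls rs in \<open>simp_all add: B_simps(2,5,6)\<close>)
  moreover have "?K = bimod_algebra_genideal R B ?X"
  proof
    show "?K \<subseteq> bimod_algebra_genideal R B ?X"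
      unfolding bimod_algebra_genideal_def
    proof (intro subsetI InterI)
      fix f J assume f: "f \<in> ?K" and "J \<in> {J. bimod_algebra_ideal R J B \<and> ?X \<subseteq> J}"
      then have J: "additive_subgroup J B" "?X \<subseteq> J" by (simp_all add: bimod_algebra_ideal_def)
      show "f \<in> J"
      proof (rule pushforward_kernel[OF J(1)])
        fix s t k assume st: "canonical_le S s t" "k \<in> supported s" "k \<in> supported t"
        then have "k \<in> dom (\<Theta> s) \<inter> dom (\<Theta> t)" using dom_\<Theta> S.canonical_leD(1,2) by blast
        then show "delta AG s k \<ominus>\<^bsub>B\<^esub> delta AG t k \<in> J" using J(2) st(1) by blast
      qed (use f in simp_all)
    qed
    have "bimod_algebra_ideal R ?K B"
      unfolding bimod_algebra_ideal_def
    proof (intro conjI ballI)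
      show "additive_subgroup ?K B"
      proof (rule additive_subgroup.intro, rule B.add.subgroupI, goal_cases)
        case 1
        then show ?case by auto
      next
        case 2
        have "\<zero>\<^bsub>B\<^esub> \<in> ?K" using pushforward_zero by simp
        then show ?case by blast
      next
        case (3 f)
        then show ?case using minus[of f] C.add.inv_one by (simp add: a_inv_def)
      next
        case (4 f g)
        then show ?case using add[of f g] by simp
      qed
    qed (use crossed_mult_closed pushforward_mult ls rs lsmult_null rsmult_null \<Gamma>.convolution_zero
        in \<open>simp_all add: B_simps(2,5,6)\<close>)
    moreover have "?X \<subseteq> ?K"
    proof
      fix f assume "f \<in> ?X"
      then obtain s t a where f: "f = delta AG s a \<ominus>\<^bsub>B\<^esub> delta AG t a"
        and st: "canonical_le S s t" "a \<in> dom (\<Theta> s)" "a \<in> dom (\<Theta> t)" by blast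
      have arr: "s \<in> arr S" "t \<in> arr S" using S.canonical_leD(1,2)[OF st(1)] .
      have a: "a \<in> supported s" "a \<in> supported t" using st(2,3) dom_\<Theta> arr by blast+
      have d: "delta AG s a \<in> carrier B" "delta AG t a \<in> carrier B" using delta_closed arr a by blast+
      have p: "pushforward (delta AG t a) \<in> carrier ?C" using pushforward_steinberg[OF d(2)] by simp
      have "pushforward f = pushforward (delta AG s a) \<oplus>\<^bsub>?C\<^esub> \<ominus>\<^bsub>?C\<^esub> pushforward (delta AG t a)"
        unfolding f B.minus_eq add[OF d(1) B.a_inv_closed[OF d(2)]] minus[OF d(2)] ..
      also have "\<dots> = \<zero>\<^bsub>?C\<^esub>"
        unfolding pushforward_delta_le[OF st(1) a] by (rule C.r_neg[OF p])
      finally show "f \<in> ?K" using d f B.minus_closed by simp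
    qed
    ultimately show "bimod_algebra_genideal R B ?X \<subseteq> ?K"
      unfolding bimod_algebra_genideal_def by blast
  qed
  ultimately show ?thesis by simp
qed

end

theorem corollary5p23:
  fixes S :: "('s, 'w) top_semigroupoid"
    and \<G> :: "('g, 'v) top_semigroupoid"
    and R :: "'r ring"
    and A :: "('r, 'a) bimod_algebra"
    and \<theta> :: "'s \<Rightarrow> 'g \<rightharpoonup> 'g"
    and \<Theta> :: "'s \<Rightarrow> ('g \<Rightarrow> 'a) \<rightharpoonup> ('g \<Rightarrow> 'a)"
    and AG :: "('r, 'g \<Rightarrow> 'a) bimod_algebra"
    and B :: "('r, 's \<Rightarrow> 'g \<Rightarrow> 'a) bimod_algebra"
  assumes "inverse_semigroupoid S" and "discrete_semigroupoid S"
    and "ample_groupoid \<G>"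
    and "ring R" and "bimod_algebra R A"
    and "wedge_preaction S \<G> \<theta>"
    and "continuous_preaction S \<G> \<theta>"
    and "associative_preaction S \<G> \<theta>"
    and "open_preaction S \<G> \<theta>"
    and "AG = steinberg_algebra A \<G>"
    and "\<Theta> = induced_preaction A \<G> \<theta>"
    and "B = crossed_product S AG \<Theta>"
  shows "bimod_algebra_isomorphic R
           (steinberg_algebra A (germ_groupoid S \<G> \<theta>))
           (bimod_algebra_quotient B
             (bimod_algebra_genideal R B
               {delta AG s a \<ominus>\<^bsub>B\<^esub> delta AG t a | s t a.
                  canonical_le S s t \<and> a \<in> dom (\<Theta> s) \<inter> dom (\<Theta> t)}))"
proof -
  have "groupoid \<G>" using assms(3) by (rule ample_groupoid.axioms(1))
  then interpret ample_preaction R A S \<G> \<theta>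
    using assms by (intro ample_preaction.intro ample_algebra.intro groupoid_preaction.intro
        ample_preaction_axioms.intro)
  show ?thesis unfolding assms(10-12) by (rule germ_algebra_isomorphic)
qed

end
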